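(* Let $\ell=0$, let $G$ be an admissible kernel of order $m$ with parameters $d>m$, $L>0$, $T_*\in(0,\infty]$, and let $F$ satisfy the structure condition of order $0$ (all as defined in the context, with associated $A$, ${\bf p}$, $|{\bf p}|$, $\langle{\bf p}\rangle_0$ and $r_0$). Assume $r_0<1$. Then there exists $\gamma>0$ such that for every locally integrable function $\phi$ on $\mathbb{R}^N$ there is a constant $C>0$, independent of $T$, with the following property: if $$\sup_{x\in\mathbb{R}^N}\frac1{|B(x,T^{1/d})|}\int_{B(x,T^{1/d})}|\phi(y)|\,dy\le\gamma\,T^{-\frac{N}{dr_0}}$$ for some $T\in(0,\infty)$ with $T\le T_*$, then the integral equation (I) displayed in the context possesses a solution $u$ in $\mathbb{R}^N\times[0,T)$ such that $$|\nabla^ju(x,t)|\le C\,t^{-\frac Nd-\frac jd}$$ for $(x,t)\in\mathbb{R}^N\times(0,T)$ and $j\in\{0,\dots,m\}$.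
   Context: Setting. $N\ge1$, $m\in\{0,1,2,\dots\}$, $a_0\in\mathbb{R}$. $\nabla^j=\nabla_x^j$ denotes the collection of all $j$-th order partial derivatives in $x$. $B(x,\sigma)$ is the open ball of centre $x$ and radius $\sigma$. $D_m:=\sum_{j=0}^mN^j$. Integral equation (I) (case $\ell=0$): $$u(x,t)=\int_{\mathbb{R}^N}G(x,y,t)\phi(y)\,dy+a_0\int_0^t\int_{\mathbb{R}^N}G(x,y,t-s)\,F\bigl(y,s,u(y,s),\dots,\nabla^mu(y,s)\bigr)\,dy\,ds.$$ Admissible kernel of order $m$ with parameters $d>m$, $L>0$, $T_*\in(0,\infty]$: a real function $G=G(x,y,t)$ such that (i) $G\in C^{m}(\mathbb{R}^{2N}\times(0,T_* ))$; (ii) there is $C_G>0$ with $|\nabla_x^jG(x,y,t)|\le C_G\,t^{-\frac{N+j}{d}}(1+t^{-\frac1d}|x-y|)^{-N-L-j}$ for $(x,y,t)\in\mathbb{R}^{2N}\times(0,T_* )$, $j\in\{0,\dots,m\}$; (iii) $G(x,z,t)=\int_{\mathbb{R}^N}G(x,y,t-s)G(y,z,s)\,dy$ for $x,z\in\mathbb{R}^N$, $0<s<t<T_*$. Structure condition of order $0$ on $F$ (with $\ell=0$): (i) $F$ is a continuous real function on $\mathbb{R}^N\times[0,\infty)\times\mathbb{R}^{D_m}$; (ii) there exist $J\subset\{0,\dots,m\}$, ${\bf p}=\{p_j\}_{j\in J}\subset(0,\infty)$ and $A>-1$ such that $|{\bf p}|:=\sum_{j\in J}p_j>1$ and $|F(x,t,z_0,\dots,z_m)|\le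 t^A\prod_{j\in J}|z_j|^{p_j}$ for $(x,t)\in\mathbb{R}^N\times[0,\infty)$, $z_j\in\mathbb{R}^{N^j}$; (iii) with $\langle{\bf p}\rangle_0:=\sum_{j\in J}j\,p_j$, one has $d(1+A)>\langle{\bf p}\rangle_0$. Define $r_0:=\dfrac{N(|{\bf p}|-1)}{d(1+A)-\langle{\bf p}\rangle_0}$. Solution: $u$ is a solution of (I) in $\mathbb{R}^N\times[0,T)$ if for every $\tau\in(0,T)$ and $j\in\{0,\dots,m\}$, $\nabla_x^ju$ exists and is bounded and continuous on $\mathbb{R}^N\times(\tau,T)$, and $u$ satisfies (I) for all $(x,t)\in\mathbb{R}^N\times(0,T)$. *)

theory Defs
  imports "HOL-Analysis.Analysis"
begin

text \<open>
  Throughout, $\mathbf{R}^N$ is an arbitrary Euclidean space of type \<open>'a\<close>, with $N = $ \<open>DIM('a)\<close>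
  (automatically at least 1). A $j$-th order partial derivative is indexed by the list of the
  $j$ basis vectors in whose directions one differentiates, so that $\nabla^j f$ has $N^j$
  components, one for each element of \<open>indices j\<close>.
\<close>

definition indices :: "nat \<Rightarrow> 'a::euclidean_space list set" where
  "indices j = {bs. set bs \<subseteq> Basis \<and> length bs = j}"

lemma finite_indices: "finite (indices j :: 'a::euclidean_space list set)"
  unfolding indices_def by (rule finite_lists_length_eq) simp

lemma card_indices: "card (indices j :: 'a::euclidean_space list set) = DIM('a) ^ j"
  unfolding indices_def by (rule card_lists_length_eq) simp

fun pderivs :: "'a::euclidean_space list \<Rightarrow> ('a \<Rightarrow> real) \<Rightarrow> 'a \<Rightarrow> real" where
  "pderivs [] f = f"
| "pderivs (b # bs) f = (\<lambda>x. deriv (\<lambda>h. pderivs bs f (x + h *\<^sub>R b)) 0)"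

text \<open>All iterated partial derivatives of orders up to \<open>k\<close> exist at every point of the open set \<open>S\<close>.\<close>

definition pderivs_exist_on :: "nat \<Rightarrow> 'a::euclidean_space set \<Rightarrow> ('a \<Rightarrow> real) \<Rightarrow> bool" where
  "pderivs_exist_on k S f \<longleftrightarrow>
     (\<forall>j<k. \<forall>bs\<in>indices j. \<forall>b\<in>Basis. \<forall>x\<in>S.
        (\<lambda>h. pderivs bs f (x + h *\<^sub>R b)) differentiable at 0)"

definition C_on :: "nat \<Rightarrow> 'a::euclidean_space set \<Rightarrow> ('a \<Rightarrow> real) \<Rightarrow> bool" where
  "C_on k S f \<longleftrightarrow>
     pderivs_exist_on k S f \<and> (\<forall>j\<le>k. \<forall>bs\<in>indices j. continuous_on S (pderivs bs f))"

text \<open>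
  $\mathbf{R}^{D_m}$, $D_m = \sum_{j \le m} N^j$: families $(z_0, \dots, z_m)$ with
  $z_j \in \mathbf{R}^{N^j}$ are functions on lists, padded by 0 outside the index lists of length
  at most \<open>m\<close>. On this set the product topology of the function space is the Euclidean one.
\<close>

definition jets :: "nat \<Rightarrow> ('a::euclidean_space list \<Rightarrow> real) set" where
  "jets m = {z. \<forall>bs. bs \<notin> (\<Union>j\<le>m. indices j) \<longrightarrow> z bs = 0}"

definition jet :: "nat \<Rightarrow> ('a::euclidean_space \<Rightarrow> real) \<Rightarrow> 'a \<Rightarrow> 'a list \<Rightarrow> real" where
  "jet m f x = (\<lambda>bs. if bs \<in> (\<Union>j\<le>m. indices j) then pderivs bs f x else 0)"

text \<open>The Euclidean norm of $\nabla^j f(x)$.\<close>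

definition grad_norm :: "nat \<Rightarrow> ('a::euclidean_space \<Rightarrow> real) \<Rightarrow> 'a \<Rightarrow> real" where
  "grad_norm j f x = L2_set (\<lambda>bs. pderivs bs f x) (indices j)"

definition admissible_kernel ::
  "nat \<Rightarrow> real \<Rightarrow> real \<Rightarrow> ereal \<Rightarrow> ('a::euclidean_space \<Rightarrow> 'a \<Rightarrow> real \<Rightarrow> real) \<Rightarrow> bool" where
  "admissible_kernel m d L Tstar G \<longleftrightarrow>
     real m < d \<and> 0 < L \<and> 0 < Tstar \<and>
     C_on m {(x, y, t). 0 < t \<and> ereal t < Tstar} (\<lambda>(x, y, t). G x y t) \<and>
     (\<exists>CG>0. \<forall>x y t. \<forall>j\<le>m. 0 < t \<and> ereal t < Tstar \<longrightarrow>
        grad_norm j (\<lambda>x. G x y t) x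
          \<le> CG * t powr (- ((real DIM('a) + real j) / d))
              * (1 + t powr (- (1 / d)) * norm (x - y)) powr (- real DIM('a) - L - real j)) \<and>
     (\<forall>x z s t. 0 < s \<and> s < t \<and> ereal t < Tstar \<longrightarrow>
        G x z t = (LINT y|lebesgue. G x y (t - s) * G y z s))"

text \<open>
  $t^A$ for $t \ge 0$ with the usual conventions $0^0 = 1$ and $0^A = \infty$ for $A < 0$,
  which \<open>powr\<close> does not follow at 0. (The value at $t = 0$ is immaterial for the growth bound below:
  for continuous \<open>F\<close>, the bound at $t = 0$ follows from the one for $t > 0$.)
\<close>

definition time_power :: "real \<Rightarrow> real \<Rightarrow> ereal" where
  "time_power t A =
     (if 0 < t then ereal (t powr A) else if 0 < A then 0 else if A = 0 then 1 else \<infinity>)"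

text \<open>Order 0; the data \<open>J\<close>, \<open>p\<close>, \<open>A\<close> of the growth bound are parameters.\<close>

definition structure_condition ::
  "nat \<Rightarrow> real \<Rightarrow> nat set \<Rightarrow> (nat \<Rightarrow> real) \<Rightarrow> real
     \<Rightarrow> ('a::euclidean_space \<Rightarrow> real \<Rightarrow> ('a list \<Rightarrow> real) \<Rightarrow> real) \<Rightarrow> bool" where
  "structure_condition m d J p A F \<longleftrightarrow>
     continuous_on (UNIV \<times> {0..} \<times> jets m) (\<lambda>(x, t, z). F x t z) \<and>
     J \<subseteq> {0..m} \<and> (\<forall>j\<in>J. 0 < p j) \<and> - 1 < A \<and> 1 < (\<Sum>j\<in>J. p j) \<and>
     (\<forall>x. \<forall>t\<ge>0. \<forall>z\<in>jets m.
        ereal \<bar>F x t z\<bar> \<le> time_power t A * ereal (\<Prod>j\<in>J. L2_set z (indices j) powr p j)) \<and>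
     (\<Sum>j\<in>J. real j * p j) < d * (1 + A)"

definition r_crit :: "nat \<Rightarrow> real \<Rightarrow> nat set \<Rightarrow> (nat \<Rightarrow> real) \<Rightarrow> real \<Rightarrow> real" where
  "r_crit N d J p A =
     real N * ((\<Sum>j\<in>J. p j) - 1) / (d * (1 + A) - (\<Sum>j\<in>J. real j * p j))"

definition locally_integrable :: "('a::euclidean_space \<Rightarrow> real) \<Rightarrow> bool" where
  "locally_integrable \<phi> \<longleftrightarrow> (\<forall>K. compact K \<longrightarrow> \<phi> absolutely_integrable_on K)"

text \<open>
  The integral equation at the point \<open>(x, t)\<close>. Since Bochner integrals of non-integrable functions
  are 0 by convention, the existence of all integrals involved is part of the definition.
\<close>

definition integral_eq_at ::
  "nat \<Rightarrow> real \<Rightarrow> ('a::euclidean_space \<Rightarrow> 'a \<Rightarrow> real \<Rightarrow> real)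
     \<Rightarrow> ('a \<Rightarrow> real \<Rightarrow> ('a list \<Rightarrow> real) \<Rightarrow> real) \<Rightarrow> ('a \<Rightarrow> real)
     \<Rightarrow> ('a \<Rightarrow> real \<Rightarrow> real) \<Rightarrow> 'a \<Rightarrow> real \<Rightarrow> bool" where
  "integral_eq_at m a0 G F \<phi> u x t \<longleftrightarrow>
     (let Gphi = (\<lambda>y. G x y t * \<phi> y);
          GF = (\<lambda>s y. G x y (t - s) * F y s (jet m (\<lambda>x. u x s) y))
      in integrable lebesgue Gphi \<and>
         (\<forall>s\<in>{0<..<t}. integrable lebesgue (GF s)) \<and>
         set_integrable lebesgue {0<..<t} (\<lambda>s. LINT y|lebesgue. GF s y) \<and>
         u x t = (LINT y|lebesgue. Gphi y)
                   + a0 * (LINT s:{0<..<t}|lebesgue. (LINT y|lebesgue. GF s y)))"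

definition is_solution ::
  "nat \<Rightarrow> real \<Rightarrow> ('a::euclidean_space \<Rightarrow> 'a \<Rightarrow> real \<Rightarrow> real)
     \<Rightarrow> ('a \<Rightarrow> real \<Rightarrow> ('a list \<Rightarrow> real) \<Rightarrow> real) \<Rightarrow> ('a \<Rightarrow> real)
     \<Rightarrow> real \<Rightarrow> ('a \<Rightarrow> real \<Rightarrow> real) \<Rightarrow> bool" where
  "is_solution m a0 G F \<phi> T u \<longleftrightarrow>
     (\<forall>\<tau>\<in>{0<..<T}.
        (\<forall>t\<in>{\<tau><..<T}. pderivs_exist_on m UNIV (\<lambda>x. u x t)) \<and>
        (\<forall>j\<le>m. \<forall>bs\<in>indices j.
           bounded ((\<lambda>(x, t). pderivs bs (\<lambda>x. u x t) x) ` (UNIV \<times> {\<tau><..<T})) \<and>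
           continuous_on (UNIV \<times> {\<tau><..<T}) (\<lambda>(x, t). pderivs bs (\<lambda>x. u x t) x))) \<and>
     (\<forall>x. \<forall>t\<in>{0<..<T}. integral_eq_at m a0 G F \<phi> u x t)"

definition ball_average :: "('a::euclidean_space \<Rightarrow> real) \<Rightarrow> 'a \<Rightarrow> real \<Rightarrow> real" where
  "ball_average f x \<sigma> = (LINT y:ball x \<sigma>|lebesgue. f y) / measure lebesgue (ball x \<sigma>)"

end

theory Submission
  imports Defs "HOL-Complex_Analysis.Great_Picard"
begin

text \<open>
  Put $\tau = t^{1/d}$, $P_t(x) = \tau^L (\tau + |x|)^{-N-L}$ and
  $W(x,t) = \int P_t(x-y) |\phi(y)| \, dy$. The kernel satisfies
  $|\nabla^j G(x,y,t)| \le C t^{-j/d} P_t(x-y)$, and $P$ is a semigroup up to constants: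
  $\int P_{t-s}(x-y) W(y,s) \, dy \le C W(x,t)$. The hypothesis on $\phi$ says that the masses of $|\phi|$ in
  balls of radius $T^{1/d}$ are at most some $M$ with $M^{|p|-1} T^\delta$ small, where
  $\delta = 1 + A - \langle p\rangle/d - N(|p|-1)/d$ is positive because $r_0 < 1$; it yields
  $W(x,t) \le C M t^{-N/d}$. If $|\nabla^j u| \le K t^{-j/d} W$, then
  $|F| \le C M^{|p|-1} s^{\delta-1} W(y,s)$, whose potential is again bounded by a small multiple of
  $t^{-j/d} W(x,t)$, so this set of functions is preserved.

  Since $F$ is merely continuous, the solution is a limit of solutions of equations with a time delay
  $\epsilon$, which can be solved step by step. Potentials of sources bounded by $\kappa s^{\delta-1} W$ are
  equicontinuous, so that a subsequence of the jets converges pointwise, and dominated convergence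
  identifies the limit.
\<close>

text \<open>The obstacle is the time \<open>s = 0\<close>. If every factor of the nonlinearity were
  replaced by its supremum, the source would be of size s^(\<delta>-1-N/d), which need not be
  integrable. Keeping one factor \<open>W\<close> avoids this: the kernel takes \<open>W\<close> at
  time \<open>s\<close> back to \<open>W\<close> at time \<open>t\<close> with a constant
  independent of \<open>s\<close>, and only s^(\<delta>-1) remains. The semigroup property up to
  constants is applied once for each potential and never iterated, since \<open>W\<close> at every
  time is computed from \<phi> itself; hence its constants do not accumulate.

  Compactness rests on the same weight. Away from s = t the kernel varies continuously under a fixed
  integrable majorant; near s = t the singularity (t-s)^(-j/d) is integrable since j \<le> m < d.
  Both facts concern the kernel integrated against s^(\<delta>-1) W, so the modulus of continuity is
  common to all sources.

  The threshold has its exponent because M = \<gamma> |B(0,1)| T^(N/d - N/(d r0)) makes M^(|p|-1)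
  T^\<delta> independent of T; what remains is a condition on \<gamma> alone.\<close>

section \<open>A polynomially decaying kernel\<close>

text \<open>For \<open>\<tau> = t powr (1 / d)\<close> this is $t^{-N/d} (1 + t^{-1/d} |x|)^{-N-L}$.\<close>

definition pker :: "real \<Rightarrow> real \<Rightarrow> 'a::euclidean_space \<Rightarrow> real" where
  "pker L \<tau> x = \<tau> powr L * (\<tau> + norm x) powr (- (real DIM('a) + L))"

lemma pker_nonneg [simp]: "0 \<le> pker L \<tau> x"
  by (simp add: pker_def)

lemma pker_measurable [measurable (raw)]:
  assumes [measurable]: "f \<in> borel_measurable M" "g \<in> borel_measurable M"
  shows "(\<lambda>x. pker L (f x) (g x)) \<in> borel_measurable M"
  unfolding pker_def by measurable

text \<open>Both factors of \<open>pker\<close> are monotone powers, so it suffices to compare the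
  scales and, separately, the sums of scale and norm. The later changes of time, centre or scale are
  instances with suitable \<open>k\<close> and \<open>c\<close>.\<close>

lemma pker_le:
  fixes u w :: "'a::euclidean_space"
  assumes "0 < L" "0 < a" "0 < \<tau>" "0 < k" "0 < c" "a \<le> k * \<tau>" "\<tau> + norm w \<le> c * (a + norm u)"
  shows "pker L a u \<le> k powr L * c powr (real DIM('a) + L) * pker L \<tau> w"
proof -
  let ?q = "real DIM('a) + L"
  have q: "0 < ?q" using assms by simp
  have "(a + norm u) powr - ?q \<le> ((\<tau> + norm w) / c) powr - ?q"
    using assms q by (intro powr_mono2') (auto simp: field_simps add_pos_nonneg)
  also have "\<dots> = c powr ?q * (\<tau> + norm w) powr - ?q"
  proof -
    have "(P / c) powr - q = c powr q * P powr - q" if "0 < P" for P q :: real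
      using that assms by (simp add: powr_divide powr_minus) (simp add: field_simps)
    then show ?thesis using assms(3) by (meson add_pos_nonneg norm_ge_zero)
  qed
  finally have 1: "(a + norm u) powr - ?q \<le> c powr ?q * (\<tau> + norm w) powr - ?q" .
  have "a powr L \<le> (k * \<tau>) powr L" using assms by (intro powr_mono2) auto
  also have "\<dots> = k powr L * \<tau> powr L" using assms by (simp add: powr_mult)
  finally have 2: "a powr L \<le> k powr L * \<tau> powr L" .
  have "pker L a u \<le> (k powr L * \<tau> powr L) * (c powr ?q * (\<tau> + norm w) powr - ?q)"
    unfolding pker_def by (rule mult_mono[OF 2 1]) auto
  then show ?thesis by (simp add: pker_def mult_ac)
qed

text \<open>By symmetry let \<open>a\<close> be the larger scale, which is comparable to \<tau>. If
  \<open>u\<close> carries at least half of \<open>u + v\<close>, or if \<open>u + v\<close> is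
  shorter than \<tau>, then the kernel of scale \<open>a\<close> is small enough. Otherwise
  \<open>v\<close> carries half of a vector of length at least \<tau>, and the kernel of scale
  \<open>b\<close> is small enough however small \<open>b\<close> is.\<close>

lemma pker_min_le:
  fixes u v :: "'a::euclidean_space"
  assumes "0 < L" "0 < a" "0 < b" "a \<le> \<tau>" "b \<le> \<tau>" "1 \<le> k" "\<tau> \<le> k * max a b"
  shows "min (pker L a u) (pker L b v) \<le> (4 * k) powr (real DIM('a) + L) * pker L \<tau> (u + v)"
proof -
  have wlog: "min (pker L a u) (pker L b v) \<le> (4 * k) powr (real DIM('a) + L) * pker L \<tau> (u + v)"
    if "0 < a" "0 < b" "a \<le> \<tau>" "b \<le> \<tau>" "\<tau> \<le> k * a" for a b and u v :: 'a
  proof -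
    note le = pker_le[OF \<open>0 < L\<close>, where k=1 and c="4*k" and \<tau>=\<tau> and w="u+v"]
    have tri: "norm (u + v) \<le> norm u + norm v" by (rule norm_triangle_ineq)
    have ku: "norm u \<le> k * norm u" and kv: "norm v \<le> k * norm v" and kb: "b \<le> k * b"
      using assms that by (auto simp: mult_le_cancel_right1)
    consider "norm (u+v) / 2 \<le> norm u \<or> norm (u+v) < \<tau>" | "norm (u+v) / 2 \<le> norm v" "\<tau> \<le> norm (u+v)"
      using tri by argo
    then show ?thesis
    proof cases
      case 1
      have "\<tau> + norm (u+v) \<le> 4 * k * (a + norm u)"
        using 1 that ku norm_ge_zero[of u] unfolding distrib_left mult.assoc by argo
      then show ?thesis using le[of a u] that assms by (auto simp: min_def)
    next
      case 2
      have "\<tau> + norm (u+v) \<le> 4 * k * (b + norm v)"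
        using 2 that kv kb unfolding distrib_left mult.assoc by argo
      then show ?thesis using le[of b v] that assms by (auto simp: min_def)
    qed
  qed
  show ?thesis
  proof (cases "a \<ge> b")
    case True then show ?thesis using wlog[of a b u v] assms by (simp add: max_def split: if_splits)
  next
    case False then show ?thesis using wlog[of b a v u] assms
      by (simp add: max_def min.commute add.commute split: if_splits)
  qed
qed

section \<open>Mass, convolution and local averages of the kernel\<close>

lemma nn_integral_translate_reflect:
  fixes f :: "'a::euclidean_space \<Rightarrow> ennreal"
  assumes [measurable]: "f \<in> borel_measurable borel"
  shows "(\<integral>\<^sup>+y. f (x - y) \<partial>lborel) = (\<integral>\<^sup>+y. f y \<partial>lborel)"
proof -
  have "(\<integral>\<^sup>+y. f y \<partial>lborel) = (\<integral>\<^sup>+y. f y \<partial>(density (distr lborel borel (\<lambda>y. x + (-1) *\<^sub>R y)) (\<lambda>_. ennreal (\<bar>-1\<bar> ^ DIM('a)))))"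
    by (subst lborel_affine[of "-1" x]) auto
  also have "\<dots> = (\<integral>\<^sup>+y. f (x - y) \<partial>lborel)"
    by (subst nn_integral_density) (auto simp: nn_integral_distr)
  finally show ?thesis ..
qed

text \<open>An upper bound for the mass of the kernel rather than its value: in the layer cake
  integral \<open>r ^ DIM('a)\<close> is replaced by \<open>(\<tau> + r) ^ DIM('a)\<close>, after
  which the radial integral is elementary and \<tau> cancels.\<close>

definition pker_mass :: "real \<Rightarrow> real \<Rightarrow> real" where
  "pker_mass n L = (n + L) * unit_ball_vol n / L"

lemma pker_mass_pos: "0 < L \<Longrightarrow> 0 \<le> n \<Longrightarrow> 0 < pker_mass n L"
  unfolding pker_mass_def by (intro divide_pos_pos mult_pos_pos) (auto simp: add_pos_nonneg)

lemma nn_integral_powr_tail: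
  assumes "0 < (q::real)" "0 < \<tau>" "0 \<le> (x::real)"
  shows "(\<integral>\<^sup>+r. ennreal ((\<tau> + r) powr (- q - 1)) * indicator {x..} r \<partial>lborel) = ennreal ((\<tau> + x) powr - q / q)"
proof -
  have "(\<integral>\<^sup>+r. ennreal ((\<tau> + r) powr (- q - 1)) * indicator {x..} r \<partial>lborel) = ennreal (0 - - ((\<tau> + x) powr - q / q))"
  proof (rule nn_integral_FTC_atLeast)
    show "((\<lambda>r. - ((\<tau> + r) powr - q / q)) has_real_derivative (\<tau> + r) powr (- q - 1)) (at r)" if "x \<le> r" for r
    proof -
      have "((\<lambda>r. (\<tau> + r) powr - q) has_real_derivative - q * (\<tau> + r) powr (- q - of_nat 1) * 1) (at r)"
        using that assms by (intro DERIV_fun_powr) (auto intro!: derivative_eq_intros)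
      from DERIV_minus[OF DERIV_cdivide[OF this, of q]] show ?thesis
        by (rule DERIV_cong) (use assms in simp)
    qed
    show "((\<lambda>r. - ((\<tau> + r) powr - q / q)) \<longlongrightarrow> 0) at_top"
    proof -
      have "((\<lambda>r. (\<tau> + r) powr - q) \<longlongrightarrow> 0) at_top"
        using assms by (intro tendsto_neg_powr filterlim_tendsto_add_at_top[OF tendsto_const]) (auto simp: filterlim_ident)
      from tendsto_minus[OF tendsto_divide[OF this tendsto_const[of q]]] show ?thesis using assms by simp
    qed
  qed (use assms in auto)
  then show ?thesis by simp
qed

text \<open>Layer cake: \<open>(\<tau> + |x|) powr -q\<close> is a superposition of indicators of balls.\<close>

lemma nn_integral_pker_le:
  assumes "0 < L" "0 < \<tau>"
  shows "(\<integral>\<^sup>+x. ennreal (pker L \<tau> (x::'a::euclidean_space)) \<partial>lborel) \<le> ennreal (pker_mass (real DIM('a)) L)"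
proof -
  let ?n = "real DIM('a)"
  let ?q = "?n + L"
  let ?v = "unit_ball_vol ?n"
  have q: "0 < ?q" using assms by simp
  have "(\<integral>\<^sup>+x. ennreal (pker L \<tau> (x::'a)) \<partial>lborel)
     = (\<integral>\<^sup>+x. ennreal (\<tau> powr L * ?q) * (\<integral>\<^sup>+r. ennreal ((\<tau> + r) powr (- ?q - 1)) * indicator {norm (x::'a)..} r \<partial>lborel) \<partial>lborel)"
  proof (intro nn_integral_cong)
    fix x :: 'a
    have "ennreal (pker L \<tau> x) = ennreal (\<tau> powr L * ?q * ((\<tau> + norm x) powr - ?q / ?q))"
      unfolding pker_def using q by simp
    then show "ennreal (pker L \<tau> x) = ennreal (\<tau> powr L * ?q) * (\<integral>\<^sup>+r. ennreal ((\<tau> + r) powr (- ?q - 1)) * indicator {norm x..} r \<partial>lborel)"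
      using assms q by (subst nn_integral_powr_tail) (auto simp: ennreal_mult'[symmetric])
  qed
  also have "\<dots> = ennreal (\<tau> powr L * ?q) * (\<integral>\<^sup>+x. (\<integral>\<^sup>+r. ennreal ((\<tau> + r) powr (- ?q - 1)) * indicator {norm (x::'a)..} r \<partial>lborel) \<partial>lborel)"
    by (intro nn_integral_cmult) (auto simp: indicator_def)
  also have "(\<integral>\<^sup>+x. (\<integral>\<^sup>+r. ennreal ((\<tau> + r) powr (- ?q - 1)) * indicator {norm (x::'a)..} r \<partial>lborel) \<partial>lborel)
     = (\<integral>\<^sup>+r. (\<integral>\<^sup>+x. ennreal ((\<tau> + r) powr (- ?q - 1)) * indicator {norm (x::'a)..} r \<partial>lborel) \<partial>lborel)"
    by (subst lborel_pair.Fubini') (auto simp: case_prod_beta indicator_def)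
  also have "\<dots> \<le> (\<integral>\<^sup>+r. ennreal ?v * (ennreal ((\<tau> + r) powr (- L - 1)) * indicator {0..} r) \<partial>lborel)"
  proof (intro nn_integral_mono)
    fix r :: real
    show "(\<integral>\<^sup>+x. ennreal ((\<tau> + r) powr (- ?q - 1)) * indicator {norm (x::'a)..} r \<partial>lborel)
       \<le> ennreal ?v * (ennreal ((\<tau> + r) powr (- L - 1)) * indicator {0..} r)"
    proof (cases "0 \<le> r")
      case True
      have "(\<integral>\<^sup>+x. ennreal ((\<tau> + r) powr (- ?q - 1)) * indicator {norm (x::'a)..} r \<partial>lborel)
         = (\<integral>\<^sup>+x. ennreal ((\<tau> + r) powr (- ?q - 1)) * indicator (cball (0::'a) r) x \<partial>lborel)"
        by (intro nn_integral_cong) (auto simp: indicator_def)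
      also have "\<dots> = ennreal ((\<tau> + r) powr (- ?q - 1) * (?v * r ^ DIM('a)))"
        using True by (subst nn_integral_cmult_indicator) (simp_all add: emeasure_cball ennreal_mult'[symmetric])
      also have "\<dots> \<le> ennreal ((\<tau> + r) powr (- ?q - 1) * (?v * (\<tau> + r) ^ DIM('a)))"
        using True assms by (intro ennreal_leI mult_left_mono power_mono) auto
      also have "(\<tau> + r) powr (- ?q - 1) * (?v * (\<tau> + r) ^ DIM('a)) = ?v * (\<tau> + r) powr (- L - 1)"
        using True assms by (simp add: powr_realpow[symmetric] powr_add[symmetric])
      finally show ?thesis using True by (simp add: ennreal_mult')
    next
      case False
      then have "indicator {norm (x::'a)..} r = (0::ennreal)" for x :: 'a
        using norm_ge_zero[of x] by (auto simp: indicator_def simp del: norm_ge_zero)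
      then show ?thesis by simp
    qed
  qed
  also have "\<dots> = ennreal ?v * ennreal (\<tau> powr - L / L)"
    using nn_integral_powr_tail[of L \<tau> 0] assms by (subst nn_integral_cmult) auto
  also have "ennreal (\<tau> powr L * ?q) * (ennreal ?v * ennreal (\<tau> powr - L / L)) = ennreal (pker_mass (real DIM('a)) L)"
  proof -
    have "\<tau> powr L * ?q * (?v * (\<tau> powr - L / L)) = pker_mass (real DIM('a)) L"
      using assms by (simp add: pker_mass_def powr_minus)
    moreover have "ennreal (\<tau> powr L * ?q) * (ennreal ?v * ennreal (\<tau> powr - L / L))
        = ennreal (\<tau> powr L * ?q * (?v * (\<tau> powr - L / L)))"
      using assms q by (simp only: ennreal_mult'' mult_nonneg_nonneg powr_ge_zero less_imp_le divide_nonneg_nonneg unit_ball_vol_nonneg of_nat_0_le_iff)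
    ultimately show ?thesis by simp
  qed
  finally show ?thesis by (simp add: mult_left_mono)
qed

lemma nn_integral_pker_le':
  assumes "0 < L" "0 < \<tau>"
  shows "(\<integral>\<^sup>+y. ennreal (pker L \<tau> (x - y :: 'a::euclidean_space)) \<partial>lborel) \<le> ennreal (pker_mass (real DIM('a)) L)"
    and "(\<integral>\<^sup>+y. ennreal (pker L \<tau> (y - x :: 'a)) \<partial>lborel) \<le> ennreal (pker_mass (real DIM('a)) L)"
proof -
  show "(\<integral>\<^sup>+y. ennreal (pker L \<tau> (x - y :: 'a::euclidean_space)) \<partial>lborel) \<le> ennreal (pker_mass (real DIM('a)) L)"
    using nn_integral_pker_le[OF assms] by (subst nn_integral_translate_reflect[where f="\<lambda>x. ennreal (pker L \<tau> x)"]) auto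
  then show "(\<integral>\<^sup>+y. ennreal (pker L \<tau> (y - x :: 'a)) \<partial>lborel) \<le> ennreal (pker_mass (real DIM('a)) L)"
    by (simp add: pker_def norm_minus_commute)
qed

text \<open>The product of the two factors is at most their minimum times their sum.\<close>

lemma nn_integral_pker_conv_le:
  fixes x z :: "'a::euclidean_space"
  assumes "0 < L" "0 < a" "0 < b" "a \<le> \<tau>" "b \<le> \<tau>" "1 \<le> k" "\<tau> \<le> k * max a b"
  shows "(\<integral>\<^sup>+y. ennreal (pker L a (x - y) * pker L b (y - z)) \<partial>lborel)
    \<le> ennreal (2 * pker_mass (real DIM('a)) L * (4 * k) powr (real DIM('a) + L) * pker L \<tau> (x - z))"
proof -
  let ?c = "(4 * k) powr (real DIM('a) + L) * pker L \<tau> (x - z)"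
  have "pker L a (x - y) * pker L b (y - z) \<le> ?c * (pker L a (x - y) + pker L b (y - z))" for y
  proof -
    have "pker L a (x - y) * pker L b (y - z)
        = min (pker L a (x - y)) (pker L b (y - z)) * max (pker L a (x - y)) (pker L b (y - z))"
      by (auto simp: min_def max_def)
    also have "\<dots> \<le> ?c * (pker L a (x - y) + pker L b (y - z))"
      using pker_min_le[OF assms, of "x - y" "y - z"] by (intro mult_mono) (auto simp: le_max_iff_disj)
    finally show ?thesis .
  qed
  then have "(\<integral>\<^sup>+y. ennreal (pker L a (x - y) * pker L b (y - z)) \<partial>lborel)
    \<le> (\<integral>\<^sup>+y. ennreal ?c * (ennreal (pker L a (x - y)) + ennreal (pker L b (y - z))) \<partial>lborel)"
    by (intro nn_integral_mono) (simp add: ennreal_mult'[symmetric] ennreal_plus[symmetric] del: ennreal_plus)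
  also have "\<dots> = ennreal ?c * ((\<integral>\<^sup>+y. ennreal (pker L a (x - y)) \<partial>lborel) + (\<integral>\<^sup>+y. ennreal (pker L b (y - z)) \<partial>lborel))"
    by (subst nn_integral_cmult, simp, subst nn_integral_add) auto
  also have "\<dots> \<le> ennreal ?c * (ennreal (pker_mass (real DIM('a)) L) + ennreal (pker_mass (real DIM('a)) L))"
    using nn_integral_pker_le' assms by (intro mult_left_mono add_mono) auto
  also have "\<dots> = ennreal (2 * pker_mass (real DIM('a)) L * (4 * k) powr (real DIM('a) + L) * pker L \<tau> (x - z))"
    using pker_mass_pos[OF \<open>0 < L\<close>, of "real DIM('a)"]
    by (simp add: ennreal_mult'[symmetric] ennreal_plus[symmetric] algebra_simps del: ennreal_plus)
  finally show ?thesis .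
qed

text \<open>Replacing \<open>pker L \<tau> (x - y)\<close> by its average over \<open>ball y \<tau>\<close> reduces the claim to
  the masses of \<open>\<phi>\<close> in balls.\<close>

lemma nn_integral_pker_uloc_le:
  fixes \<phi> :: "'a::euclidean_space \<Rightarrow> real"
  assumes "0 < L" "0 < \<tau>" "\<tau> \<le> R" and [measurable]: "\<phi> \<in> borel_measurable borel"
    and uloc: "\<And>z. (\<integral>\<^sup>+y\<in>ball z R. ennreal \<bar>\<phi> y\<bar> \<partial>lborel) \<le> ennreal M"
    and M: "0 \<le> M"
  shows "(\<integral>\<^sup>+y. ennreal (pker L \<tau> (x - y) * \<bar>\<phi> y\<bar>) \<partial>lborel)
    \<le> ennreal (2 powr (real DIM('a) + L) * pker_mass (real DIM('a)) L / unit_ball_vol (real DIM('a)) * M * \<tau> powr - real DIM('a))"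
proof -
  let ?n = "real DIM('a)"
  let ?v = "unit_ball_vol ?n"
  define c where "c = 2 powr (?n + L) / (?v * \<tau> ^ DIM('a))"
  have v: "?v \<noteq> 0" by (rule less_imp_neq[symmetric]) simp
  have c: "0 < c" using assms by (simp add: c_def)
  \<comment> \<open>The average is written as an integral over the centre \<open>z\<close>, so that
    after exchanging the integrals the mass of \<phi> in \<open>ball z \<tau>\<close> is innermost.
    Within distance \<tau> the kernel changes by a bounded factor, and the volume of the ball yields
    the power of \<tau>.\<close>
  have pt: "ennreal (pker L \<tau> (x - y)) \<le> ennreal c * (\<integral>\<^sup>+z. ennreal (pker L \<tau> (x - z)) * indicator (ball z \<tau>) y \<partial>lborel)" for y
  proof -
    have le: "pker L \<tau> (x - y) \<le> 2 powr (?n + L) * pker L \<tau> (x - z)" if "dist z y < \<tau>" for z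
    proof -
      have "norm (x - z) \<le> norm (x - y) + dist z y"
        by (metis dist_commute dist_norm dist_triangle)
      then show ?thesis
        using pker_le[of L \<tau> \<tau> 1 2 "x - z" "x - y"] assms that norm_ge_zero[of "x - y"]
        by (simp del: norm_ge_zero)
    qed
    have "ennreal (pker L \<tau> (x - y)) = ennreal (pker L \<tau> (x - y) / (?v * \<tau> ^ DIM('a))) * emeasure lborel (ball y \<tau>)"
      using assms v by (simp add: emeasure_ball ennreal_mult'[symmetric])
    also have "\<dots> = (\<integral>\<^sup>+z. ennreal (pker L \<tau> (x - y) / (?v * \<tau> ^ DIM('a))) * indicator (ball y \<tau>) z \<partial>lborel)"
      by (rule nn_integral_cmult_indicator[symmetric]) simp
    also have "\<dots> \<le> (\<integral>\<^sup>+z. ennreal c * (ennreal (pker L \<tau> (x - z)) * indicator (ball z \<tau>) y) \<partial>lborel)"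
    proof (intro nn_integral_mono)
      fix z
      show "ennreal (pker L \<tau> (x - y) / (?v * \<tau> ^ DIM('a))) * indicator (ball y \<tau>) z
         \<le> ennreal c * (ennreal (pker L \<tau> (x - z)) * indicator (ball z \<tau>) y)"
      proof (cases "dist z y < \<tau>")
        case True
        have "pker L \<tau> (x - y) / (?v * \<tau> ^ DIM('a)) \<le> c * pker L \<tau> (x - z)"
          using le[OF True] assms by (simp add: c_def divide_right_mono)
        then show ?thesis using True c
          by (auto simp: indicator_def dist_commute ennreal_mult'[symmetric] intro!: ennreal_leI)
      qed (simp add: dist_commute)
    qed
    also have "\<dots> = ennreal c * (\<integral>\<^sup>+z. ennreal (pker L \<tau> (x - z)) * indicator (ball z \<tau>) y \<partial>lborel)"
      by (intro nn_integral_cmult) (auto simp: indicator_def)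
    finally show ?thesis .
  qed
  have "(\<integral>\<^sup>+y. ennreal (pker L \<tau> (x - y) * \<bar>\<phi> y\<bar>) \<partial>lborel)
    \<le> (\<integral>\<^sup>+y. (ennreal c * (\<integral>\<^sup>+z. ennreal (pker L \<tau> (x - z)) * indicator (ball z \<tau>) y \<partial>lborel)) * ennreal \<bar>\<phi> y\<bar> \<partial>lborel)"
    using pt by (intro nn_integral_mono) (simp add: ennreal_mult mult_right_mono)
  also have "\<dots> = ennreal c * (\<integral>\<^sup>+y. (\<integral>\<^sup>+z. ennreal (pker L \<tau> (x - z)) * (indicator (ball z \<tau>) y * ennreal \<bar>\<phi> y\<bar>) \<partial>lborel) \<partial>lborel)"
    by (subst nn_integral_cmult[symmetric]) (auto simp: indicator_def mult.assoc nn_integral_multc[symmetric] intro!: nn_integral_cong)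
  also have "(\<integral>\<^sup>+y. (\<integral>\<^sup>+z. ennreal (pker L \<tau> (x - z)) * (indicator (ball z \<tau>) y * ennreal \<bar>\<phi> y\<bar>) \<partial>lborel) \<partial>lborel)
    = (\<integral>\<^sup>+z. (\<integral>\<^sup>+y. ennreal (pker L \<tau> (x - z)) * (indicator (ball z \<tau>) y * ennreal \<bar>\<phi> y\<bar>) \<partial>lborel) \<partial>lborel)"
    by (subst lborel_pair.Fubini') (auto simp: case_prod_beta indicator_def)
  also have "\<dots> \<le> (\<integral>\<^sup>+z. ennreal (pker L \<tau> (x - z)) * ennreal M \<partial>lborel)"
  proof (intro nn_integral_mono)
    fix z
    have "(\<integral>\<^sup>+y. ennreal (pker L \<tau> (x - z)) * (indicator (ball z \<tau>) y * ennreal \<bar>\<phi> y\<bar>) \<partial>lborel)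
      = ennreal (pker L \<tau> (x - z)) * (\<integral>\<^sup>+y. (indicator (ball z \<tau>) y * ennreal \<bar>\<phi> y\<bar>) \<partial>lborel)"
      by (intro nn_integral_cmult borel_measurable_times_ennreal borel_measurable_indicator) auto
    also have "\<dots> \<le> ennreal (pker L \<tau> (x - z)) * (\<integral>\<^sup>+y\<in>ball z R. ennreal \<bar>\<phi> y\<bar> \<partial>lborel)"
      using assms by (intro mult_left_mono nn_integral_mono) (auto simp: indicator_def)
    also have "\<dots> \<le> ennreal (pker L \<tau> (x - z)) * ennreal M"
      by (intro mult_left_mono uloc) auto
    finally show "(\<integral>\<^sup>+y. ennreal (pker L \<tau> (x - z)) * (indicator (ball z \<tau>) y * ennreal \<bar>\<phi> y\<bar>) \<partial>lborel)
       \<le> ennreal (pker L \<tau> (x - z)) * ennreal M" .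
  qed
  also have "\<dots> \<le> ennreal (pker_mass (real DIM('a)) L) * ennreal M"
    using nn_integral_pker_le'(1)[of L \<tau> x] assms by (simp add: nn_integral_multc mult_right_mono)
  also have "ennreal c * (ennreal (pker_mass (real DIM('a)) L) * ennreal M) =
     ennreal (2 powr (?n + L) * pker_mass (real DIM('a)) L / ?v * M * \<tau> powr - ?n)"
  proof -
    have "c * (pker_mass (real DIM('a)) L * M) = 2 powr (?n + L) * pker_mass (real DIM('a)) L / ?v * M * \<tau> powr - ?n"
      using assms by (simp add: c_def powr_minus powr_realpow divide_simps)
    then show ?thesis
      using c M pker_mass_pos[of L "real DIM('a)"] assms by (simp add: ennreal_mult'[symmetric])
  qed
  finally show ?thesis by (simp add: mult_left_mono)
qed

section \<open>Time integrals and differentiation under the integral\<close>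

lemma nn_integral_powr_from_0_le:
  assumes "-1 < (a::real)" "0 \<le> c"
  shows "(\<integral>\<^sup>+s\<in>{0<..<c}. ennreal (s powr a) \<partial>lborel) \<le> ennreal (c powr (a + 1) / (a + 1))"
proof -
  have "(\<integral>\<^sup>+s\<in>{0<..<c}. ennreal (s powr a) \<partial>lborel) \<le> (\<integral>\<^sup>+s\<in>{0..c}. ennreal (s powr a) \<partial>lborel)"
    by (intro nn_integral_mono) (auto simp: indicator_def)
  also have "\<dots> = ennreal (c powr (a + 1) / (a + 1))"
    using has_integral_powr_from_0[OF assms] by (intro nn_integral_has_integral_lebesgue') auto
  finally show ?thesis .
qed

lemma nn_integral_powr_reflect_le:
  assumes "(a::real) < 1" "\<sigma> \<le> t"
  shows "(\<integral>\<^sup>+s\<in>{\<sigma><..<t}. ennreal ((t - s) powr - a) \<partial>lborel) \<le> ennreal ((t - \<sigma>) powr (1 - a) / (1 - a))"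
proof -
  have "(\<integral>\<^sup>+s\<in>{\<sigma><..<t}. ennreal ((t - s) powr - a) \<partial>lborel)
      = (\<integral>\<^sup>+s. ennreal ((t - s) powr - a) * indicator {0<..<t - \<sigma>} (t - s) \<partial>lborel)"
    by (intro nn_integral_cong) (auto simp: indicator_def)
  also have "\<dots> = (\<integral>\<^sup>+s\<in>{0<..<t - \<sigma>}. ennreal (s powr - a) \<partial>lborel)"
    by (rule nn_integral_translate_reflect[where f="\<lambda>s. ennreal (s powr - a) * indicator {0<..<t - \<sigma>} s"]) simp
  also have "\<dots> \<le> ennreal ((t - \<sigma>) powr (1 - a) / (1 - a))"
    using nn_integral_powr_from_0_le[of "- a" "t - \<sigma>"] assms by simp
  finally show ?thesis .
qed

text \<open>On each half of the interval only one factor can be singular; the other is at most twice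
  its value at \<open>t\<close>. Adding the two bounds makes them valid on the whole interval, so
  the integral need not be split.\<close>

lemma nn_integral_powr_conv_le:
  assumes "0 \<le> (a::real)" "a < 1" "0 < \<delta>" "0 < t"
  shows "(\<integral>\<^sup>+s\<in>{0<..<t}. ennreal ((t - s) powr - a * s powr (\<delta> - 1)) \<partial>lborel)
    \<le> ennreal ((2 / \<delta> + 2 / (1 - a)) * t powr (\<delta> - a))"
proof -
  let ?A = "2 * t powr - a" and ?B = "2 * t powr (\<delta> - 1)"
  have pt: "(t - s) powr - a * s powr (\<delta> - 1) \<le> ?A * s powr (\<delta> - 1) + ?B * (t - s) powr - a"
    if "0 < s" "s < t" for s
  proof (cases "s \<le> t / 2")
    case True
    have "(t - s) powr - a \<le> (t / 2) powr - a"
      using True assms that by (intro powr_mono2') auto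
    also have "\<dots> = 2 powr a * t powr - a"
      using assms by (simp add: powr_divide powr_minus field_simps)
    also have "\<dots> \<le> 2 powr 1 * t powr - a"
      using assms by (intro mult_right_mono powr_mono) auto
    finally have "(t - s) powr - a * s powr (\<delta> - 1) \<le> ?A * s powr (\<delta> - 1)"
      by (intro mult_right_mono) auto
    then show ?thesis by (simp add: add_increasing2)
  next
    case False
    \<comment> \<open>Separating the factor \<open>1 / s\<close> leaves the increasing power
      \<open>s powr \<delta>\<close>, which avoids a case distinction on the sign of
      \<open>\<delta> - 1\<close>.\<close>
    have "s powr (\<delta> - 1) = s powr \<delta> / s" using that by (simp add: powr_diff)
    also have "\<dots> \<le> t powr \<delta> / (t / 2)"
      using False assms that by (intro frac_le powr_mono2) auto
    also have "\<dots> = ?B" using assms by (simp add: powr_diff)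
    finally have "(t - s) powr - a * s powr (\<delta> - 1) \<le> ?B * (t - s) powr - a"
      by (subst mult.commute) (intro mult_right_mono, auto)
    then show ?thesis by (simp add: add_increasing)
  qed
  have "(\<integral>\<^sup>+s\<in>{0<..<t}. ennreal ((t - s) powr - a * s powr (\<delta> - 1)) \<partial>lborel)
    \<le> (\<integral>\<^sup>+s. ennreal ?A * (ennreal (s powr (\<delta> - 1)) * indicator {0<..<t} s)
        + ennreal ?B * (ennreal ((t - s) powr - a) * indicator {0<..<t} s) \<partial>lborel)"
    using pt by (intro nn_integral_mono)
      (auto simp: indicator_def ennreal_mult'[symmetric] ennreal_plus[symmetric] intro!: ennreal_leI simp del: ennreal_plus)
  also have "\<dots> = ennreal ?A * (\<integral>\<^sup>+s\<in>{0<..<t}. ennreal (s powr (\<delta> - 1)) \<partial>lborel)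
      + ennreal ?B * (\<integral>\<^sup>+s\<in>{0<..<t}. ennreal ((t - s) powr - a) \<partial>lborel)"
    by (subst nn_integral_add) (auto simp: nn_integral_cmult)
  also have "\<dots> \<le> ennreal ?A * ennreal (t powr \<delta> / \<delta>) + ennreal ?B * ennreal (t powr (1 - a) / (1 - a))"
    using nn_integral_powr_from_0_le[of "\<delta> - 1" t] nn_integral_powr_reflect_le[of a 0 t] assms
    by (intro add_mono mult_left_mono) auto
  also have "\<dots> = ennreal (?A * (t powr \<delta> / \<delta>) + ?B * (t powr (1 - a) / (1 - a)))"
    using assms by (subst (1 2) ennreal_mult'[symmetric]) (auto simp: ennreal_plus[symmetric] simp del: ennreal_plus)
  also have "?A * (t powr \<delta> / \<delta>) + ?B * (t powr (1 - a) / (1 - a)) = (2 / \<delta> + 2 / (1 - a)) * t powr (\<delta> - a)"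
  proof -
    have "t powr - a * t powr \<delta> = t powr (\<delta> - a)" "t powr (\<delta> - 1) * t powr (1 - a) = t powr (\<delta> - a)"
      by (simp_all add: powr_add[symmetric])
    then show ?thesis by (simp add: distrib_right mult.assoc)
  qed
  finally show ?thesis .
qed

text \<open>Away from \<open>s = 0\<close> only the singularity at \<open>s = t\<close> counts. The
  point is that the bound tends to 0 as \<sigma> approaches \<open>t\<close>, which the bound for
  the whole interval does not show.\<close>

lemma nn_integral_powr_conv_tail_le:
  assumes "0 \<le> (a::real)" "a < 1" "0 < \<delta>" "0 < \<sigma>" "\<sigma> < t"
  shows "(\<integral>\<^sup>+s\<in>{\<sigma><..<t}. ennreal ((t - s) powr - a * s powr (\<delta> - 1)) \<partial>lborel)
    \<le> ennreal (t powr \<delta> / \<sigma> * ((t - \<sigma>) powr (1 - a) / (1 - a)))"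
proof -
  have pt: "(t - s) powr - a * s powr (\<delta> - 1) \<le> t powr \<delta> / \<sigma> * (t - s) powr - a" if "\<sigma> < s" "s < t" for s
  proof -
    have "s powr (\<delta> - 1) = s powr \<delta> / s" using that assms by (simp add: powr_diff)
    also have "\<dots> \<le> t powr \<delta> / \<sigma>"
      using assms that by (intro frac_le powr_mono2) auto
    finally show ?thesis by (subst mult.commute) (intro mult_right_mono, auto)
  qed
  have "(\<integral>\<^sup>+s\<in>{\<sigma><..<t}. ennreal ((t - s) powr - a * s powr (\<delta> - 1)) \<partial>lborel)
    \<le> (\<integral>\<^sup>+s. ennreal (t powr \<delta> / \<sigma>) * (ennreal ((t - s) powr - a) * indicator {\<sigma><..<t} s) \<partial>lborel)"
    using pt assms by (intro nn_integral_mono)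
      (auto simp: indicator_def ennreal_mult'[symmetric] intro!: ennreal_leI)
  also have "\<dots> = ennreal (t powr \<delta> / \<sigma>) * (\<integral>\<^sup>+s\<in>{\<sigma><..<t}. ennreal ((t - s) powr - a) \<partial>lborel)"
    by (rule nn_integral_cmult) auto
  also have "\<dots> \<le> ennreal (t powr \<delta> / \<sigma>) * ennreal ((t - \<sigma>) powr (1 - a) / (1 - a))"
    using assms by (intro mult_left_mono nn_integral_powr_reflect_le) auto
  also have "\<dots> = ennreal (t powr \<delta> / \<sigma> * ((t - \<sigma>) powr (1 - a) / (1 - a)))"
    using assms by (subst ennreal_mult'[symmetric]) auto
  finally show ?thesis .
qed

text \<open>The derivative is obtained from the fundamental theorem of calculus and Fubini, so that
  only the integrals of \<open>k'\<close>, and not \<open>k'\<close> itself, need a bound that is uniform in \<open>h\<close>.\<close>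

lemma has_real_derivative_integral_Fubini:
  fixes k k' :: "real \<Rightarrow> 'b::euclidean_space \<Rightarrow> real"
  assumes r: "0 < r"
    and int: "\<And>h. \<bar>h\<bar> \<le> r \<Longrightarrow> integrable lborel (k h)"
    and deriv: "\<And>h \<omega>. ((\<lambda>h. k h \<omega>) has_real_derivative k' h \<omega>) (at h)"
    and contk: "\<And>h \<omega>. isCont (\<lambda>h. k' h \<omega>) h"
    and meas[measurable]: "(\<lambda>(h, \<omega>). k' h \<omega>) \<in> borel_measurable (borel \<Otimes>\<^sub>M borel)"
    and bound: "\<And>h. \<bar>h\<bar> \<le> r \<Longrightarrow> (\<integral>\<^sup>+\<omega>. ennreal \<bar>k' h \<omega>\<bar> \<partial>lborel) \<le> ennreal B"
    and cont: "continuous_on {-r..r} (\<lambda>h. \<integral>\<omega>. k' h \<omega> \<partial>lborel)"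
  shows "((\<lambda>h. \<integral>\<omega>. k h \<omega> \<partial>lborel) has_real_derivative (\<integral>\<omega>. k' 0 \<omega> \<partial>lborel)) (at 0)"
proof -
  let ?I = "\<lambda>h. \<integral>\<omega>. k' h \<omega> \<partial>lborel"
  \<comment> \<open>For fixed \<omega> the increment of \<open>k\<close> is the integral of
    \<open>k'\<close> over \<open>{-r..h}\<close>; Fubini then exhibits the integral of
    \<open>k h\<close> as an antiderivative of the continuous function \<open>?I\<close>.\<close>
  have eq: "(\<integral>\<omega>. k h \<omega> \<partial>lborel) = (\<integral>\<omega>. k (-r) \<omega> \<partial>lborel) + integral {-r..h} ?I" if h: "h \<in> {-r..r}" for h
  proof -
    have FTC: "(\<integral>\<theta>. k' \<theta> \<omega> * indicator {-r..h} \<theta> \<partial>lborel) = k h \<omega> - k (-r) \<omega>" for \<omega>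
      using h by (intro integral_FTC_Icc_real deriv contk) auto
    let ?f = "\<lambda>(\<theta>, \<omega>). k' \<theta> \<omega> * indicator {-r..h} \<theta>"
    have "(\<integral>\<^sup>+z. norm (?f z) \<partial>(lborel \<Otimes>\<^sub>M lborel)) = (\<integral>\<^sup>+\<theta>. (\<integral>\<^sup>+\<omega>. norm (?f (\<theta>, \<omega>)) \<partial>lborel) \<partial>lborel)"
      by (rule lborel.nn_integral_fst[symmetric]) measurable
    also have "\<dots> \<le> (\<integral>\<^sup>+\<theta>. ennreal B * indicator {-r..h} \<theta> \<partial>lborel)"
      using bound h by (intro nn_integral_mono) (auto simp: indicator_def)
    also have "\<dots> < \<infinity>"
      using h by (subst nn_integral_cmult_indicator) (auto simp: ennreal_mult_less_top)
    finally have intf: "integrable (lborel \<Otimes>\<^sub>M lborel) ?f"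
      by (intro integrableI_bounded) auto
    have "(\<integral>\<omega>. k h \<omega> \<partial>lborel) - (\<integral>\<omega>. k (-r) \<omega> \<partial>lborel) = (\<integral>\<omega>. k h \<omega> - k (-r) \<omega> \<partial>lborel)"
      using int[of h] int[of "-r"] h r by (subst Bochner_Integration.integral_diff) auto
    also have "\<dots> = (\<integral>\<omega>. (\<integral>\<theta>. k' \<theta> \<omega> * indicator {-r..h} \<theta> \<partial>lborel) \<partial>lborel)"
      by (simp only: FTC)
    also have "\<dots> = (\<integral>\<theta>. (\<integral>\<omega>. k' \<theta> \<omega> * indicator {-r..h} \<theta> \<partial>lborel) \<partial>lborel)"
      by (rule lborel_pair.Fubini_integral) (rule intf)
    also have "\<dots> = (\<integral>\<theta>\<in>{-r..h}. ?I \<theta> \<partial>lborel)"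
      unfolding set_lebesgue_integral_def by (intro Bochner_Integration.integral_cong) auto
    also have "\<dots> = integral {-r..h} ?I"
      by (intro set_borel_integral_eq_integral(2) borel_integrable_atLeastAtMost' continuous_on_subset[OF cont])
         (use h in auto)
    finally show ?thesis by simp
  qed
  have "((\<lambda>h. integral {-r..h} ?I) has_real_derivative ?I 0) (at 0 within {-r..r})"
    using cont r by (intro integral_has_real_derivative) auto
  then have "((\<lambda>h. (\<integral>\<omega>. k (-r) \<omega> \<partial>lborel) + integral {-r..h} ?I) has_real_derivative 0 + ?I 0) (at 0 within {-r..r})"
    by (intro DERIV_add DERIV_const)
  then have "((\<lambda>h. \<integral>\<omega>. k h \<omega> \<partial>lborel) has_real_derivative ?I 0) (at 0 within {-r..r})"
    unfolding add_0_left
    by (rule has_field_derivative_transform_within[OF _ r]) (use r in \<open>auto intro!: eq[symmetric]\<close>)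
  moreover have "at (0::real) within {-r..r} = at 0"
    using r by (intro at_within_interior) (simp add: interior_atLeastAtMost_real)
  ultimately show ?thesis by simp
qed

section \<open>Potentials\<close>

text \<open>Doubling the time multiplies the length scale \<open>t powr (1 / d)\<close> by this
  factor.\<close>

definition time_const :: "real \<Rightarrow> real" where
  "time_const d = 2 powr (1 / d)"

text \<open>The constant of \<open>pker_le\<close> when the scales differ by at most a factor
  \<open>time_const d\<close> and the centres by at most the reference scale.\<close>

definition compare_const :: "real \<Rightarrow> real \<Rightarrow> real \<Rightarrow> real" where
  "compare_const n d L = time_const d powr L * (2 * time_const d) powr (n + L)"

definition conv_const :: "real \<Rightarrow> real \<Rightarrow> real \<Rightarrow> real" where
  "conv_const n d L = 2 * pker_mass n L * (4 * time_const d) powr (n + L)"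

definition uloc_const :: "real \<Rightarrow> real \<Rightarrow> real" where
  "uloc_const n L = 2 powr (n + L) * pker_mass n L / unit_ball_vol n"

text \<open>The space integral contributes \<open>conv_const\<close>, the time integral of order
  \<open>j\<close> the other factor with \<open>j\<close> in place of \<open>m\<close>. The order
  \<open>m\<close> is the worst one, so a single constant serves all derivatives.\<close>

definition potential_const :: "real \<Rightarrow> nat \<Rightarrow> real \<Rightarrow> real \<Rightarrow> real \<Rightarrow> real" where
  "potential_const n m d L \<delta> = conv_const n d L * (2 / \<delta> + 2 / (1 - real m / d))"

lemma time_const_ge_1: "0 < d \<Longrightarrow> 1 \<le> time_const d"
  unfolding time_const_def using powr_mono[of 0 "1 / d" 2] by simp

lemma compare_const_ge_0: "0 \<le> compare_const n d L"
  by (simp add: compare_const_def)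

lemma conv_const_ge_0: "0 < L \<Longrightarrow> 0 \<le> n \<Longrightarrow> 0 \<le> conv_const n d L"
  using pker_mass_pos[of L n] by (simp add: conv_const_def)

lemma uloc_const_pos: "0 < L \<Longrightarrow> 0 \<le> n \<Longrightarrow> 0 < uloc_const n L"
  unfolding uloc_const_def by (intro divide_pos_pos mult_pos_pos pker_mass_pos unit_ball_vol_pos) auto

lemma powr_time_le: "0 < t \<Longrightarrow> t \<le> 2 * t' \<Longrightarrow> 0 < d \<Longrightarrow> t powr (1 / d) \<le> time_const d * t' powr (1 / d)"
  unfolding time_const_def by (subst powr_mult[symmetric]) (auto intro: powr_mono2)

text \<open>\<open>\<Gamma> bs\<close> stands for the partial derivative of the kernel in \<open>x\<close> with index list \<open>bs\<close>.\<close>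

locale kernel_potential =
  fixes \<Gamma> :: "'a::euclidean_space list \<Rightarrow> 'a \<Rightarrow> 'a \<Rightarrow> real \<Rightarrow> real"
    and m :: nat and d L C\<Gamma> T \<delta> M :: real and \<phi> :: "'a \<Rightarrow> real"
  assumes m_less: "real m < d" and L_pos: "0 < L" and C\<Gamma>_pos: "0 < C\<Gamma>" and T_pos: "0 < T"
    and \<delta>_pos: "0 < \<delta>" and M_nonneg: "0 \<le> M"
    and \<phi>_meas[measurable]: "\<phi> \<in> borel_measurable borel"
    and uloc: "\<And>z. (\<integral>\<^sup>+y\<in>ball z (T powr (1 / d)). ennreal \<bar>\<phi> y\<bar> \<partial>lborel) \<le> ennreal M"
    and \<Gamma>_cont: "\<And>bs j. bs \<in> indices j \<Longrightarrow> j \<le> m \<Longrightarrow>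
          continuous_on (UNIV \<times> UNIV \<times> {0<..<T}) (\<lambda>(x, y, t). \<Gamma> bs x y t)"
    and \<Gamma>_bound: "\<And>bs j x y t. bs \<in> indices j \<Longrightarrow> j \<le> m \<Longrightarrow> 0 < t \<Longrightarrow> t < T \<Longrightarrow>
          \<bar>\<Gamma> bs x y t\<bar> \<le> C\<Gamma> * t powr - (real j / d) * pker L (t powr (1 / d)) (x - y)"
    and \<Gamma>_deriv: "\<And>bs j b x y t. bs \<in> indices j \<Longrightarrow> j < m \<Longrightarrow> b \<in> Basis \<Longrightarrow> 0 < t \<Longrightarrow> t < T \<Longrightarrow>
          ((\<lambda>h. \<Gamma> bs (x + h *\<^sub>R b) y t) has_real_derivative \<Gamma> (b # bs) x y t) (at 0)"
begin

section \<open>The majorant \<open>W\<close> of the linear evolution\<close>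

definition pk :: "real \<Rightarrow> 'a \<Rightarrow> real" where
  "pk t x = pker L (t powr (1 / d)) x"

text \<open>With values in \<open>ennreal\<close>, so that integrals can be exchanged before
  anything is known to be finite; finiteness for times up to \<open>T\<close> is
  \<open>W_finite\<close>.\<close>

definition W :: "'a \<Rightarrow> real \<Rightarrow> ennreal" where
  "W x t = (\<integral>\<^sup>+y. ennreal (pk t (x - y) * \<bar>\<phi> y\<bar>) \<partial>lborel)"

lemma d_pos: "0 < d"
  using m_less of_nat_0_le_iff[of m, where 'a=real] by linarith

lemma pk_nonneg [simp]: "0 \<le> pk t x"
  by (simp add: pk_def)

lemma pk_measurable [measurable (raw)]:
  assumes [measurable]: "f \<in> borel_measurable N" "g \<in> borel_measurable N"
  shows "(\<lambda>w. pk (f w) (g w)) \<in> borel_measurable N"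
  unfolding pk_def by measurable

lemma W_measurable [measurable (raw)]:
  assumes [measurable]: "f \<in> borel_measurable N" "g \<in> borel_measurable N"
  shows "(\<lambda>w. W (f w) (g w)) \<in> borel_measurable N"
  unfolding W_def by measurable

text \<open>A Harnack type comparison: times within a factor 2 and centres within one length
  \<open>t0 powr (1 / d)\<close> make both quantities in \<open>pker_le\<close> comparable. It
  supplies majorants that are uniform near a given point \<open>(x0, t0)\<close>.\<close>

lemma pk_compare:
  assumes "0 < t" "0 < t0" "t \<le> 2 * t0" "t0 \<le> 2 * t" "norm (x - x0) \<le> t0 powr (1 / d)"
  shows "pk t (x - y) \<le> compare_const (real DIM('a)) d L * pk t0 (x0 - y)"
  unfolding pk_def compare_const_def
proof (rule pker_le)
  let ?k = "time_const d"
  have k: "1 \<le> ?k" using time_const_ge_1 d_pos by simp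
  show "t powr (1 / d) \<le> ?k * t0 powr (1 / d)"
    using assms d_pos by (intro powr_time_le) auto
  have 1: "t0 powr (1 / d) \<le> ?k * t powr (1 / d)"
    using assms d_pos by (intro powr_time_le) auto
  have "x0 - y = (x - y) - (x - x0)" by simp
  then have "norm (x0 - y) \<le> norm (x - y) + norm (x - x0)"
    by (metis norm_triangle_ineq4)
  then have "t0 powr (1 / d) + norm (x0 - y) \<le> 2 * (?k * t powr (1 / d)) + 1 * norm (x - y)"
    using 1 assms(5) by linarith
  also have "\<dots> \<le> 2 * (?k * t powr (1 / d)) + 2 * ?k * norm (x - y)"
    using k by (intro add_left_mono mult_right_mono) auto
  finally show "t0 powr (1 / d) + norm (x0 - y) \<le> 2 * ?k * (t powr (1 / d) + norm (x - y))"
    by (simp add: algebra_simps)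
qed (use assms L_pos time_const_ge_1[OF d_pos] in auto)

lemma W_compare:
  assumes "0 < t" "0 < t0" "t \<le> 2 * t0" "t0 \<le> 2 * t" "norm (x - x0) \<le> t0 powr (1 / d)"
  shows "W x t \<le> ennreal (compare_const (real DIM('a)) d L) * W x0 t0"
proof -
  have "W x t \<le> (\<integral>\<^sup>+y. ennreal (compare_const (real DIM('a)) d L) * ennreal (pk t0 (x0 - y) * \<bar>\<phi> y\<bar>) \<partial>lborel)"
    unfolding W_def
  proof (intro nn_integral_mono)
    fix y
    have "pk t (x - y) * \<bar>\<phi> y\<bar> \<le> compare_const (real DIM('a)) d L * pk t0 (x0 - y) * \<bar>\<phi> y\<bar>"
      using pk_compare[OF assms, of y] by (intro mult_right_mono) auto
    then show "ennreal (pk t (x - y) * \<bar>\<phi> y\<bar>) \<le> ennreal (compare_const (real DIM('a)) d L) * ennreal (pk t0 (x0 - y) * \<bar>\<phi> y\<bar>)"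
      using compare_const_ge_0 by (simp add: ennreal_mult'[symmetric] ennreal_leI mult.assoc)
  qed
  also have "\<dots> = ennreal (compare_const (real DIM('a)) d L) * W x0 t0"
    unfolding W_def by (rule nn_integral_cmult) measurable
  finally show ?thesis .
qed

lemma W_le:
  assumes "0 < t" "t \<le> T"
  shows "W x t \<le> ennreal (uloc_const (real DIM('a)) L * M * t powr - (real DIM('a) / d))"
proof -
  have "W x t \<le> ennreal (uloc_const (real DIM('a)) L * M * (t powr (1 / d)) powr - real DIM('a))"
    unfolding W_def pk_def uloc_const_def
    by (rule nn_integral_pker_uloc_le[OF L_pos _ _ \<phi>_meas uloc M_nonneg])
       (use assms d_pos in \<open>auto intro: powr_mono2\<close>)
  then show ?thesis by (simp add: powr_powr)
qed

lemma W_finite: "0 < t \<Longrightarrow> t \<le> T \<Longrightarrow> W x t < \<infinity>"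
  by (rule le_less_trans[OF W_le]) auto

text \<open>One of \<open>t - s\<close> and \<open>s\<close> is at least \<open>t / 2\<close>, which
  is the comparability of scales that \<open>nn_integral_pker_conv_le\<close> asks for. The exchange
  of integrals moves the convolution from \<open>W\<close> to the two kernels.\<close>

lemma W_conv:
  assumes "0 < s" "s < t"
  shows "(\<integral>\<^sup>+y. ennreal (pk (t - s) (x - y)) * W y s \<partial>lborel) \<le> ennreal (conv_const (real DIM('a)) d L) * W x t"
proof -
  have mx: "t powr (1 / d) \<le> time_const d * max ((t - s) powr (1 / d)) (s powr (1 / d))"
  proof (cases "t \<le> 2 * s")
    case True
    then have "t powr (1 / d) \<le> time_const d * s powr (1 / d)"
      using assms d_pos by (intro powr_time_le) auto
    also have "\<dots> \<le> time_const d * max ((t - s) powr (1 / d)) (s powr (1 / d))"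
      using time_const_ge_1[OF d_pos] by (intro mult_left_mono) auto
    finally show ?thesis .
  next
    case False
    then have "t powr (1 / d) \<le> time_const d * (t - s) powr (1 / d)"
      using assms d_pos by (intro powr_time_le) auto
    also have "\<dots> \<le> time_const d * max ((t - s) powr (1 / d)) (s powr (1 / d))"
      using time_const_ge_1[OF d_pos] by (intro mult_left_mono) auto
    finally show ?thesis .
  qed
  have "(\<integral>\<^sup>+y. ennreal (pk (t - s) (x - y)) * W y s \<partial>lborel)
      = (\<integral>\<^sup>+y. (\<integral>\<^sup>+z. ennreal (pk (t - s) (x - y) * pk s (y - z)) * ennreal \<bar>\<phi> z\<bar> \<partial>lborel) \<partial>lborel)"
    unfolding W_def
    by (subst nn_integral_cmult[symmetric]) (auto simp: ennreal_mult'[symmetric] mult.assoc)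
  also have "\<dots> = (\<integral>\<^sup>+z. (\<integral>\<^sup>+y. ennreal (pk (t - s) (x - y) * pk s (y - z)) * ennreal \<bar>\<phi> z\<bar> \<partial>lborel) \<partial>lborel)"
    by (rule lborel_pair.Fubini'[symmetric]) measurable
  also have "\<dots> = (\<integral>\<^sup>+z. (\<integral>\<^sup>+y. ennreal (pk (t - s) (x - y) * pk s (y - z)) \<partial>lborel) * ennreal \<bar>\<phi> z\<bar> \<partial>lborel)"
    by (subst nn_integral_multc) auto
  also have "\<dots> \<le> (\<integral>\<^sup>+z. ennreal (conv_const (real DIM('a)) d L * pk t (x - z)) * ennreal \<bar>\<phi> z\<bar> \<partial>lborel)"
    unfolding pk_def conv_const_def using assms d_pos L_pos mx time_const_ge_1[OF d_pos]
    by (intro nn_integral_mono mult_right_mono nn_integral_pker_conv_le) (auto intro: powr_mono2)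
  also have "\<dots> = (\<integral>\<^sup>+z. ennreal (conv_const (real DIM('a)) d L) * ennreal (pk t (x - z) * \<bar>\<phi> z\<bar>) \<partial>lborel)"
    using conv_const_ge_0[OF L_pos, of "real DIM('a)" d] by (simp add: ennreal_mult'[symmetric] mult.assoc)
  also have "\<dots> = ennreal (conv_const (real DIM('a)) d L) * W x t"
    unfolding W_def by (rule nn_integral_cmult) measurable
  finally show ?thesis .
qed

section \<open>A common majorant for the integrands of potentials\<close>

text \<open>Up to a constant, \<open>H j x t\<close> dominates the integrand of the potential of order \<open>j\<close> of every
  source that is bounded by \<open>s powr (\<delta> - 1) * W y s\<close>.\<close>

definition H :: "nat \<Rightarrow> 'a \<Rightarrow> real \<Rightarrow> 'a \<times> real \<Rightarrow> ennreal" where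
  "H j x t = (\<lambda>(y, s). indicator {0<..<t} s *
     ennreal ((t - s) powr - (real j / d) * s powr (\<delta> - 1) * pk (t - s) (x - y)) * W y s)"

lemma H_measurable [measurable]: "H j x t \<in> borel_measurable borel"
  unfolding H_def borel_prod[symmetric] by measurable

text \<open>At each fixed time \<open>W_conv\<close> bounds the space integral by a multiple of
  \<open>W x t\<close> that does not depend on \<open>s\<close>, so only an integral of powers over
  time is left. The set \<open>S\<close> allows the whole potential and its part near
  \<open>s = t\<close> to be treated alike.\<close>

lemma nn_integral_H:
  assumes [measurable]: "S \<in> sets borel"
  shows "(\<integral>\<^sup>+\<omega>. indicator S (snd \<omega>) * H j x t \<omega> \<partial>lborel) \<le> ennreal (conv_const (real DIM('a)) d L) * W x t *
    (\<integral>\<^sup>+s\<in>S \<inter> {0<..<t}. ennreal ((t - s) powr - (real j / d) * s powr (\<delta> - 1)) \<partial>lborel)"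
proof -
  have "(\<integral>\<^sup>+\<omega>. indicator S (snd \<omega>) * H j x t \<omega> \<partial>lborel)
      = (\<integral>\<^sup>+\<omega>. indicator S (snd \<omega>) * H j x t \<omega> \<partial>(lborel \<Otimes>\<^sub>M lborel))"
    by (simp add: lborel_prod)
  also have "\<dots> = (\<integral>\<^sup>+s. (\<integral>\<^sup>+y. indicator S (snd (y, s)) * H j x t (y, s) \<partial>lborel) \<partial>lborel)"
    by (rule lborel_pair.nn_integral_snd[symmetric]) (simp add: H_def, measurable)
  also have "\<dots> \<le> (\<integral>\<^sup>+s. ennreal (conv_const (real DIM('a)) d L) * W x t *
      (ennreal ((t - s) powr - (real j / d) * s powr (\<delta> - 1)) * indicator (S \<inter> {0<..<t}) s) \<partial>lborel)"
  proof (intro nn_integral_mono)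
    fix s
    show "(\<integral>\<^sup>+y. indicator S (snd (y, s)) * H j x t (y, s) \<partial>lborel) \<le> ennreal (conv_const (real DIM('a)) d L) * W x t *
      (ennreal ((t - s) powr - (real j / d) * s powr (\<delta> - 1)) * indicator (S \<inter> {0<..<t}) s)"
    proof (cases "s \<in> S \<inter> {0<..<t}")
      case True
      have "(\<integral>\<^sup>+y. indicator S (snd (y, s)) * H j x t (y, s) \<partial>lborel)
          = (\<integral>\<^sup>+y. ennreal ((t - s) powr - (real j / d) * s powr (\<delta> - 1)) * (ennreal (pk (t - s) (x - y)) * W y s) \<partial>lborel)"
        using True by (intro nn_integral_cong) (simp add: H_def ennreal_mult mult.assoc)
      also have "\<dots> = ennreal ((t - s) powr - (real j / d) * s powr (\<delta> - 1)) * (\<integral>\<^sup>+y. ennreal (pk (t - s) (x - y)) * W y s \<partial>lborel)"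
        by (rule nn_integral_cmult) measurable
      also have "\<dots> \<le> ennreal ((t - s) powr - (real j / d) * s powr (\<delta> - 1)) * (ennreal (conv_const (real DIM('a)) d L) * W x t)"
        using True by (intro mult_left_mono W_conv) auto
      finally show ?thesis using True by (simp add: mult_ac)
    next
      case False
      then have "indicator S s * H j x t (y, s) = 0" for y by (auto simp: H_def indicator_def)
      then show ?thesis unfolding snd_conv by (simp only: nn_integral_const) simp
    qed
  qed
  also have "\<dots> = ennreal (conv_const (real DIM('a)) d L) * W x t *
    (\<integral>\<^sup>+s\<in>S \<inter> {0<..<t}. ennreal ((t - s) powr - (real j / d) * s powr (\<delta> - 1)) \<partial>lborel)"
    by (rule nn_integral_cmult) measurable
  finally show ?thesis .
qed

lemma order_quotient: "j \<le> m \<Longrightarrow> 0 \<le> real j / d" "j \<le> m \<Longrightarrow> real j / d < 1"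
  "j \<le> m \<Longrightarrow> real j / d \<le> real m / d"
  using m_less d_pos by (auto simp: divide_simps)

lemma max_order_quotient: "real m / d < 1"
  using m_less d_pos by (simp add: divide_simps)

lemma potential_const_ge_0: "0 \<le> potential_const (real DIM('a)) m d L \<delta>"
  using conv_const_ge_0[OF L_pos, of "real DIM('a)" d] \<delta>_pos max_order_quotient by (simp add: potential_const_def)

lemma nn_integral_H_le:
  assumes "j \<le> m" "0 < t"
  shows "(\<integral>\<^sup>+\<omega>. H j x t \<omega> \<partial>lborel) \<le> ennreal (potential_const (real DIM('a)) m d L \<delta> * t powr (\<delta> - real j / d)) * W x t"
proof -
  let ?c = "2 / \<delta> + 2 / (1 - real j / d)"
  have "(\<integral>\<^sup>+\<omega>. H j x t \<omega> \<partial>lborel) \<le> ennreal (conv_const (real DIM('a)) d L) * W x t *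
      (\<integral>\<^sup>+s\<in>{0<..<t}. ennreal ((t - s) powr - (real j / d) * s powr (\<delta> - 1)) \<partial>lborel)"
    using nn_integral_H[of UNIV] by simp
  also have "\<dots> \<le> ennreal (conv_const (real DIM('a)) d L) * W x t * ennreal (?c * t powr (\<delta> - real j / d))"
    using order_quotient[OF assms(1)] assms \<delta>_pos by (intro mult_left_mono nn_integral_powr_conv_le) auto
  also have "\<dots> = ennreal (conv_const (real DIM('a)) d L * ?c * t powr (\<delta> - real j / d)) * W x t"
    using conv_const_ge_0[OF L_pos, of "real DIM('a)" d] \<delta>_pos order_quotient[OF assms(1)]
    by (simp add: ennreal_mult mult_ac)
  also have "\<dots> \<le> ennreal (potential_const (real DIM('a)) m d L \<delta> * t powr (\<delta> - real j / d)) * W x t"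
    unfolding potential_const_def using order_quotient[OF assms(1)] max_order_quotient conv_const_ge_0[OF L_pos, of "real DIM('a)" d]
    by (intro mult_right_mono ennreal_leI mult_left_mono add_left_mono divide_left_mono) auto
  finally show ?thesis .
qed

lemma nn_integral_H_tail_le:
  assumes "j \<le> m" "0 < \<sigma>" "\<sigma> < t"
  shows "(\<integral>\<^sup>+\<omega>. indicator {\<sigma><..} (snd \<omega>) * H j x t \<omega> \<partial>lborel)
    \<le> ennreal (conv_const (real DIM('a)) d L * (t powr \<delta> / \<sigma> * ((t - \<sigma>) powr (1 - real j / d) / (1 - real j / d)))) * W x t"
proof -
  have eq: "{\<sigma><..} \<inter> {0<..<t} = {\<sigma><..<t}" using assms by auto
  have "(\<integral>\<^sup>+\<omega>. indicator {\<sigma><..} (snd \<omega>) * H j x t \<omega> \<partial>lborel) \<le> ennreal (conv_const (real DIM('a)) d L) * W x t *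
      (\<integral>\<^sup>+s\<in>{\<sigma><..<t}. ennreal ((t - s) powr - (real j / d) * s powr (\<delta> - 1)) \<partial>lborel)"
    using nn_integral_H[of "{\<sigma><..}" j x t] unfolding eq by simp
  also have "\<dots> \<le> ennreal (conv_const (real DIM('a)) d L) * W x t * ennreal (t powr \<delta> / \<sigma> * ((t - \<sigma>) powr (1 - real j / d) / (1 - real j / d)))"
    using order_quotient[OF assms(1)] assms \<delta>_pos by (intro mult_left_mono nn_integral_powr_conv_tail_le) auto
  also have "\<dots> = ennreal (conv_const (real DIM('a)) d L * (t powr \<delta> / \<sigma> * ((t - \<sigma>) powr (1 - real j / d) / (1 - real j / d)))) * W x t"
    by (subst ennreal_mult'[OF conv_const_ge_0[OF L_pos]]) (simp_all only: of_nat_0_le_iff mult.assoc mult.commute[of "W x t"])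
  finally show ?thesis .
qed


text \<open>The kernel is controlled only at times in \<open>{0<..<T}\<close>; the indicator extends
  it by 0 to all times.\<close>

lemma \<Gamma>_measurable:
  assumes "bs \<in> indices j" "j \<le> m"
    and [measurable]: "f \<in> borel_measurable N" "g \<in> borel_measurable N" "h \<in> borel_measurable N"
  shows "(\<lambda>w. indicator {0<..<T} (h w) * \<Gamma> bs (f w) (g w) (h w)) \<in> borel_measurable N"
proof -
  let ?S = "UNIV \<times> UNIV \<times> {0<..<T} :: ('a \<times> 'a \<times> real) set"
  have "open ?S" by (intro open_Times) auto
  then have "(\<lambda>z. indicator ?S z *\<^sub>R (case z of (x, y, t) \<Rightarrow> \<Gamma> bs x y t)) \<in> borel_measurable borel"
    using \<Gamma>_cont[OF assms(1,2)] by (intro borel_measurable_continuous_on_indicator) auto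
  then have "(\<lambda>w. indicator ?S (f w, g w, h w) *\<^sub>R (case (f w, g w, h w) of (x, y, t) \<Rightarrow> \<Gamma> bs x y t)) \<in> borel_measurable N"
    by (rule measurable_compose[rotated]) (simp add: borel_prod[symmetric])
  then show ?thesis by (simp add: indicator_def)
qed

section \<open>Sources and their potentials\<close>

definition K :: "'a list \<Rightarrow> 'a \<Rightarrow> real \<Rightarrow> 'a \<times> real \<Rightarrow> real" where
  "K bs x t = (\<lambda>(y, s). indicator {0<..<t} s * \<Gamma> bs x y (t - s))"

lemma K_measurable:
  assumes bs: "bs \<in> indices j" "j \<le> m" and "t < T"
    and [measurable]: "f \<in> borel_measurable N" "g \<in> borel_measurable N"
  shows "(\<lambda>w. K bs (f w) t (g w)) \<in> borel_measurable N"
proof -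
  have g[measurable]: "(\<lambda>w. fst (g w)) \<in> borel_measurable N" "(\<lambda>w. snd (g w)) \<in> borel_measurable N"
    by (auto intro!: measurable_compose[OF assms(5)] borel_measurable_continuous_onI continuous_intros)
  have "K bs (f w) t (g w) = indicator {0<..<t} (snd (g w)) *
      (indicator {0<..<T} (t - snd (g w)) * \<Gamma> bs (f w) (fst (g w)) (t - snd (g w)))" for w
    using \<open>t < T\<close> by (auto simp: K_def indicator_def split: prod.split)
  then show ?thesis
    by (simp only:) (intro borel_measurable_times \<Gamma>_measurable[OF bs], auto)
qed

lemma K_measurable' [measurable]:
  assumes "bs \<in> indices j" "j \<le> m" "t < T"
  shows "K bs x t \<in> borel_measurable borel"
  using K_measurable[OF assms, of "\<lambda>_. x" borel "\<lambda>w. w"] by simp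

definition src :: "'a \<times> real \<Rightarrow> ennreal" where
  "src = (\<lambda>(y, s). indicator {0<..<T} s * (ennreal (s powr (\<delta> - 1)) * W y s))"

lemma src_measurable [measurable]: "src \<in> borel_measurable borel"
  unfolding src_def borel_prod[symmetric] by measurable

lemma K_src_le:
  assumes "bs \<in> indices j" "j \<le> m" "t < T"
  shows "ennreal \<bar>K bs x t \<omega>\<bar> * src \<omega> \<le> ennreal C\<Gamma> * H j x t \<omega>"
proof -
  obtain y s where \<omega>: "\<omega> = (y, s)" by (cases \<omega>)
  show ?thesis
  proof (cases "0 < s \<and> s < t")
    case True
    have "ennreal \<bar>K bs x t \<omega>\<bar> * src \<omega> = ennreal (\<bar>\<Gamma> bs x y (t - s)\<bar> * s powr (\<delta> - 1)) * W y s"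
      using True assms by (simp add: \<omega> K_def src_def ennreal_mult mult.assoc)
    also have "\<dots> \<le> ennreal ((C\<Gamma> * (t - s) powr - (real j / d) * pk (t - s) (x - y)) * s powr (\<delta> - 1)) * W y s"
      unfolding pk_def using True assms by (intro mult_right_mono ennreal_leI \<Gamma>_bound[OF assms(1,2)]) auto
    also have "\<dots> = ennreal C\<Gamma> * H j x t \<omega>"
      using True C\<Gamma>_pos by (simp add: \<omega> H_def ennreal_mult'[symmetric] mult.assoc[symmetric]) (simp add: mult_ac)
    finally show ?thesis .
  qed (auto simp: \<omega> K_def indicator_def)
qed

text \<open>The invariant set of sources. The bound holds everywhere and not merely almost
  everywhere, because limits of sources are later taken point by point. It concerns only times in
  \<open>{0<..<T}\<close>, outside which \<open>K\<close> vanishes whenever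
  \<open>t < T\<close>.\<close>

definition dens :: "real \<Rightarrow> ('a \<times> real \<Rightarrow> real) set" where
  "dens \<kappa> = {f. f \<in> borel_measurable borel \<and>
     (\<forall>y s. 0 < s \<longrightarrow> s < T \<longrightarrow> ennreal \<bar>f (y, s)\<bar> \<le> ennreal \<kappa> * src (y, s))}"

text \<open>The Duhamel term as one integral over space-time, with the restriction to
  \<open>s < t\<close> hidden in \<open>K\<close>. This form suits dominated convergence and the
  differentiation lemma; \<open>U_integral_eq\<close> recovers the iterated integral.\<close>

definition V :: "'a list \<Rightarrow> ('a \<times> real \<Rightarrow> real) \<Rightarrow> 'a \<Rightarrow> real \<Rightarrow> real" where
  "V bs f x t = (\<integral>\<omega>. K bs x t \<omega> * f \<omega> \<partial>lborel)"

lemma dens_measurable: "f \<in> dens \<kappa> \<Longrightarrow> f \<in> borel_measurable borel"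
  by (simp add: dens_def)

lemma K_dens_le:
  assumes "f \<in> dens \<kappa>" "t < T"
  shows "ennreal \<bar>K bs x t \<omega> * f \<omega>\<bar> \<le> ennreal \<kappa> * (ennreal \<bar>K bs x t \<omega>\<bar> * src \<omega>)"
proof (cases \<omega>)
  case (Pair y s)
  show ?thesis
  proof (cases "0 < s \<and> s < t")
    case True
    then have "ennreal \<bar>f \<omega>\<bar> \<le> ennreal \<kappa> * src \<omega>" using assms by (auto simp: dens_def Pair)
    then have "ennreal \<bar>K bs x t \<omega>\<bar> * ennreal \<bar>f \<omega>\<bar> \<le> ennreal \<bar>K bs x t \<omega>\<bar> * (ennreal \<kappa> * src \<omega>)"
      by (rule mult_left_mono) simp
    then show ?thesis by (simp add: abs_mult ennreal_mult mult_ac)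
  qed (auto simp: Pair K_def indicator_def)
qed

lemma nn_integral_K_dens:
  assumes "bs \<in> indices j" "j \<le> m" "0 < t" "t < T" "f \<in> dens \<kappa>" "0 \<le> \<kappa>"
  shows "(\<integral>\<^sup>+\<omega>. ennreal \<bar>K bs x t \<omega> * f \<omega>\<bar> \<partial>lborel)
    \<le> ennreal (\<kappa> * C\<Gamma> * potential_const (real DIM('a)) m d L \<delta> * t powr (\<delta> - real j / d)) * W x t"
proof -
  have "(\<integral>\<^sup>+\<omega>. ennreal \<bar>K bs x t \<omega> * f \<omega>\<bar> \<partial>lborel) \<le> (\<integral>\<^sup>+\<omega>. ennreal (\<kappa> * C\<Gamma>) * H j x t \<omega> \<partial>lborel)"
  proof (intro nn_integral_mono)
    fix \<omega>
    have "ennreal \<bar>K bs x t \<omega> * f \<omega>\<bar> \<le> ennreal \<kappa> * (ennreal \<bar>K bs x t \<omega>\<bar> * src \<omega>)"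
      using assms by (intro K_dens_le)
    also have "\<dots> \<le> ennreal \<kappa> * (ennreal C\<Gamma> * H j x t \<omega>)"
      using assms by (intro mult_left_mono K_src_le) auto
    finally show "ennreal \<bar>K bs x t \<omega> * f \<omega>\<bar> \<le> ennreal (\<kappa> * C\<Gamma>) * H j x t \<omega>"
      using assms C\<Gamma>_pos by (simp add: ennreal_mult mult.assoc)
  qed
  also have "\<dots> = ennreal (\<kappa> * C\<Gamma>) * (\<integral>\<^sup>+\<omega>. H j x t \<omega> \<partial>lborel)"
    by (rule nn_integral_cmult) simp
  also have "\<dots> \<le> ennreal (\<kappa> * C\<Gamma>) * (ennreal (potential_const (real DIM('a)) m d L \<delta> * t powr (\<delta> - real j / d)) * W x t)"
    using assms by (intro mult_left_mono nn_integral_H_le) auto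
  also have "\<dots> = ennreal (\<kappa> * C\<Gamma> * potential_const (real DIM('a)) m d L \<delta> * t powr (\<delta> - real j / d)) * W x t"
    using assms C\<Gamma>_pos potential_const_ge_0 by (simp add: ennreal_mult mult.assoc)
  finally show ?thesis .
qed

lemma integrable_K_dens:
  assumes "bs \<in> indices j" "j \<le> m" "0 < t" "t < T" "f \<in> dens \<kappa>" "0 \<le> \<kappa>"
  shows "integrable lborel (\<lambda>\<omega>. K bs x t \<omega> * f \<omega>)"
proof (rule integrableI_bounded)
  note [measurable] = K_measurable'[OF assms(1,2,4)] dens_measurable[OF assms(5)]
  show "(\<lambda>\<omega>. K bs x t \<omega> * f \<omega>) \<in> borel_measurable lborel" by measurable
  show "(\<integral>\<^sup>+\<omega>. norm (K bs x t \<omega> * f \<omega>) \<partial>lborel) < \<infinity>"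
    using nn_integral_K_dens[OF assms, of x] W_finite[of t x] assms
    by (auto simp: ennreal_mult_less_top intro: le_less_trans)
qed

lemma V_le:
  assumes "bs \<in> indices j" "j \<le> m" "0 < t" "t < T" "f \<in> dens \<kappa>" "0 \<le> \<kappa>"
  shows "ennreal \<bar>V bs f x t\<bar>
    \<le> ennreal (\<kappa> * C\<Gamma> * potential_const (real DIM('a)) m d L \<delta> * t powr (\<delta> - real j / d)) * W x t"
proof -
  have "ennreal \<bar>V bs f x t\<bar> \<le> (\<integral>\<^sup>+\<omega>. ennreal \<bar>K bs x t \<omega> * f \<omega>\<bar> \<partial>lborel)"
    unfolding V_def using integral_norm_bound_ennreal[OF integrable_K_dens[OF assms]] by simp
  also note nn_integral_K_dens[OF assms]
  finally show ?thesis .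
qed

section \<open>Equicontinuity of potentials\<close>

lemma K_src_compare:
  assumes bs: "bs \<in> indices j" "j \<le> m" and "0 < \<sigma>" "\<sigma> < t0" "t0 < T"
    and "t0 - (t0 - \<sigma>) / 2 < t" "t < t0 + (t0 - \<sigma>) / 2" "norm (x - x0) \<le> (t0 - \<sigma>) powr (1 / d)" "t < T"
  shows "indicator {..\<sigma>} (snd \<omega>) * (ennreal \<bar>K bs x t \<omega>\<bar> * src \<omega>)
    \<le> ennreal (2 * C\<Gamma> * compare_const (real DIM('a)) d L) * H j x0 t0 \<omega>"
proof (cases \<omega>)
  case (Pair y s)
  show ?thesis
  proof (cases "0 < s \<and> s \<le> \<sigma>")
    case True
    let ?c = "compare_const (real DIM('a)) d L"
    \<comment> \<open>Since \<open>s \<le> \<sigma>\<close>, the distance of \<open>t\<close> and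
      \<open>t0\<close> is less than half of \<open>t0 - s\<close>. Hence \<open>t - s\<close> and
      \<open>t0 - s\<close> differ by at most a factor 2 for all these \<open>s\<close> at once, and
      one majorant centred at \<open>(x0, t0)\<close> suffices.\<close>
    have st: "s < t" "s < t0" "t - s \<le> 2 * (t0 - s)" "t0 - s \<le> 2 * (t - s)" using True assms by argo+
    have pk: "pk (t - s) (x - y) \<le> ?c * pk (t0 - s) (x0 - y)"
    proof (rule pk_compare)
      have "(t0 - \<sigma>) powr (1 / d) \<le> (t0 - s) powr (1 / d)"
        using True assms d_pos by (intro powr_mono2) auto
      then show "norm (x - x0) \<le> (t0 - s) powr (1 / d)" using assms by linarith
    qed (use st in auto)
    have "(t - s) powr - (real j / d) \<le> ((t0 - s) / 2) powr - (real j / d)"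
      using st order_quotient(1)[OF bs(2)] by (intro powr_mono2') auto
    also have "\<dots> = 2 powr (real j / d) * (t0 - s) powr - (real j / d)"
      using st by (simp add: powr_divide powr_minus field_simps)
    also have "\<dots> \<le> 2 powr 1 * (t0 - s) powr - (real j / d)"
      using order_quotient(2)[OF bs(2)] by (intro mult_right_mono powr_mono) auto
    finally have tm: "(t - s) powr - (real j / d) \<le> 2 * (t0 - s) powr - (real j / d)" by simp
    have "ennreal \<bar>K bs x t \<omega>\<bar> * src \<omega> \<le> ennreal C\<Gamma> * H j x t \<omega>"
      by (rule K_src_le[OF bs \<open>t < T\<close>])
    also have "\<dots> = ennreal (C\<Gamma> * ((t - s) powr - (real j / d) * s powr (\<delta> - 1) * pk (t - s) (x - y))) * W y s"
      using True st C\<Gamma>_pos by (simp add: Pair H_def ennreal_mult'[symmetric] mult.assoc[symmetric])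
    also have "\<dots> \<le> ennreal (C\<Gamma> * ((2 * (t0 - s) powr - (real j / d)) * s powr (\<delta> - 1) * (?c * pk (t0 - s) (x0 - y)))) * W y s"
      using tm pk C\<Gamma>_pos by (intro mult_right_mono ennreal_leI mult_left_mono mult_mono) auto
    also have "\<dots> = ennreal (2 * C\<Gamma> * ?c * ((t0 - s) powr - (real j / d) * s powr (\<delta> - 1) * pk (t0 - s) (x0 - y))) * W y s"
      by (simp only: mult.assoc mult.commute mult.left_commute)
    also have "\<dots> = ennreal (2 * C\<Gamma> * ?c) * H j x0 t0 \<omega>"
      using True st C\<Gamma>_pos compare_const_ge_0[of "real DIM('a)" d L]
      by (subst ennreal_mult) (auto simp: Pair H_def mult.assoc)
    finally show ?thesis using True by (simp add: Pair)
  next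
    case False
    then have "indicator {..\<sigma>} (snd \<omega>) = (0::ennreal) \<or> src \<omega> = 0"
      by (auto simp: Pair src_def indicator_def)
    then show ?thesis by auto
  qed
qed

text \<open>The kernel difference is integrated against the majorant \<open>src\<close>, not against
  a particular source, so that smallness is uniform over \<open>dens \<kappa>\<close>. The cut at
  \<sigma> keeps \<open>s\<close> away from the moving singularity at \<open>s = t\<close>.\<close>

definition osc :: "'a list \<Rightarrow> 'a \<Rightarrow> real \<Rightarrow> 'a \<Rightarrow> real \<Rightarrow> real \<Rightarrow> ennreal" where
  "osc bs x0 t0 x t \<sigma> = (\<integral>\<^sup>+\<omega>. indicator {..\<sigma>} (snd \<omega>) * (ennreal \<bar>K bs x t \<omega> - K bs x0 t0 \<omega>\<bar> * src \<omega>) \<partial>lborel)"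

lemma osc_tendsto:
  assumes bs: "bs \<in> indices j" "j \<le> m" and "0 < \<sigma>" "\<sigma> < t0" "t0 < T"
  shows "((\<lambda>(x, t). osc bs x0 t0 x t \<sigma>) \<longlongrightarrow> 0) (at (x0, t0))"
proof -
  let ?N = "ball x0 ((t0 - \<sigma>) powr (1 / d)) \<times> ({t0 - (t0 - \<sigma>) / 2<..<t0 + (t0 - \<sigma>) / 2} \<inter> {0<..<T})"
  have N: "open ?N" "(x0, t0) \<in> ?N" using assms by (auto intro!: open_Times)
  \<comment> \<open>Twice the bound of \<open>K_src_compare\<close>, once for the kernel at the
    moving point and once for the kernel at \<open>(x0, t0)\<close>.\<close>
  let ?w = "\<lambda>\<omega>. ennreal (4 * C\<Gamma> * compare_const (real DIM('a)) d L) * H j x0 t0 \<omega>"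
  have "continuous (at (x0, t0) within ?N) (\<lambda>(x, t). osc bs x0 t0 x t \<sigma>)"
  proof (rule continuous_within_sequentiallyI)
    fix X assume lim: "X \<longlonglongrightarrow> (x0, t0)" and X: "\<forall>n::nat. X n \<in> ?N"
    let ?u = "\<lambda>n \<omega>. indicator {..\<sigma>} (snd \<omega>) * (ennreal \<bar>K bs (fst (X n)) (snd (X n)) \<omega> - K bs x0 t0 \<omega>\<bar> * src \<omega>)"
    have XT: "snd (X n) < T" "t0 - (t0 - \<sigma>) / 2 < snd (X n)" "snd (X n) < t0 + (t0 - \<sigma>) / 2" "norm (fst (X n) - x0) \<le> (t0 - \<sigma>) powr (1 / d)" for n
      using X[rule_format, of n] by (auto simp: mem_Times_iff dist_norm norm_minus_commute)
    note [measurable] = K_measurable'[OF bs XT(1)] K_measurable'[OF bs \<open>t0 < T\<close>]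
    have [measurable]: "(\<lambda>\<omega>. snd \<omega> :: real) \<in> borel_measurable (borel :: ('a \<times> real) measure)"
      by (intro borel_measurable_continuous_onI continuous_intros)
    have "(\<lambda>n. \<integral>\<^sup>+\<omega>. ?u n \<omega> \<partial>lborel) \<longlonglongrightarrow> integral\<^sup>N (lborel :: ('a \<times> real) measure) (\<lambda>_. 0)"
    proof (rule nn_integral_dominated_convergence[where w="?w"])
      show "AE \<omega> in lborel. ?u n \<omega> \<le> ?w \<omega>" for n
      proof (rule AE_I2)
        fix \<omega>
        let ?a = "\<lambda>x t. indicator {..\<sigma>} (snd \<omega>) * (ennreal \<bar>K bs x t \<omega>\<bar> * src \<omega>)"
        have "?u n \<omega> \<le> indicator {..\<sigma>} (snd \<omega>) * ((ennreal \<bar>K bs (fst (X n)) (snd (X n)) \<omega>\<bar> + ennreal \<bar>K bs x0 t0 \<omega>\<bar>) * src \<omega>)"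
          by (intro mult_left_mono mult_right_mono) (auto simp: ennreal_plus[symmetric] simp del: ennreal_plus intro!: ennreal_leI)
        also have "\<dots> = ?a (fst (X n)) (snd (X n)) + ?a x0 t0" by (simp add: distrib_left distrib_right)
        also have "\<dots> \<le> ennreal (2 * C\<Gamma> * compare_const (real DIM('a)) d L) * H j x0 t0 \<omega> + ennreal (2 * C\<Gamma> * compare_const (real DIM('a)) d L) * H j x0 t0 \<omega>"
          using assms XT by (intro add_mono K_src_compare[OF bs]) auto
        also have "\<dots> = ?w \<omega>"
          using C\<Gamma>_pos compare_const_ge_0[of "real DIM('a)" d L]
          by (simp add: distrib_right[symmetric] ennreal_plus[symmetric] del: ennreal_plus)
        finally show "?u n \<omega> \<le> ?w \<omega>" .
      qed
      have "(\<integral>\<^sup>+\<omega>. ?w \<omega> \<partial>lborel) = ennreal (4 * C\<Gamma> * compare_const (real DIM('a)) d L) * (\<integral>\<^sup>+\<omega>. H j x0 t0 \<omega> \<partial>lborel)"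
        by (rule nn_integral_cmult) simp
      also have "\<dots> < \<infinity>"
        using le_less_trans[OF nn_integral_H_le[OF bs(2), of t0 x0]] W_finite[of t0 x0] assms
        by (auto simp: ennreal_mult_less_top)
      finally show "(\<integral>\<^sup>+\<omega>. ?w \<omega> \<partial>lborel) < \<infinity>" .
      show "AE \<omega> in lborel. (\<lambda>n. ?u n \<omega>) \<longlonglongrightarrow> 0"
      proof (rule AE_I2)
        fix \<omega> :: "'a \<times> real"
        obtain y s where \<omega>: "\<omega> = (y, s)" by (cases \<omega>)
        show "(\<lambda>n. ?u n \<omega>) \<longlonglongrightarrow> 0"
        proof (cases "0 < s \<and> s \<le> \<sigma>")
          case False
          then have "indicator {..\<sigma>} (snd \<omega>) = (0::ennreal) \<or> src \<omega> = 0"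
            by (auto simp: \<omega> src_def indicator_def)
          then show ?thesis by auto
        next
          case True
          have src: "src \<omega> < \<infinity>"
            using W_finite[of s y] True assms by (auto simp: \<omega> src_def indicator_def ennreal_mult_less_top)
          have seq: "(\<lambda>n. (fst (X n), y, snd (X n) - s)) \<longlonglongrightarrow> (x0, y, t0 - s)"
            using tendsto_fst[OF lim] tendsto_snd[OF lim] by (auto intro!: tendsto_intros)
          have mem: "(fst (X n), y, snd (X n) - s) \<in> UNIV \<times> UNIV \<times> {0<..<T}" for n
            using XT(1,2)[of n] True assms by auto argo
          have "(\<lambda>n. \<Gamma> bs (fst (X n)) y (snd (X n) - s)) \<longlonglongrightarrow> \<Gamma> bs x0 y (t0 - s)"
            using continuous_on_tendsto_compose[OF \<Gamma>_cont[OF bs] seq] mem True assms by auto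
          moreover have "K bs (fst (X n)) (snd (X n)) \<omega> = \<Gamma> bs (fst (X n)) y (snd (X n) - s)" for n
            using mem[of n] True by (simp add: K_def \<omega>)
          moreover have "K bs x0 t0 \<omega> = \<Gamma> bs x0 y (t0 - s)"
            using True assms by (simp add: K_def \<omega>)
          ultimately have "(\<lambda>n. \<bar>K bs (fst (X n)) (snd (X n)) \<omega> - K bs x0 t0 \<omega>\<bar>) \<longlonglongrightarrow> 0"
            by (simp add: tendsto_rabs_zero LIM_zero)
          then have "(\<lambda>n. ennreal \<bar>K bs (fst (X n)) (snd (X n)) \<omega> - K bs x0 t0 \<omega>\<bar>) \<longlonglongrightarrow> ennreal 0"
            by (rule tendsto_ennrealI)
          then have "(\<lambda>n. src \<omega> * ennreal \<bar>K bs (fst (X n)) (snd (X n)) \<omega> - K bs x0 t0 \<omega>\<bar>) \<longlonglongrightarrow> src \<omega> * ennreal 0"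
            using src by (intro ennreal_tendsto_cmult) auto
          then show ?thesis using True by (simp add: \<omega> mult.commute)
        qed
      qed
    qed measurable
    then show "(\<lambda>n. (\<lambda>(x, t). osc bs x0 t0 x t \<sigma>) (X n)) \<longlonglongrightarrow> (\<lambda>(x, t). osc bs x0 t0 x t \<sigma>) (x0, t0)"
      by (simp add: osc_def case_prod_beta)
  qed
  then have "continuous (at (x0, t0)) (\<lambda>(x, t). osc bs x0 t0 x t \<sigma>)"
    by (simp only: at_within_open[OF N(2,1)])
  then show ?thesis by (simp add: continuous_at osc_def)
qed

text \<open>The last time layer has length at most \<open>2 * \<eta>\<close> and its singularity is
  integrable because \<open>j / d < 1\<close>, whence the positive power of
  \<open>2 * \<eta>\<close>. The condition \<open>\<eta> < t0 / 2\<close> keeps the layer off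
  \<open>s = 0\<close> and lets \<open>W_compare\<close> replace \<open>W x t\<close> by
  \<open>W x0 t0\<close>.\<close>

lemma K_src_tail_le:
  assumes bs: "bs \<in> indices j" "j \<le> m" and "0 < \<eta>" "\<eta> < t0 / 2" "t0 < T"
    and "t0 - \<eta> < t" "t < t0 + \<eta>" "t < T" "norm (x - x0) \<le> t0 powr (1 / d)"
  shows "(\<integral>\<^sup>+\<omega>. indicator {t0 - \<eta><..} (snd \<omega>) * (ennreal \<bar>K bs x t \<omega>\<bar> * src \<omega>) \<partial>lborel)
    \<le> ennreal (C\<Gamma> * conv_const (real DIM('a)) d L * (T powr \<delta> / (t0 / 2) / (1 - real j / d))
        * compare_const (real DIM('a)) d L * enn2real (W x0 t0) * (2 * \<eta>) powr (1 - real j / d))"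
proof -
  let ?\<sigma> = "t0 - \<eta>" and ?a = "real j / d"
  let ?cv = "conv_const (real DIM('a)) d L" and ?cc = "compare_const (real DIM('a)) d L"
  have cv: "0 \<le> ?cv" using conv_const_ge_0 L_pos by simp
  have a: "?a < 1" "0 \<le> ?a" using order_quotient bs by auto
  have [measurable]: "(\<lambda>\<omega>. snd \<omega> :: real) \<in> borel_measurable (borel :: ('a \<times> real) measure)"
    by (intro borel_measurable_continuous_onI continuous_intros)
  have "(\<integral>\<^sup>+\<omega>. indicator {?\<sigma><..} (snd \<omega>) * (ennreal \<bar>K bs x t \<omega>\<bar> * src \<omega>) \<partial>lborel)
      \<le> (\<integral>\<^sup>+\<omega>. ennreal C\<Gamma> * (indicator {?\<sigma><..} (snd \<omega>) * H j x t \<omega>) \<partial>lborel)"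
    using K_src_le[OF bs \<open>t < T\<close>] by (intro nn_integral_mono) (simp add: indicator_def)
  also have "\<dots> = ennreal C\<Gamma> * (\<integral>\<^sup>+\<omega>. indicator {?\<sigma><..} (snd \<omega>) * H j x t \<omega> \<partial>lborel)"
    by (rule nn_integral_cmult) measurable
  also have "\<dots> \<le> ennreal C\<Gamma> * (ennreal (?cv * (t powr \<delta> / ?\<sigma> * ((t - ?\<sigma>) powr (1 - ?a) / (1 - ?a)))) * (ennreal ?cc * W x0 t0))"
    using assms by (intro mult_left_mono order_trans[OF nn_integral_H_tail_le mult_left_mono[OF W_compare]]) auto
  also have "\<dots> \<le> ennreal C\<Gamma> * (ennreal (?cv * (T powr \<delta> / (t0 / 2) * ((2 * \<eta>) powr (1 - ?a) / (1 - ?a)))) * (ennreal ?cc * W x0 t0))"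
    using assms a cv \<delta>_pos
    by (intro mult_left_mono mult_right_mono ennreal_leI mult_mono frac_le divide_right_mono powr_mono2) auto
  also have "W x0 t0 = ennreal (enn2real (W x0 t0))"
    using W_finite[of t0 x0] assms by (simp add: ennreal_enn2real_if less_top)
  also have "ennreal C\<Gamma> * (ennreal (?cv * (T powr \<delta> / (t0 / 2) * ((2 * \<eta>) powr (1 - ?a) / (1 - ?a)))) * (ennreal ?cc * \<dots>))
    = ennreal (C\<Gamma> * (?cv * (T powr \<delta> / (t0 / 2) * ((2 * \<eta>) powr (1 - ?a) / (1 - ?a))) * (?cc * enn2real (W x0 t0))))"
    using C\<Gamma>_pos compare_const_ge_0[of "real DIM('a)" d L] cv by (simp only: ennreal_mult'' ennreal_mult' enn2real_nonneg less_imp_le mult_nonneg_nonneg)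
  finally show ?thesis by (simp add: mult_ac)
qed

text \<open>Times up to \<open>t0 - \<eta>\<close> are treated by \<open>osc_tendsto\<close>; on the
  last layer no cancellation is used, and the kernels at the two points are estimated separately.
  Each of the three contributions is at most \<open>e / 3\<close>.\<close>

lemma K_src_diff_small:
  assumes bs: "bs \<in> indices j" "j \<le> m" and "0 < t0" "t0 < T" and e: "0 < e"
  obtains r where "0 < r" "\<And>x t. dist (x, t) (x0, t0) < r \<Longrightarrow> 0 < t \<and> t < T \<and>
    (\<integral>\<^sup>+\<omega>. ennreal \<bar>K bs x t \<omega> - K bs x0 t0 \<omega>\<bar> * src \<omega> \<partial>lborel) \<le> ennreal e"
proof -
  let ?a = "real j / d"
  have a: "?a < 1" "0 \<le> ?a" using order_quotient bs by auto
  define Q where "Q = C\<Gamma> * conv_const (real DIM('a)) d L * (T powr \<delta> / (t0 / 2) / (1 - real j / d))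
        * compare_const (real DIM('a)) d L * enn2real (W x0 t0)"
  have Q: "0 \<le> Q" unfolding Q_def using C\<Gamma>_pos conv_const_ge_0[OF L_pos] compare_const_ge_0 a assms by auto
  \<comment> \<open>The second entry solves
    \<open>(2 * \<eta>) powr (1 - ?a) = e / (3 * (Q + 1))\<close>; here \<open>Q + 1\<close>
    replaces \<open>Q\<close> because \<open>Q\<close> may be 0. The first entry ensures
    \<open>\<eta> < t0 / 2\<close>.\<close>
  define \<eta> where "\<eta> = min (t0 / 4) ((e / (3 * (Q + 1))) powr (1 / (1 - ?a)) / 2)"
  have \<eta>: "0 < \<eta>" "\<eta> < t0 / 2" using assms Q by (auto simp: \<eta>_def min_def)
  have "(2 * \<eta>) powr (1 - ?a) \<le> ((e / (3 * (Q + 1))) powr (1 / (1 - ?a))) powr (1 - ?a)"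
    using a \<eta> by (intro powr_mono2) (auto simp: \<eta>_def)
  also have "\<dots> = e / (3 * (Q + 1))"
  proof -
    have "1 / (1 - b) * (1 - b) = 1" if "b < 1" for b :: real using that by simp
    from this[OF a(1)] show ?thesis using e Q by (simp only: powr_powr) simp
  qed
  finally have "Q * (2 * \<eta>) powr (1 - ?a) \<le> Q * (e / (3 * (Q + 1)))" using Q by (rule mult_left_mono)
  also have "\<dots> \<le> e / 3" using Q e by (simp add: field_simps)
  finally have tail: "Q * (2 * \<eta>) powr (1 - ?a) \<le> e / 3" .
  define \<sigma> where "\<sigma> = t0 - \<eta>"
  have \<sigma>: "0 < \<sigma>" "\<sigma> < t0" using \<eta> assms by (auto simp: \<sigma>_def)
  have "\<forall>\<^sub>F p in at (x0, t0). (case p of (x, t) \<Rightarrow> osc bs x0 t0 x t \<sigma>) < ennreal (e / 3)"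
    using osc_tendsto[OF bs \<sigma> \<open>t0 < T\<close>] e by (auto simp: order_tendsto_iff)
  then obtain r1 where r1: "0 < r1" "\<And>x t. (x, t) \<noteq> (x0, t0) \<Longrightarrow> dist (x, t) (x0, t0) < r1 \<Longrightarrow> osc bs x0 t0 x t \<sigma> < ennreal (e / 3)"
    unfolding eventually_at by auto
  have osc: "osc bs x0 t0 x t \<sigma> \<le> ennreal (e / 3)" if "dist (x, t) (x0, t0) < r1" for x t
    using r1(2)[of x t] that by (cases "(x, t) = (x0, t0)") (auto simp: osc_def)
  define r where "r = Min {r1, \<eta>, t0 powr (1 / d), T - t0}"
  show ?thesis
  proof (rule that[of r])
    show "0 < r" using r1 \<eta> assms by (simp add: r_def)
    fix x t assume D: "dist (x, t) (x0, t0) < r"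
    have "dist x x0 < r" "dist t t0 < r"
      using D dist_fst_le[of "(x, t)" "(x0, t0)"] dist_snd_le[of "(x, t)" "(x0, t0)"] by auto
    then have close: "norm (x - x0) \<le> t0 powr (1 / d)" "t0 - \<eta> < t" "t < t0 + \<eta>" "t < T" "0 < t"
      using \<eta> by (auto simp: r_def dist_norm abs_less_iff)
    note meas [measurable] = K_measurable'[OF bs \<open>t < T\<close>] K_measurable'[OF bs \<open>t0 < T\<close>]
    have [measurable]: "(\<lambda>\<omega>. snd \<omega> :: real) \<in> borel_measurable (borel :: ('a \<times> real) measure)"
      by (intro borel_measurable_continuous_onI continuous_intros)
    let ?T = "\<lambda>x t \<omega>. indicator {t0 - \<eta><..} (snd \<omega>) * (ennreal \<bar>K bs x t \<omega>\<bar> * src \<omega>)"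
    let ?o = "\<lambda>\<omega>. indicator {..\<sigma>} (snd \<omega>) * (ennreal \<bar>K bs x t \<omega> - K bs x0 t0 \<omega>\<bar> * src \<omega>)"
    have tailT: "integral\<^sup>N lborel (?T x' t') \<le> ennreal (e / 3)"
      if "t0 - \<eta> < t'" "t' < t0 + \<eta>" "t' < T" "norm (x' - x0) \<le> t0 powr (1 / d)" for x' t'
      by (rule order_trans[OF K_src_tail_le[OF bs \<eta> \<open>t0 < T\<close> that, folded Q_def] ennreal_leI[OF tail]])
    have "(\<integral>\<^sup>+\<omega>. ennreal \<bar>K bs x t \<omega> - K bs x0 t0 \<omega>\<bar> * src \<omega> \<partial>lborel) \<le> (\<integral>\<^sup>+\<omega>. ?o \<omega> + (?T x t \<omega> + ?T x0 t0 \<omega>) \<partial>lborel)"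
    proof (intro nn_integral_mono)
      fix \<omega>
      have "ennreal \<bar>K bs x t \<omega> - K bs x0 t0 \<omega>\<bar> * src \<omega> \<le> (ennreal \<bar>K bs x t \<omega>\<bar> + ennreal \<bar>K bs x0 t0 \<omega>\<bar>) * src \<omega>"
        by (intro mult_right_mono) (auto simp: ennreal_plus[symmetric] simp del: ennreal_plus intro!: ennreal_leI)
      then show "ennreal \<bar>K bs x t \<omega> - K bs x0 t0 \<omega>\<bar> * src \<omega> \<le> ?o \<omega> + (?T x t \<omega> + ?T x0 t0 \<omega>)"
        by (auto simp: indicator_def \<sigma>_def distrib_right)
    qed
    also have "\<dots> = osc bs x0 t0 x t \<sigma> + (integral\<^sup>N lborel (?T x t) + integral\<^sup>N lborel (?T x0 t0))"
      unfolding osc_def by (subst nn_integral_add, measurable, subst nn_integral_add) measurable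
    also have "\<dots> \<le> ennreal (e / 3) + (ennreal (e / 3) + ennreal (e / 3))"
    proof (intro add_mono osc)
      show "dist (x, t) (x0, t0) < r1" using D by (simp add: r_def)
      show "integral\<^sup>N lborel (?T x t) \<le> ennreal (e / 3)"
        using close by (intro tailT) auto
      show "integral\<^sup>N lborel (?T x0 t0) \<le> ennreal (e / 3)"
        using \<eta> assms by (intro tailT) auto
    qed
    also have "\<dots> = ennreal e" using e by (simp add: ennreal_plus[symmetric] del: ennreal_plus)
    finally show "0 < t \<and> t < T \<and> (\<integral>\<^sup>+\<omega>. ennreal \<bar>K bs x t \<omega> - K bs x0 t0 \<omega>\<bar> * src \<omega> \<partial>lborel) \<le> ennreal e"
      using close by simp
  qed
qed

text \<open>The radius comes from \<open>K_src_diff_small\<close>, in which no source occurs; a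
  source enters only through its bound by \<kappa> times \<open>src\<close>. Hence one radius serves
  all of \<open>dens \<kappa>\<close>.\<close>

lemma V_equicontinuous:
  assumes bs: "bs \<in> indices j" "j \<le> m" and "0 < t0" "t0 < T" and "0 < e" "0 \<le> \<kappa>"
  obtains r where "0 < r" "\<And>f x t. f \<in> dens \<kappa> \<Longrightarrow> dist (x, t) (x0, t0) < r \<Longrightarrow> \<bar>V bs f x t - V bs f x0 t0\<bar> < e"
proof -
  \<comment> \<open>Adding 1 covers the case of vanishing \<kappa>, and halving makes the final
    inequality strict.\<close>
  define e' where "e' = e / (\<kappa> + 1) / 2"
  have e': "0 < e'" "\<kappa> * e' < e"
  proof -
    show "0 < e'" using assms by (simp add: e'_def)
    have "\<kappa> * e' \<le> e / 2" using assms by (simp add: e'_def field_simps)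
    then show "\<kappa> * e' < e" using \<open>0 < e\<close> by simp
  qed
  obtain r where r: "0 < r" "\<And>x t. dist (x, t) (x0, t0) < r \<Longrightarrow> 0 < t \<and> t < T \<and>
    (\<integral>\<^sup>+\<omega>. ennreal \<bar>K bs x t \<omega> - K bs x0 t0 \<omega>\<bar> * src \<omega> \<partial>lborel) \<le> ennreal e'"
    using K_src_diff_small[OF assms(1-4) e'(1), of x0] by metis
  show ?thesis
  proof (rule that[OF r(1)])
    fix f x t assume f: "f \<in> dens \<kappa>" and D: "dist (x, t) (x0, t0) < r"
    have t: "0 < t" "t < T" using r(2)[OF D] by auto
    note [measurable] = K_measurable'[OF bs t(2)] K_measurable'[OF bs \<open>t0 < T\<close>] dens_measurable[OF f]
    have i: "integrable lborel (\<lambda>\<omega>. K bs x t \<omega> * f \<omega>)" "integrable lborel (\<lambda>\<omega>. K bs x0 t0 \<omega> * f \<omega>)"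
      using integrable_K_dens bs t f assms by auto
    have "V bs f x t - V bs f x0 t0 = (\<integral>\<omega>. K bs x t \<omega> * f \<omega> - K bs x0 t0 \<omega> * f \<omega> \<partial>lborel)"
      unfolding V_def using i by simp
    then have "ennreal \<bar>V bs f x t - V bs f x0 t0\<bar> \<le> (\<integral>\<^sup>+\<omega>. ennreal \<bar>K bs x t \<omega> * f \<omega> - K bs x0 t0 \<omega> * f \<omega>\<bar> \<partial>lborel)"
      using integral_norm_bound_ennreal[OF Bochner_Integration.integrable_diff[OF i]] by simp
    also have "\<dots> \<le> (\<integral>\<^sup>+\<omega>. ennreal \<kappa> * (ennreal \<bar>K bs x t \<omega> - K bs x0 t0 \<omega>\<bar> * src \<omega>) \<partial>lborel)"
    proof (intro nn_integral_mono)
      fix \<omega> :: "'a \<times> real"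
      obtain y s where \<omega>: "\<omega> = (y, s)" by (cases \<omega>)
      let ?k = "K bs x t \<omega> - K bs x0 t0 \<omega>"
      have eq: "K bs x t \<omega> * f \<omega> - K bs x0 t0 \<omega> * f \<omega> = ?k * f \<omega>" by (simp add: algebra_simps)
      show "ennreal \<bar>K bs x t \<omega> * f \<omega> - K bs x0 t0 \<omega> * f \<omega>\<bar> \<le> ennreal \<kappa> * (ennreal \<bar>?k\<bar> * src \<omega>)"
      proof (cases "0 < s \<and> s < T")
        case True
        then have "ennreal \<bar>f \<omega>\<bar> \<le> ennreal \<kappa> * src \<omega>" using f by (auto simp: dens_def \<omega>)
        then have "ennreal \<bar>?k\<bar> * ennreal \<bar>f \<omega>\<bar> \<le> ennreal \<bar>?k\<bar> * (ennreal \<kappa> * src \<omega>)"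
          by (rule mult_left_mono) simp
        then show ?thesis unfolding eq by (simp add: abs_mult ennreal_mult mult_ac)
      next
        \<comment> \<open>At these times membership in \<open>dens \<kappa>\<close> gives no bound
          on \<open>f\<close>, but both kernels vanish.\<close>
        case False
        then have "?k = 0" using t assms by (auto simp: \<omega> K_def indicator_def)
        then show ?thesis unfolding eq by simp
      qed
    qed
    also have "\<dots> = ennreal \<kappa> * (\<integral>\<^sup>+\<omega>. ennreal \<bar>K bs x t \<omega> - K bs x0 t0 \<omega>\<bar> * src \<omega> \<partial>lborel)"
      by (rule nn_integral_cmult) measurable
    also have "\<dots> \<le> ennreal \<kappa> * ennreal e'" using r(2)[OF D] by (intro mult_left_mono) auto
    also have "\<dots> = ennreal (\<kappa> * e')" using assms e' by (simp add: ennreal_mult)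
    finally show "\<bar>V bs f x t - V bs f x0 t0\<bar> < e" using e' assms by (simp add: ennreal_le_iff)
  qed
qed

lemma V_continuous:
  assumes bs: "bs \<in> indices j" "j \<le> m" and "f \<in> dens \<kappa>" "0 \<le> \<kappa>"
  shows "continuous_on (UNIV \<times> {0<..<T}) (\<lambda>(x, t). V bs f x t)"
  unfolding continuous_on_iff
proof (intro ballI allI impI)
  fix p :: "'a \<times> real" and e :: real assume "p \<in> UNIV \<times> {0<..<T}" "0 < e"
  moreover obtain x0 t0 where p: "p = (x0, t0)" by (cases p)
  ultimately have "0 < t0" "t0 < T" "0 < e" by auto
  then obtain r where "0 < r" "\<And>f x t. f \<in> dens \<kappa> \<Longrightarrow> dist (x, t) (x0, t0) < r \<Longrightarrow> \<bar>V bs f x t - V bs f x0 t0\<bar> < e"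
    using V_equicontinuous[OF bs, of t0 e \<kappa> x0] assms by auto
  then show "\<exists>r>0. \<forall>q\<in>UNIV \<times> {0<..<T}. dist q p < r \<longrightarrow> dist (case q of (x, t) \<Rightarrow> V bs f x t) (case p of (x, t) \<Rightarrow> V bs f x t) < e"
    using assms by (intro exI[of _ r]) (auto simp: dist_real_def p)
qed

end

lemma Cons_in_indices: "b # bs \<in> indices j \<longleftrightarrow> (\<exists>i. j = Suc i \<and> b \<in> Basis \<and> bs \<in> indices i)"
  by (auto simp: indices_def)

section \<open>The linear part, and derivatives of both parts\<close>

context kernel_potential
begin

definition V0 :: "'a list \<Rightarrow> 'a \<Rightarrow> real \<Rightarrow> real" where
  "V0 bs x t = (\<integral>y. \<Gamma> bs x y t * \<phi> y \<partial>lborel)"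

lemma \<Gamma>_measurable':
  assumes "bs \<in> indices j" "j \<le> m" "0 < t" "t < T"
    and "f \<in> borel_measurable N" "g \<in> borel_measurable N"
  shows "(\<lambda>w. \<Gamma> bs (f w) (g w) t) \<in> borel_measurable N"
  using \<Gamma>_measurable[OF assms(1,2,5,6), of "\<lambda>_. t"] assms by simp

lemma \<Gamma>_\<phi>_le:
  assumes "bs \<in> indices j" "j \<le> m" "0 < t" "t < T"
  shows "ennreal \<bar>\<Gamma> bs x y t * \<phi> y\<bar> \<le> ennreal (C\<Gamma> * t powr - (real j / d)) * ennreal (pk t (x - y) * \<bar>\<phi> y\<bar>)"
proof -
  have "\<bar>\<Gamma> bs x y t * \<phi> y\<bar> \<le> (C\<Gamma> * t powr - (real j / d) * pk t (x - y)) * \<bar>\<phi> y\<bar>"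
    unfolding abs_mult pk_def using \<Gamma>_bound[OF assms] by (intro mult_right_mono) auto
  then show ?thesis using C\<Gamma>_pos by (simp add: ennreal_mult'[symmetric] ennreal_leI mult.assoc)
qed

lemma nn_integral_\<Gamma>_\<phi>:
  assumes "bs \<in> indices j" "j \<le> m" "0 < t" "t < T"
  shows "(\<integral>\<^sup>+y. ennreal \<bar>\<Gamma> bs x y t * \<phi> y\<bar> \<partial>lborel) \<le> ennreal (C\<Gamma> * t powr - (real j / d)) * W x t"
proof -
  have "(\<integral>\<^sup>+y. ennreal \<bar>\<Gamma> bs x y t * \<phi> y\<bar> \<partial>lborel)
      \<le> (\<integral>\<^sup>+y. ennreal (C\<Gamma> * t powr - (real j / d)) * ennreal (pk t (x - y) * \<bar>\<phi> y\<bar>) \<partial>lborel)"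
    by (intro nn_integral_mono \<Gamma>_\<phi>_le assms)
  also have "\<dots> = ennreal (C\<Gamma> * t powr - (real j / d)) * W x t"
    unfolding W_def by (rule nn_integral_cmult) measurable
  finally show ?thesis .
qed

lemma integrable_\<Gamma>_\<phi>:
  assumes "bs \<in> indices j" "j \<le> m" "0 < t" "t < T"
  shows "integrable lborel (\<lambda>y. \<Gamma> bs x y t * \<phi> y)"
proof (rule integrableI_bounded)
  note [measurable] = \<Gamma>_measurable'[OF assms]
  show "(\<lambda>y. \<Gamma> bs x y t * \<phi> y) \<in> borel_measurable lborel" by measurable
  show "(\<integral>\<^sup>+y. norm (\<Gamma> bs x y t * \<phi> y) \<partial>lborel) < \<infinity>"
    using nn_integral_\<Gamma>_\<phi>[OF assms, of x] W_finite[of t x] assms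
    by (auto simp: ennreal_mult_less_top intro: le_less_trans)
qed

lemma V0_le:
  assumes "bs \<in> indices j" "j \<le> m" "0 < t" "t < T"
  shows "ennreal \<bar>V0 bs x t\<bar> \<le> ennreal (C\<Gamma> * t powr - (real j / d)) * W x t"
proof -
  have "ennreal \<bar>V0 bs x t\<bar> \<le> (\<integral>\<^sup>+y. ennreal \<bar>\<Gamma> bs x y t * \<phi> y\<bar> \<partial>lborel)"
    unfolding V0_def using integral_norm_bound_ennreal[OF integrable_\<Gamma>_\<phi>[OF assms]] by simp
  also note nn_integral_\<Gamma>_\<phi>[OF assms]
  finally show ?thesis .
qed

text \<open>Near \<open>(x0, t0)\<close> \<open>pk_compare\<close> bounds all kernels by one
  multiple of \<open>pk t0 (x0 - y)\<close>, so dominated convergence applies along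
  sequences.\<close>

lemma V0_continuous:
  assumes bs: "bs \<in> indices j" "j \<le> m"
  shows "continuous_on (UNIV \<times> {0<..<T}) (\<lambda>(x, t). V0 bs x t)"
proof -
  have "continuous (at (x0, t0)) (\<lambda>(x, t). V0 bs x t)" if t0: "0 < t0" "t0 < T" for x0 t0
  proof -
    let ?N = "ball x0 (t0 powr (1 / d)) \<times> ({t0 / 2<..<2 * t0} \<inter> {0<..<T})"
    have N: "open ?N" "(x0, t0) \<in> ?N" using t0 by (auto intro!: open_Times)
    let ?c = "C\<Gamma> * (t0 / 2) powr - (real j / d) * compare_const (real DIM('a)) d L"
    have "continuous (at (x0, t0) within ?N) (\<lambda>(x, t). V0 bs x t)"
    proof (rule continuous_within_sequentiallyI)
      fix X assume lim: "X \<longlonglongrightarrow> (x0, t0)" and X: "\<forall>n::nat. X n \<in> ?N"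
      have XT: "0 < snd (X n)" "snd (X n) < T" "t0 / 2 < snd (X n)" "snd (X n) < 2 * t0" "norm (fst (X n) - x0) \<le> t0 powr (1 / d)" for n
        using X[rule_format, of n] by (auto simp: mem_Times_iff dist_norm norm_minus_commute)
      have "(\<lambda>n. \<integral>y. \<Gamma> bs (fst (X n)) y (snd (X n)) * \<phi> y \<partial>lborel) \<longlonglongrightarrow> (\<integral>y. \<Gamma> bs x0 y t0 * \<phi> y \<partial>lborel)"
      proof (rule integral_dominated_convergence[where w="\<lambda>y. ?c * (pk t0 (x0 - y) * \<bar>\<phi> y\<bar>)"])
        note [measurable] = \<Gamma>_measurable'[OF bs t0] \<Gamma>_measurable'[OF bs XT(1,2)]
        show "(\<lambda>y. \<Gamma> bs x0 y t0 * \<phi> y) \<in> borel_measurable lborel"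
          "(\<lambda>y. \<Gamma> bs (fst (X n)) y (snd (X n)) * \<phi> y) \<in> borel_measurable lborel" for n by measurable
        have "integrable lborel (\<lambda>y. pk t0 (x0 - y) * \<bar>\<phi> y\<bar>)"
          using W_finite[of t0 x0] t0 by (intro integrableI_bounded) (auto simp: W_def)
        then show "integrable lborel (\<lambda>y. ?c * (pk t0 (x0 - y) * \<bar>\<phi> y\<bar>))"
          by (rule integrable_mult_right)
        show "AE y in lborel. norm (\<Gamma> bs (fst (X n)) y (snd (X n)) * \<phi> y) \<le> ?c * (pk t0 (x0 - y) * \<bar>\<phi> y\<bar>)" for n
        proof (rule AE_I2)
          fix y :: 'a
          have "\<bar>\<Gamma> bs (fst (X n)) y (snd (X n))\<bar> \<le> C\<Gamma> * snd (X n) powr - (real j / d) * pk (snd (X n)) (fst (X n) - y)"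
            unfolding pk_def using \<Gamma>_bound[OF bs XT(1,2)] .
          also have "\<dots> \<le> C\<Gamma> * (t0 / 2) powr - (real j / d) * (compare_const (real DIM('a)) d L * pk t0 (x0 - y))"
            using C\<Gamma>_pos XT[of n] t0 order_quotient(1)[OF bs(2)]
            by (intro mult_mono mult_left_mono powr_mono2' pk_compare) auto
          finally show "norm (\<Gamma> bs (fst (X n)) y (snd (X n)) * \<phi> y) \<le> ?c * (pk t0 (x0 - y) * \<bar>\<phi> y\<bar>)"
            by (simp add: abs_mult mult.assoc[symmetric] mult_right_mono)
        qed
        show "AE y in lborel. (\<lambda>n. \<Gamma> bs (fst (X n)) y (snd (X n)) * \<phi> y) \<longlonglongrightarrow> \<Gamma> bs x0 y t0 * \<phi> y"
        proof (rule AE_I2)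
          fix y :: 'a
          have seq: "(\<lambda>n. (fst (X n), y, snd (X n))) \<longlonglongrightarrow> (x0, y, t0)"
            using tendsto_fst[OF lim] tendsto_snd[OF lim] by (auto intro!: tendsto_intros)
          have "(\<lambda>n. \<Gamma> bs (fst (X n)) y (snd (X n))) \<longlonglongrightarrow> \<Gamma> bs x0 y t0"
            using continuous_on_tendsto_compose[OF \<Gamma>_cont[OF bs] seq] XT(1,2) t0 by auto
          then show "(\<lambda>n. \<Gamma> bs (fst (X n)) y (snd (X n)) * \<phi> y) \<longlonglongrightarrow> \<Gamma> bs x0 y t0 * \<phi> y"
            by (intro tendsto_intros)
        qed
      qed
      then show "(\<lambda>n. (\<lambda>(x, t). V0 bs x t) (X n)) \<longlonglongrightarrow> (\<lambda>(x, t). V0 bs x t) (x0, t0)"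
        by (simp add: V0_def case_prod_beta)
    qed
    then show ?thesis by (simp only: at_within_open[OF N(2,1)])
  qed
  then show ?thesis by (intro continuous_at_imp_continuous_on) auto
qed

lemma \<Gamma>_deriv_at:
  assumes "bs \<in> indices j" "j < m" "b \<in> Basis" "0 < t" "t < T"
  shows "((\<lambda>h. \<Gamma> bs (x + h *\<^sub>R b) y t) has_real_derivative \<Gamma> (b # bs) (x + h *\<^sub>R b) y t) (at h)"
proof -
  have "((\<lambda>h'. \<Gamma> bs ((x + h *\<^sub>R b) + h' *\<^sub>R b) y t) has_real_derivative \<Gamma> (b # bs) (x + h *\<^sub>R b) y t) (at 0)"
    by (rule \<Gamma>_deriv[OF assms])
  then have "((\<lambda>h'. \<Gamma> bs (x + (h' + h) *\<^sub>R b) y t) has_real_derivative \<Gamma> (b # bs) (x + h *\<^sub>R b) y t) (at 0)"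
    by (simp add: algebra_simps)
  then show ?thesis using DERIV_shift[of "\<lambda>h. \<Gamma> bs (x + h *\<^sub>R b) y t" _ 0 h] by simp
qed

lemma \<Gamma>_isCont_line:
  assumes "bs \<in> indices j" "j \<le> m" "0 < t" "t < T"
  shows "isCont (\<lambda>h. \<Gamma> bs (x + h *\<^sub>R b) y t) h"
proof -
  have "continuous_on UNIV (\<lambda>h. case (x + h *\<^sub>R b, y, t) of (x, y, t) \<Rightarrow> \<Gamma> bs x y t)"
    by (rule continuous_on_compose2[OF \<Gamma>_cont[OF assms(1,2)]]) (use assms in \<open>auto intro!: continuous_intros\<close>)
  then show ?thesis by (simp add: continuous_on_eq_continuous_at)
qed

lemma continuous_on_line:
  fixes g :: "'a \<Rightarrow> real \<Rightarrow> real"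
  assumes "continuous_on (UNIV \<times> {0<..<T}) (\<lambda>(x, t). g x t)" "0 < t" "t < T"
  shows "continuous_on S (\<lambda>h. g (x + h *\<^sub>R b) t)"
proof -
  have "continuous_on S (\<lambda>h. case (x + h *\<^sub>R b, t) of (x, t) \<Rightarrow> g x t)"
    by (rule continuous_on_compose2[OF assms(1)]) (use assms in \<open>auto intro!: continuous_intros\<close>)
  then show ?thesis by simp
qed

lemma V0_deriv:
  assumes "bs \<in> indices j" "j < m" "b \<in> Basis" "0 < t" "t < T"
  shows "((\<lambda>h. V0 bs (x + h *\<^sub>R b) t) has_real_derivative V0 (b # bs) x t) (at 0)"
proof -
  have bs': "b # bs \<in> indices (Suc j)" "Suc j \<le> m" using assms by (auto simp: Cons_in_indices)
  note t = \<open>0 < t\<close> \<open>t < T\<close>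
  have "((\<lambda>h. \<integral>y. \<Gamma> bs (x + h *\<^sub>R b) y t * \<phi> y \<partial>lborel) has_real_derivative
     (\<integral>y. \<Gamma> (b # bs) (x + 0 *\<^sub>R b) y t * \<phi> y \<partial>lborel)) (at 0)"
  proof (rule has_real_derivative_integral_Fubini[where r=1
        and B="C\<Gamma> * t powr - (real (Suc j) / d) * (uloc_const (real DIM('a)) L * M * t powr - (real DIM('a) / d))"])
    show "integrable lborel (\<lambda>y. \<Gamma> bs (x + h *\<^sub>R b) y t * \<phi> y)" for h
      using assms by (intro integrable_\<Gamma>_\<phi>) auto
    show "((\<lambda>h. \<Gamma> bs (x + h *\<^sub>R b) y t * \<phi> y) has_real_derivative \<Gamma> (b # bs) (x + h *\<^sub>R b) y t * \<phi> y) (at h)" for h y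
      using \<Gamma>_deriv_at[OF assms] by (intro DERIV_cmult_right)
    show "isCont (\<lambda>h. \<Gamma> (b # bs) (x + h *\<^sub>R b) y t * \<phi> y) h" for h y
      by (intro continuous_intros \<Gamma>_isCont_line[OF bs' t])
    show "(\<lambda>(h, y). \<Gamma> (b # bs) (x + h *\<^sub>R b) y t * \<phi> y) \<in> borel_measurable (borel \<Otimes>\<^sub>M borel)"
      unfolding case_prod_beta by (intro borel_measurable_times \<Gamma>_measurable'[OF bs' t]) measurable
    show "(\<integral>\<^sup>+y. ennreal \<bar>\<Gamma> (b # bs) (x + h *\<^sub>R b) y t * \<phi> y\<bar> \<partial>lborel)
      \<le> ennreal (C\<Gamma> * t powr - (real (Suc j) / d) * (uloc_const (real DIM('a)) L * M * t powr - (real DIM('a) / d)))" for h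
    proof -
      have "(\<integral>\<^sup>+y. ennreal \<bar>\<Gamma> (b # bs) (x + h *\<^sub>R b) y t * \<phi> y\<bar> \<partial>lborel)
          \<le> ennreal (C\<Gamma> * t powr - (real (Suc j) / d)) * W (x + h *\<^sub>R b) t"
        by (rule nn_integral_\<Gamma>_\<phi>[OF bs' t])
      also have "\<dots> \<le> ennreal (C\<Gamma> * t powr - (real (Suc j) / d)) * ennreal (uloc_const (real DIM('a)) L * M * t powr - (real DIM('a) / d))"
        using t by (intro mult_left_mono W_le) auto
      finally show ?thesis using C\<Gamma>_pos by (simp add: ennreal_mult')
    qed
    show "continuous_on {-1..1} (\<lambda>h. \<integral>y. \<Gamma> (b # bs) (x + h *\<^sub>R b) y t * \<phi> y \<partial>lborel)"
      using continuous_on_line[OF V0_continuous[OF bs'] t] by (simp add: V0_def)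
  qed simp
  then show ?thesis by (simp add: V0_def)
qed

text \<open>The differentiated kernel is of order \<open>Suc j \<le> m\<close>, so its singularity
  is still integrable. The bound by \<open>W\<close> is uniform in \<open>x\<close> by
  \<open>W_le\<close>, and the continuity that \<open>has_real_derivative_integral_Fubini\<close>
  requires is \<open>V_continuous\<close> for the longer index list.\<close>

lemma V_deriv:
  assumes "bs \<in> indices j" "j < m" "b \<in> Basis" "0 < t" "t < T" and f: "f \<in> dens \<kappa>" "0 \<le> \<kappa>"
  shows "((\<lambda>h. V bs f (x + h *\<^sub>R b) t) has_real_derivative V (b # bs) f x t) (at 0)"
proof -
  have bs': "b # bs \<in> indices (Suc j)" "Suc j \<le> m" using assms by (auto simp: Cons_in_indices)
  note t = \<open>0 < t\<close> \<open>t < T\<close>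
  let ?B = "\<kappa> * C\<Gamma> * potential_const (real DIM('a)) m d L \<delta> * t powr (\<delta> - real (Suc j) / d)"
  have B: "0 \<le> ?B" using f C\<Gamma>_pos potential_const_ge_0 by simp
  have "((\<lambda>h. \<integral>\<omega>. K bs (x + h *\<^sub>R b) t \<omega> * f \<omega> \<partial>lborel) has_real_derivative
     (\<integral>\<omega>. K (b # bs) (x + 0 *\<^sub>R b) t \<omega> * f \<omega> \<partial>lborel)) (at 0)"
  proof (rule has_real_derivative_integral_Fubini[where r=1 and B="?B * (uloc_const (real DIM('a)) L * M * t powr - (real DIM('a) / d))"])
    show "integrable lborel (\<lambda>\<omega>. K bs (x + h *\<^sub>R b) t \<omega> * f \<omega>)" for h
      using assms by (intro integrable_K_dens) auto
    show "((\<lambda>h. K bs (x + h *\<^sub>R b) t \<omega> * f \<omega>) has_real_derivative K (b # bs) (x + h *\<^sub>R b) t \<omega> * f \<omega>) (at h)" for h \<omega>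
    proof (cases \<omega>)
      case (Pair y s)
      show ?thesis
      proof (cases "0 < s \<and> s < t")
        case True
        then show ?thesis using \<Gamma>_deriv_at[OF assms(1-3), where t="t - s" and x=x and y=y and h=h] t
          by (auto simp: Pair K_def intro!: DERIV_cmult_right)
      qed (auto simp: Pair K_def)
    qed
    show "isCont (\<lambda>h. K (b # bs) (x + h *\<^sub>R b) t \<omega> * f \<omega>) h" for h \<omega>
    proof (cases \<omega>)
      case (Pair y s)
      show ?thesis
      proof (cases "0 < s \<and> s < t")
        case True
        then show ?thesis using \<Gamma>_isCont_line[OF bs', where t="t - s" and x=x and b=b and y=y and h=h] t
          by (auto simp: Pair K_def intro!: continuous_intros)
      qed (auto simp: Pair K_def)
    qed
    show "(\<lambda>(h, \<omega>). K (b # bs) (x + h *\<^sub>R b) t \<omega> * f \<omega>) \<in> borel_measurable (borel \<Otimes>\<^sub>M borel)"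
      unfolding case_prod_beta using dens_measurable[OF f(1)]
      by (intro borel_measurable_times K_measurable[OF bs' t(2)]) (measurable, auto)
    show "(\<integral>\<^sup>+\<omega>. ennreal \<bar>K (b # bs) (x + h *\<^sub>R b) t \<omega> * f \<omega>\<bar> \<partial>lborel)
      \<le> ennreal (?B * (uloc_const (real DIM('a)) L * M * t powr - (real DIM('a) / d)))" for h
    proof -
      have "(\<integral>\<^sup>+\<omega>. ennreal \<bar>K (b # bs) (x + h *\<^sub>R b) t \<omega> * f \<omega>\<bar> \<partial>lborel) \<le> ennreal ?B * W (x + h *\<^sub>R b) t"
        by (rule nn_integral_K_dens[OF bs' t f])
      also have "\<dots> \<le> ennreal ?B * ennreal (uloc_const (real DIM('a)) L * M * t powr - (real DIM('a) / d))"
        using t by (intro mult_left_mono W_le) auto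
      finally show ?thesis using B by (simp only: ennreal_mult')
    qed
    show "continuous_on {-1..1} (\<lambda>h. \<integral>\<omega>. K (b # bs) (x + h *\<^sub>R b) t \<omega> * f \<omega> \<partial>lborel)"
      using continuous_on_line[OF V_continuous[OF bs' f] t] by (simp add: V_def)
  qed simp
  then show ?thesis by (simp add: V_def)
qed

end

section \<open>The nonlinear equation\<close>

text \<open>The factor \<open>2 * C\<close> comes from \<open>U_le\<close> and \<open>n ^ m\<close>
  from the number of components of a gradient. The remaining 2 and \<open>compare_const\<close> are
  the cost of passing from a delayed time \<open>s'\<close> to the time \<open>s\<close> in
  \<open>F_Z_le\<close>.\<close>

definition jet_const :: "real \<Rightarrow> nat \<Rightarrow> real \<Rightarrow> real \<Rightarrow> real \<Rightarrow> real" where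
  "jet_const n m d L C = 4 * C * n ^ m * compare_const n d L"

text \<open>The exponent \<open>\<delta> - 1\<close> collects the powers of \<open>s\<close> in the
  source: \<open>A\<close> from the growth bound, \<open>- j / d\<close> times \<open>p j\<close>
  from each derivative, and \<open>- N / d\<close> for each of the |p| - 1 factors \<open>W\<close>
  that are replaced by their supremum. The constant left over is \<kappa>. The assumption
  \<open>small\<close> makes the bound for the nonlinear part at most that for the linear part at
  all times up to \<open>T\<close>.\<close>

locale nonlinear_problem = kernel_potential \<Gamma> m d L C\<Gamma> T \<delta> M \<phi>
  for \<Gamma> :: "'a::euclidean_space list \<Rightarrow> 'a \<Rightarrow> 'a \<Rightarrow> real \<Rightarrow> real"
    and m :: nat and d L C\<Gamma> T \<delta> M :: real and \<phi> :: "'a \<Rightarrow> real" +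
  fixes a0 A \<kappa> :: real and F :: "'a \<Rightarrow> real \<Rightarrow> ('a list \<Rightarrow> real) \<Rightarrow> real"
    and J :: "nat set" and p :: "nat \<Rightarrow> real"
  assumes F_cont: "continuous_on (UNIV \<times> {0..} \<times> jets m) (\<lambda>(x, t, z). F x t z)"
    and J_sub: "J \<subseteq> {0..m}" and p_pos: "\<And>j. j \<in> J \<Longrightarrow> 0 < p j" and p_sum: "1 < (\<Sum>j\<in>J. p j)"
    and F_bound: "\<And>x t z. 0 < t \<Longrightarrow> z \<in> jets m \<Longrightarrow>
          \<bar>F x t z\<bar> \<le> t powr A * (\<Prod>j\<in>J. L2_set z (indices j) powr p j)"
    and \<delta>_eq: "\<delta> = 1 + A - (\<Sum>j\<in>J. real j * p j) / d - real DIM('a) * ((\<Sum>j\<in>J. p j) - 1) / d"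
    and \<kappa>_eq: "\<kappa> = jet_const (real DIM('a)) m d L C\<Gamma> powr (\<Sum>j\<in>J. p j)
                  * (uloc_const (real DIM('a)) L * M) powr ((\<Sum>j\<in>J. p j) - 1)"
    and small: "\<bar>a0\<bar> * \<kappa> * potential_const (real DIM('a)) m d L \<delta> * T powr \<delta> \<le> 1"
begin

section \<open>Bounds preserved by the nonlinearity\<close>

lemma \<kappa>_nonneg: "0 \<le> \<kappa>"
  by (simp add: \<kappa>_eq)

definition Wr :: "'a \<Rightarrow> real \<Rightarrow> real" where
  "Wr x t = enn2real (W x t)"

lemma Wr_nonneg [simp]: "0 \<le> Wr x t"
  by (simp add: Wr_def)

lemma ennreal_Wr: "0 < t \<Longrightarrow> t \<le> T \<Longrightarrow> W x t = ennreal (Wr x t)"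
  using W_finite[of t x] by (simp add: Wr_def ennreal_enn2real_if less_top)

lemma Wr_le: "0 < t \<Longrightarrow> t \<le> T \<Longrightarrow> Wr x t \<le> uloc_const (real DIM('a)) L * M * t powr - (real DIM('a) / d)"
  using W_le[of t x] ennreal_Wr[of t x] uloc_const_pos[OF L_pos, of "real DIM('a)"] M_nonneg
  by (simp add: ennreal_le_iff)

lemma Wr_compare: "0 < s \<Longrightarrow> s \<le> t \<Longrightarrow> t \<le> 2 * s \<Longrightarrow> t \<le> T \<Longrightarrow> Wr x s \<le> compare_const (real DIM('a)) d L * Wr x t"
  using W_compare[of s t x x] ennreal_Wr[of t x] ennreal_Wr[of s x] compare_const_ge_0[of "real DIM('a)" d L]
  by (simp add: ennreal_le_iff ennreal_mult'[symmetric])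

lemma src_eq: "0 < s \<Longrightarrow> s < T \<Longrightarrow> src (y, s) = ennreal (s powr (\<delta> - 1) * Wr y s)"
  by (simp add: src_def ennreal_Wr ennreal_mult')

lemma dens_iff:
  "f \<in> dens \<kappa> \<longleftrightarrow> f \<in> borel_measurable borel \<and>
     (\<forall>y s. 0 < s \<longrightarrow> s < T \<longrightarrow> \<bar>f (y, s)\<bar> \<le> \<kappa> * (s powr (\<delta> - 1) * Wr y s))"
  using \<kappa>_nonneg by (auto simp: dens_def src_eq ennreal_mult'[symmetric] ennreal_le_iff)

text \<open>The unknown is the source \<open>f (y, s) = F y s (u, ..., \<nabla>\<^sup>m u)\<close>, and \<open>U f bs\<close> is the derivative with index
  list \<open>bs\<close> of the solution of the linear equation with source \<open>f\<close>.\<close>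

definition U :: "('a \<times> real \<Rightarrow> real) \<Rightarrow> 'a list \<Rightarrow> 'a \<Rightarrow> real \<Rightarrow> real" where
  "U f bs x t = V0 bs x t + a0 * V bs f x t"

definition Z :: "('a \<times> real \<Rightarrow> real) \<Rightarrow> 'a \<Rightarrow> real \<Rightarrow> 'a list \<Rightarrow> real" where
  "Z f x t = (\<lambda>bs. if bs \<in> (\<Union>j\<le>m. indices j) then U f bs x t else 0)"

lemma Z_in_jets: "Z f x t \<in> jets m"
  by (simp add: Z_def jets_def)

text \<open>By \<open>small\<close> the potential obeys the same bound as the linear part, which
  doubles the constant. It is the same for every source in \<open>dens \<kappa>\<close>, so the
  nonlinearity can be applied again without loss.\<close>

lemma U_le:
  assumes bs: "bs \<in> indices j" "j \<le> m" and t: "0 < t" "t < T" and f: "f \<in> dens \<kappa>"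
  shows "\<bar>U f bs x t\<bar> \<le> 2 * C\<Gamma> * t powr - (real j / d) * Wr x t"
proof -
  let ?P = "potential_const (real DIM('a)) m d L \<delta>"
  have 1: "\<bar>V0 bs x t\<bar> \<le> C\<Gamma> * t powr - (real j / d) * Wr x t"
    using V0_le[OF bs t, of x] t C\<Gamma>_pos by (simp add: ennreal_Wr ennreal_mult'[symmetric] ennreal_le_iff)
  have "\<bar>V bs f x t\<bar> \<le> \<kappa> * C\<Gamma> * ?P * t powr (\<delta> - real j / d) * Wr x t"
    using V_le[OF bs t f \<kappa>_nonneg, of x] t C\<Gamma>_pos \<kappa>_nonneg potential_const_ge_0
    by (simp add: ennreal_Wr ennreal_mult'[symmetric] ennreal_le_iff)
  then have "\<bar>a0\<bar> * \<bar>V bs f x t\<bar> \<le> \<bar>a0\<bar> * (\<kappa> * C\<Gamma> * ?P * t powr (\<delta> - real j / d) * Wr x t)"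
    by (rule mult_left_mono) simp
  also have "\<dots> = (\<bar>a0\<bar> * \<kappa> * ?P * t powr \<delta>) * (C\<Gamma> * t powr - (real j / d) * Wr x t)"
    using t by (simp add: powr_diff powr_minus field_simps)
  also have "\<dots> \<le> 1 * (C\<Gamma> * t powr - (real j / d) * Wr x t)"
  proof (rule mult_right_mono)
    have "\<bar>a0\<bar> * \<kappa> * ?P * t powr \<delta> \<le> \<bar>a0\<bar> * \<kappa> * ?P * T powr \<delta>"
      using t \<delta>_pos \<kappa>_nonneg potential_const_ge_0 by (intro mult_left_mono powr_mono2) auto
    then show "\<bar>a0\<bar> * \<kappa> * ?P * t powr \<delta> \<le> 1" using small by linarith
  qed (use C\<Gamma>_pos in auto)
  finally have "\<bar>a0 * V bs f x t\<bar> \<le> C\<Gamma> * t powr - (real j / d) * Wr x t" by (simp add: abs_mult)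
  with 1 show ?thesis unfolding U_def by linarith
qed

lemma U_continuous:
  assumes "bs \<in> indices j" "j \<le> m" "f \<in> dens \<kappa>"
  shows "continuous_on (UNIV \<times> {0<..<T}) (\<lambda>(x, t). U f bs x t)"
  using V0_continuous[OF assms(1,2)] V_continuous[OF assms \<kappa>_nonneg]
  unfolding U_def case_prod_beta by (intro continuous_intros)

text \<open>Stated for any \<open>z\<close> that agrees with \<open>U f\<close> on
  \<open>indices j\<close>, so that it serves both for the formal jets \<open>Z\<close> and for the
  actual partial derivatives of the solution.\<close>

lemma L2_set_U_le:
  assumes "j \<le> m" "0 < t" "t < T" "f \<in> dens \<kappa>" and z: "\<And>bs. bs \<in> indices j \<Longrightarrow> z bs = U f bs x t"
  shows "L2_set z (indices j) \<le> 2 * C\<Gamma> * real DIM('a) ^ m * t powr - (real j / d) * Wr x t"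
proof -
  have "L2_set z (indices j) \<le> (\<Sum>bs\<in>indices j. \<bar>z bs\<bar>)" by (rule L2_set_le_sum_abs)
  also have "\<dots> \<le> (\<Sum>bs\<in>(indices j :: 'a list set). 2 * C\<Gamma> * t powr - (real j / d) * Wr x t)"
    using U_le assms by (intro sum_mono) auto
  also have "\<dots> = real DIM('a) ^ j * (2 * C\<Gamma> * t powr - (real j / d) * Wr x t)"
    by (simp add: card_indices)
  also have "\<dots> \<le> real DIM('a) ^ m * (2 * C\<Gamma> * t powr - (real j / d) * Wr x t)"
    using C\<Gamma>_pos \<open>j \<le> m\<close> DIM_positive[where 'a='a] by (intro mult_right_mono power_increasing) (auto simp: Suc_le_eq)
  finally show ?thesis by (simp add: mult_ac)
qed

text \<open>All but one of the factors \<open>Wr\<close> are estimated by their supremum; the definition of \<open>\<delta>\<close> collects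
  the resulting powers of \<open>s\<close>.\<close>

lemma F_Z_le:
  assumes s: "0 < s" "s < T" and s': "s \<le> 2 * s'" "s' \<le> s" and f: "f \<in> dens \<kappa>"
  shows "\<bar>F y s (Z f y s')\<bar> \<le> \<kappa> * (s powr (\<delta> - 1) * Wr y s)"
proof -
  let ?P = "\<Sum>j\<in>J. p j" and ?Q = "\<Sum>j\<in>J. real j * p j" and ?w = "Wr y s" and ?N = "real DIM('a)"
  define jc where "jc = jet_const ?N m d L C\<Gamma>"
  have jc: "0 \<le> jc" using C\<Gamma>_pos compare_const_ge_0[of ?N d L] by (simp add: jc_def jet_const_def)
  have fin: "finite J" using J_sub finite_subset by blast
  have J: "J \<noteq> {}" using p_sum by auto
  have L2: "L2_set (Z f y s') (indices j) \<le> jc * s powr - (real j / d) * ?w" if "j \<in> J" for j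
  proof -
    have j: "j \<le> m" using that J_sub by auto
    have "L2_set (Z f y s') (indices j) \<le> 2 * C\<Gamma> * ?N ^ m * s' powr - (real j / d) * Wr y s'"
      using s s' f j by (intro L2_set_U_le) (auto simp: Z_def)
    also have "\<dots> \<le> 2 * C\<Gamma> * ?N ^ m * (2 * s powr - (real j / d)) * (compare_const ?N d L * ?w)"
    proof (intro mult_mono mult_left_mono Wr_compare)
      have "s' powr - (real j / d) \<le> (s / 2) powr - (real j / d)"
        using s s' order_quotient(1)[OF j] by (intro powr_mono2') auto
      also have "\<dots> = 2 powr (real j / d) * s powr - (real j / d)"
        using s by (simp add: powr_divide powr_minus field_simps)
      also have "\<dots> \<le> 2 powr 1 * s powr - (real j / d)"
        using order_quotient(2)[OF j] by (intro mult_right_mono powr_mono) auto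
      finally show "s' powr - (real j / d) \<le> 2 * s powr - (real j / d)" by simp
    qed (use s s' C\<Gamma>_pos in auto)
    finally show ?thesis by (simp add: jc_def jet_const_def mult_ac)
  qed
  have "\<bar>F y s (Z f y s')\<bar> \<le> s powr A * (\<Prod>j\<in>J. L2_set (Z f y s') (indices j) powr p j)"
    using s by (intro F_bound Z_in_jets)
  also have "\<dots> \<le> s powr A * (\<Prod>j\<in>J. (jc * s powr - (real j / d) * ?w) powr p j)"
    using L2 p_pos by (intro mult_left_mono prod_mono conjI powr_mono2 powr_ge_zero) (auto simp: less_imp_le L2_set_nonneg)
  also have "(\<Prod>j\<in>J. (jc * s powr - (real j / d) * ?w) powr p j)
      = (\<Prod>j\<in>J. jc powr p j) * (\<Prod>j\<in>J. s powr (- (real j / d) * p j)) * (\<Prod>j\<in>J. ?w powr p j)"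
    using jc by (simp add: powr_mult powr_powr prod.distrib)
  also have "(\<Prod>j\<in>J. s powr (- (real j / d) * p j)) = s powr (- ?Q / d)"
    using s by (simp add: powr_sum[symmetric] sum_negf sum_divide_distrib)
  \<comment> \<open>Stated for general \<open>c\<close> and then instantiated at \<open>jc\<close>.
    The case \<open>c = 0\<close> is separate, with \<open>0 powr _ = 0\<close> on both sides
    because \<open>J\<close> is nonempty and finite.\<close>
  also have "(\<Prod>j\<in>J. c powr p j) = c powr ?P" if "0 \<le> c" for c :: real
    using that J fin by (cases "c = 0") (auto simp: powr_sum)
  note this[OF jc] 
  also have "(\<Prod>j\<in>J. ?w powr p j) = ?w powr ?P"
    using J fin by (cases "?w = 0") (auto simp: powr_sum)
  also have "?w powr ?P = ?w powr (?P - 1) * ?w"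
    by (cases "?w = 0") (auto simp: powr_diff)
  also have "s powr A * (jc powr ?P * s powr (- ?Q / d) * (?w powr (?P - 1) * ?w))
      \<le> s powr A * (jc powr ?P * s powr (- ?Q / d) * ((uloc_const ?N L * M * s powr - (?N / d)) powr (?P - 1) * ?w))"
    using s p_sum Wr_le[of s y] by (intro mult_left_mono mult_right_mono powr_mono2) auto
  also have "(uloc_const ?N L * M * s powr - (?N / d)) powr (?P - 1)
     = (uloc_const ?N L * M) powr (?P - 1) * s powr (- (?N / d) * (?P - 1))"
    using uloc_const_pos[OF L_pos, of ?N] M_nonneg by (simp add: powr_mult powr_powr)
  also have "s powr A * (jc powr ?P * s powr (- ?Q / d) * ((uloc_const ?N L * M) powr (?P - 1) * s powr (- (?N / d) * (?P - 1)) * ?w))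
     = \<kappa> * ((s powr A * s powr (- ?Q / d) * s powr (- (?N / d) * (?P - 1))) * ?w)"
    by (simp only: \<kappa>_eq jc_def mult_ac)
  also have "s powr A * s powr (- ?Q / d) * s powr (- (?N / d) * (?P - 1)) = s powr (\<delta> - 1)"
    by (simp add: powr_add[symmetric] \<delta>_eq algebra_simps)
  finally show ?thesis .
qed

lemma Z_continuous:
  assumes "f \<in> dens \<kappa>"
  shows "continuous_on (UNIV \<times> {0<..<T}) (\<lambda>(x, t). Z f x t)"
proof (rule continuous_on_coordinatewise_then_product)
  fix bs
  show "continuous_on (UNIV \<times> {0<..<T}) (\<lambda>q. (case q of (x, t) \<Rightarrow> Z f x t) bs)"
  proof (cases "bs \<in> (\<Union>j\<le>m. indices j)")
    case True
    then obtain j where "bs \<in> indices j" "j \<le> m" by auto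
    then show ?thesis using U_continuous[of bs j f] assms True by (simp add: Z_def case_prod_beta)
  next
    case False
    then show ?thesis unfolding Z_def case_prod_beta by simp
  qed
qed

section \<open>The delayed equation\<close>

lemma F_Z_delay_continuous:
  assumes f: "f \<in> dens \<kappa>" and "0 \<le> \<epsilon>"
  shows "continuous_on (UNIV \<times> {\<epsilon><..<T}) (\<lambda>(y, s). F y s (Z f y (s - \<epsilon> / 2)))"
proof -
  have "continuous_on (UNIV \<times> {\<epsilon><..<T}) (\<lambda>q. case (fst q, snd q - \<epsilon> / 2) of (x, t) \<Rightarrow> Z f x t)"
    using assms by (intro continuous_on_compose2[OF Z_continuous[OF f]] continuous_intros) auto
  then have Z: "continuous_on (UNIV \<times> {\<epsilon><..<T}) (\<lambda>q. Z f (fst q) (snd q - \<epsilon> / 2))"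
    by (simp only: prod.case)
  have "continuous_on (UNIV \<times> {\<epsilon><..<T})
     (\<lambda>q. case (fst q, snd q, Z f (fst q) (snd q - \<epsilon> / 2)) of (x, t, z) \<Rightarrow> F x t z)"
    using assms
    by (intro continuous_on_compose2[OF F_cont] continuous_on_Pair continuous_on_fst continuous_on_snd continuous_on_id Z)
       (auto simp: Z_in_jets)
  then show ?thesis by (simp add: case_prod_beta)
qed

text \<open>The delay is half of the cut-off: for \<open>s > \<epsilon>\<close> the shifted time
  lies between \<open>s / 2\<close> and \<open>s\<close>, as \<open>F_Z_le\<close> requires. The
  invariant bound therefore has the same \<kappa> for every \<epsilon>.\<close>

definition delay :: "real \<Rightarrow> ('a \<times> real \<Rightarrow> real) \<Rightarrow> 'a \<times> real \<Rightarrow> real" where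
  "delay \<epsilon> f = (\<lambda>(y, s). if \<epsilon> < s \<and> s < T then F y s (Z f y (s - \<epsilon> / 2)) else 0)"

lemma delay_in_dens:
  assumes "0 < \<epsilon>" and f: "f \<in> dens \<kappa>"
  shows "delay \<epsilon> f \<in> dens \<kappa>"
proof -
  have "open (UNIV \<times> {\<epsilon><..<T} :: ('a \<times> real) set)" by (intro open_Times) auto
  then have "(\<lambda>q. indicator (UNIV \<times> {\<epsilon><..<T}) q *\<^sub>R (case q of (y, s) \<Rightarrow> F y s (Z f y (s - \<epsilon> / 2)))) \<in> borel_measurable borel"
    using F_Z_delay_continuous[OF f, of \<epsilon>] assms by (intro borel_measurable_continuous_on_indicator) auto
  moreover have "(\<lambda>q. indicator (UNIV \<times> {\<epsilon><..<T}) q *\<^sub>R (case q of (y, s) \<Rightarrow> F y s (Z f y (s - \<epsilon> / 2)))) = delay \<epsilon> f"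
    by (auto simp: delay_def indicator_def fun_eq_iff)
  ultimately have "delay \<epsilon> f \<in> borel_measurable borel" by simp
  moreover have "\<bar>delay \<epsilon> f (y, s)\<bar> \<le> \<kappa> * (s powr (\<delta> - 1) * Wr y s)" if "0 < s" "s < T" for y s
    using F_Z_le[OF that, of "s - \<epsilon> / 2" f y] assms \<kappa>_nonneg that by (auto simp: delay_def)
  ultimately show ?thesis by (simp add: dens_iff)
qed

text \<open>Causality: \<open>K\<close> vanishes for \<open>s \<ge> t\<close>, so the jet at time
  \<open>t\<close> sees the source only at earlier times.\<close>

lemma Z_cong:
  assumes "\<And>y s. 0 < s \<Longrightarrow> s < t \<Longrightarrow> f (y, s) = g (y, s)"
  shows "Z f x t = Z g x t"
proof -
  have "V bs f x t = V bs g x t" for bs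
    unfolding V_def by (intro Bochner_Integration.integral_cong) (auto simp: K_def indicator_def assms)
  then show ?thesis by (simp add: Z_def U_def cong: if_cong)
qed

text \<open>The delay makes the fixed point equation explicit on successive intervals of length \<open>\<epsilon> / 2\<close>.\<close>

lemma delay_fixed_point:
  assumes \<epsilon>: "0 < \<epsilon>"
  shows "\<exists>f. f \<in> dens \<kappa> \<and> (\<forall>y s. s < T \<longrightarrow> delay \<epsilon> f (y, s) = f (y, s))"
proof -
  define g where "g k = (delay \<epsilon> ^^ k) (\<lambda>_. 0)" for k
  have g: "g k \<in> dens \<kappa>" for k
  proof (induction k)
    case 0
    show ?case by (simp add: g_def dens_iff \<kappa>_nonneg)
  qed (simp add: g_def delay_in_dens[OF \<epsilon>])
  \<comment> \<open>The iterate \<open>g k\<close> is already stationary at times up to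
    \<open>real k * (\<epsilon> / 2)\<close>, because its next value at \<open>s\<close> uses only
    times before \<open>s - \<epsilon> / 2\<close>. For \<open>k = 0\<close> both sides vanish by
    the cut-off.\<close>
  have eq: "g (Suc k) (y, s) = g k (y, s)" if "s \<le> real k * (\<epsilon> / 2)" for k y s
    using that
  proof (induction k arbitrary: y s)
    case 0
    then show ?case using \<epsilon> by (simp add: g_def delay_def)
  next
    case (Suc k)
    have "Z (g (Suc k)) y (s - \<epsilon> / 2) = Z (g k) y (s - \<epsilon> / 2)"
      using Suc.prems by (intro Z_cong Suc.IH) (auto simp: algebra_simps)
    then show ?case by (simp add: g_def delay_def)
  qed
  obtain k where "T < real k * (\<epsilon> / 2)"
    using reals_Archimedean3[of "\<epsilon> / 2"] \<epsilon> by auto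
  then show ?thesis
    using g[of k] eq[of _ k] by (intro exI[of _ "g k"]) (simp add: g_def)
qed

end

section \<open>Passing to the limit in the delay\<close>

lemma tendsto_fun_coordinatewise:
  fixes f :: "'c \<Rightarrow> 'i \<Rightarrow> 'b::topological_space"
  assumes "\<And>i. ((\<lambda>n. f n i) \<longlongrightarrow> l i) \<F>"
  shows "(f \<longlongrightarrow> l) \<F>"
proof -
  have "limitin (product_topology (\<lambda>_. euclidean) UNIV) f l \<F>"
    using assms by (simp add: limitin_componentwise)
  then show ?thesis by (simp add: euclidean_product_topology)
qed

context nonlinear_problem
begin

text \<open>The linear part does not involve the source, so its plain continuity is enough; the
  uniformity comes from \<open>V_equicontinuous\<close>.\<close>

lemma U_equicontinuous:
  assumes bs: "bs \<in> indices j" "j \<le> m" and t0: "0 < t0" "t0 < T" and e: "0 < e"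
  shows "\<exists>r>0. \<forall>f\<in>dens \<kappa>. \<forall>x t. 0 < t \<longrightarrow> t < T \<longrightarrow> dist (x, t) (x0, t0) < r \<longrightarrow> \<bar>U f bs x t - U f bs x0 t0\<bar> < e"
proof -
  obtain r1 where r1: "0 < r1" "\<And>x t. 0 < t \<Longrightarrow> t < T \<Longrightarrow> dist (x, t) (x0, t0) < r1 \<Longrightarrow> \<bar>V0 bs x t - V0 bs x0 t0\<bar> < e / 2"
  proof -
    have "\<exists>r>0. \<forall>q\<in>UNIV \<times> {0<..<T}. dist q (x0, t0) < r \<longrightarrow>
        dist (case q of (x, t) \<Rightarrow> V0 bs x t) (case (x0, t0) of (x, t) \<Rightarrow> V0 bs x t) < e / 2"
      by (rule V0_continuous[OF bs, unfolded continuous_on_iff, rule_format]) (use t0 e in auto)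
    then obtain r where "r > 0" "\<forall>q\<in>UNIV \<times> {0<..<T}. dist q (x0, t0) < r \<longrightarrow>
        dist (case q of (x, t) \<Rightarrow> V0 bs x t) (case (x0, t0) of (x, t) \<Rightarrow> V0 bs x t) < e / 2" by blast
    then show ?thesis using that[of r] by (auto simp: dist_real_def)
  qed
  define e' where "e' = e / 2 / (\<bar>a0\<bar> + 1)"
  have e': "0 < e'" "\<bar>a0\<bar> * e' \<le> e / 2" using e by (auto simp: e'_def field_simps)
  obtain r2 where r2: "0 < r2" "\<And>f x t. f \<in> dens \<kappa> \<Longrightarrow> dist (x, t) (x0, t0) < r2 \<Longrightarrow> \<bar>V bs f x t - V bs f x0 t0\<bar> < e'"
    using V_equicontinuous[OF bs t0 e'(1) \<kappa>_nonneg, of x0] by metis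
  show ?thesis
  proof (intro exI[of _ "min r1 r2"] conjI ballI allI impI)
    fix f x t assume *: "f \<in> dens \<kappa>" "0 < t" "t < T" "dist (x, t) (x0, t0) < min r1 r2"
    have "\<bar>a0 * V bs f x t - a0 * V bs f x0 t0\<bar> = \<bar>a0\<bar> * \<bar>V bs f x t - V bs f x0 t0\<bar>"
      by (simp add: abs_mult[symmetric] right_diff_distrib)
    also have "\<dots> \<le> \<bar>a0\<bar> * e'" using r2(2)[of f x t] * by (intro mult_left_mono) auto
    finally have "\<bar>a0 * V bs f x t - a0 * V bs f x0 t0\<bar> \<le> \<bar>a0\<bar> * e'" .
    moreover have "\<bar>V0 bs x t - V0 bs x0 t0\<bar> < e / 2" using * by (intro r1(2)) auto
    ultimately show "\<bar>U f bs x t - U f bs x0 t0\<bar> < e" using e'(2) unfolding U_def by arith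
  qed (use r1 r2 in auto)
qed

text \<open>The argument of Arzela and Ascoli: a diagonal sequence converges on a countable dense
  set for all index lists at once, and equicontinuity makes it Cauchy at every other point.
  Pointwise convergence is all that dominated convergence will need.\<close>

lemma convergent_subsequence_U:
  assumes f: "\<And>n. f n \<in> dens \<kappa>"
  shows "\<exists>\<sigma>::nat \<Rightarrow> nat. strict_mono \<sigma> \<and> (\<forall>bs j x t. bs \<in> indices j \<longrightarrow> j \<le> m \<longrightarrow> 0 < t \<longrightarrow> t < T
    \<longrightarrow> convergent (\<lambda>n. U (f (\<sigma> n)) bs x t))"
proof -
  obtain D :: "('a \<times> real) set" where D: "countable D" "\<And>X. open X \<Longrightarrow> X \<noteq> {} \<Longrightarrow> \<exists>q\<in>D. q \<in> X"
    using countable_dense_exists by metis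
  let ?I = "(\<Union>j\<le>m. indices j) :: 'a list set"
  let ?S = "?I \<times> (D \<inter> UNIV \<times> {0<..<T})"
  \<comment> \<open>The bound on \<open>U\<close> blows up as \<open>t\<close> tends to 0, while the
    diagonal argument uses one bound for all points; dividing by \<open>h\<close> normalises the
    values to at most 1. The summand 1 keeps \<open>h\<close> positive.\<close>
  define h where "h bs x t = 2 * C\<Gamma> * t powr - (real (length bs) / d) * Wr x t + 1" for bs :: "'a list" and x t
  have h: "0 < h bs x t" for bs x t using C\<Gamma>_pos by (simp add: h_def add_nonneg_pos)
  let ?g = "\<lambda>n (bs, x, t). U (f n) bs x t / h bs x t"
  have "countable ?I" by (rule countable_finite) (auto simp: finite_indices)
  then have count: "countable ?S" using D(1) by (intro countable_SIGMA) auto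
  have bound: "norm (?g n q) \<le> 1" if "q \<in> ?S" for n q
  proof -
    obtain bs x t where q: "q = (bs, x, t)" by (cases q)
    then have bs: "bs \<in> indices (length bs)" "length bs \<le> m" "0 < t" "t < T"
      using that by (auto simp: indices_def)
    have "\<bar>U (f n) bs x t\<bar> \<le> h bs x t"
      using U_le[OF bs f[of n], of x] by (simp add: h_def)
    then show ?thesis using h[of bs x t] by (simp add: q)
  qed
  have "\<exists>\<sigma>. strict_mono (\<sigma> :: nat \<Rightarrow> nat) \<and> (\<forall>q\<in>?S. \<exists>l. (\<lambda>n. ?g (\<sigma> n) q) \<longlonglongrightarrow> l)"
  proof (rule function_convergent_subsequence[where f="?g" and M=1 and S="?S"])
    show "\<exists>\<sigma>. strict_mono (\<sigma> :: nat \<Rightarrow> nat) \<and> (\<forall>q\<in>?S. \<exists>l. (\<lambda>n. ?g (\<sigma> n) q) \<longlonglongrightarrow> l)"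
      if "strict_mono k" "\<And>q. q \<in> ?S \<Longrightarrow> \<exists>l. (\<lambda>n. ?g (k n) q) \<longlonglongrightarrow> l" for k :: "nat \<Rightarrow> nat"
      using that by (intro exI[of _ k] conjI ballI)
  qed (fact count, rule bound)
  then obtain \<sigma> where \<sigma>: "strict_mono (\<sigma> :: nat \<Rightarrow> nat)" "\<And>q. q \<in> ?S \<Longrightarrow> \<exists>l. (\<lambda>n. ?g (\<sigma> n) q) \<longlonglongrightarrow> l"
    by blast
  have convD: "convergent (\<lambda>n. U (f (\<sigma> n)) bs x t)" if "bs \<in> ?I" "(x, t) \<in> D" "0 < t" "t < T" for bs x t
  proof -
    have "\<exists>l. (\<lambda>n. ?g (\<sigma> n) (bs, x, t)) \<longlonglongrightarrow> l" using that by (intro \<sigma>(2)) auto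
    then obtain l where "(\<lambda>n. U (f (\<sigma> n)) bs x t / h bs x t) \<longlonglongrightarrow> l" by auto
    from tendsto_mult[OF this tendsto_const[of "h bs x t"]]
    show ?thesis using h[of bs x t] by (auto simp: convergent_def)
  qed
  show ?thesis
  proof (intro exI[of _ \<sigma>] conjI allI impI \<sigma>(1))
    fix bs :: "'a list" and j and x0 :: 'a and t0 :: real
    assume bs: "bs \<in> indices j" "j \<le> m" and t0: "0 < t0" "t0 < T"
    have "Cauchy (\<lambda>n. U (f (\<sigma> n)) bs x0 t0)"
    proof (rule metric_CauchyI)
      fix e :: real assume e: "0 < e"
      obtain r where r: "0 < r" "\<And>f x t. f \<in> dens \<kappa> \<Longrightarrow> 0 < t \<Longrightarrow> t < T \<Longrightarrow> dist (x, t) (x0, t0) < r \<Longrightarrow> \<bar>U f bs x t - U f bs x0 t0\<bar> < e / 3"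
        using U_equicontinuous[OF bs t0, of "e / 3" x0] e by fastforce
      have "open (ball (x0, t0) r \<inter> UNIV \<times> {0<..<T})" by (intro open_Int open_Times) auto
      moreover have "(x0, t0) \<in> ball (x0, t0) r \<inter> UNIV \<times> {0<..<T}" using r t0 by auto
      ultimately obtain q where "q \<in> D" "q \<in> ball (x0, t0) r \<inter> UNIV \<times> {0<..<T}" using D(2) by blast
      then obtain x t where xt: "(x, t) \<in> D" "dist (x, t) (x0, t0) < r" "0 < t" "t < T"
        by (cases q) (auto simp: dist_commute)
      have "Cauchy (\<lambda>n. U (f (\<sigma> n)) bs x t)"
        using convD[of bs x t] xt bs by (auto intro: convergent_Cauchy)
      then obtain N where N: "\<And>k n. k \<ge> N \<Longrightarrow> n \<ge> N \<Longrightarrow> dist (U (f (\<sigma> k)) bs x t) (U (f (\<sigma> n)) bs x t) < e / 3"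
        using e unfolding Cauchy_def by (metis divide_pos_pos zero_less_numeral)
      have "dist (U (f (\<sigma> k)) bs x0 t0) (U (f (\<sigma> n)) bs x0 t0) < e" if "k \<ge> N" "n \<ge> N" for k n
        using N[OF that] r(2)[OF f xt(3,4,2), of "\<sigma> k"] r(2)[OF f xt(3,4,2), of "\<sigma> n"]
        unfolding dist_real_def by arith
      then show "\<exists>N. \<forall>k\<ge>N. \<forall>n\<ge>N. dist (U (f (\<sigma> k)) bs x0 t0) (U (f (\<sigma> n)) bs x0 t0) < e" by blast
    qed
    then show "convergent (\<lambda>n. U (f (\<sigma> n)) bs x0 t0)" by (simp add: real_Cauchy_convergent)
  qed
qed

text \<open>All sources share the majorant \<kappa> times \<open>src\<close>. This majorant is
  itself a member of \<open>dens \<kappa>\<close>, so its integrability against the kernel is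
  already known from \<open>integrable_K_dens\<close>.\<close>

lemma V_tendsto:
  assumes bs: "bs \<in> indices j" "j \<le> m" and t: "0 < t" "t < T"
    and f: "\<And>n. f n \<in> dens \<kappa>" and g: "g \<in> dens \<kappa>"
    and lim: "\<And>y s. 0 < s \<Longrightarrow> s < T \<Longrightarrow> (\<lambda>n. f n (y, s)) \<longlonglongrightarrow> g (y, s)"
  shows "(\<lambda>n. V bs (f n) x t) \<longlonglongrightarrow> V bs g x t"
  unfolding V_def
proof (rule integral_dominated_convergence[where w="\<lambda>\<omega>. \<bar>K bs x t \<omega>\<bar> * (\<kappa> * enn2real (src \<omega>))"])
  note [measurable] = K_measurable'[OF bs t(2)] dens_measurable[OF f] dens_measurable[OF g]
  show "(\<lambda>\<omega>. K bs x t \<omega> * g \<omega>) \<in> borel_measurable lborel" "(\<lambda>\<omega>. K bs x t \<omega> * f n \<omega>) \<in> borel_measurable lborel" for n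
    by measurable
  have src: "src (y, s) = ennreal (enn2real (src (y, s)))" if "0 < s" "s < T" for y s
    using that by (simp add: src_eq)
  have w: "(\<lambda>\<omega>. \<kappa> * enn2real (src \<omega>)) \<in> dens \<kappa>"
    unfolding dens_def
  proof (safe)
    show "(\<lambda>\<omega>. \<kappa> * enn2real (src \<omega>)) \<in> borel_measurable borel" by measurable
    show "ennreal \<bar>\<kappa> * enn2real (src (y, s))\<bar> \<le> ennreal \<kappa> * src (y, s)" if "0 < s" "s < T" for y s
      using src[OF that, of y] \<kappa>_nonneg by (simp add: abs_mult ennreal_mult')
  qed
  show "integrable lborel (\<lambda>\<omega>. \<bar>K bs x t \<omega>\<bar> * (\<kappa> * enn2real (src \<omega>)))"
    using integrable_abs[OF integrable_K_dens[OF bs t w \<kappa>_nonneg, of x]] \<kappa>_nonneg by (simp add: abs_mult)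
  show "AE \<omega> in lborel. (\<lambda>n. K bs x t \<omega> * f n \<omega>) \<longlonglongrightarrow> K bs x t \<omega> * g \<omega>"
  proof (rule AE_I2)
    fix \<omega> :: "'a \<times> real"
    obtain y s where \<omega>: "\<omega> = (y, s)" by (cases \<omega>)
    show "(\<lambda>n. K bs x t \<omega> * f n \<omega>) \<longlonglongrightarrow> K bs x t \<omega> * g \<omega>"
    proof (cases "0 < s \<and> s < t")
      case True
      then show ?thesis using lim[of s y] t by (auto simp: \<omega> intro!: tendsto_intros)
    qed (auto simp: \<omega> K_def)
  qed
  show "AE \<omega> in lborel. norm (K bs x t \<omega> * f n \<omega>) \<le> \<bar>K bs x t \<omega>\<bar> * (\<kappa> * enn2real (src \<omega>))" for n
  proof (rule AE_I2)
    fix \<omega> :: "'a \<times> real"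
    obtain y s where \<omega>: "\<omega> = (y, s)" by (cases \<omega>)
    show "norm (K bs x t \<omega> * f n \<omega>) \<le> \<bar>K bs x t \<omega>\<bar> * (\<kappa> * enn2real (src \<omega>))"
    proof (cases "0 < s \<and> s < t")
      case True
      then have "\<bar>f n \<omega>\<bar> \<le> \<kappa> * enn2real (src \<omega>)"
        using f[of n] t by (auto simp: \<omega> dens_iff src_eq)
      then show ?thesis by (simp add: abs_mult mult_left_mono)
    qed (auto simp: \<omega> K_def)
  qed
qed

text \<open>The limit source \<open>g\<close> is defined through the limits \<open>Z'\<close> of the
  jets. Continuity of \<open>F\<close> gives convergence of the sources to \<open>g\<close>, hence
  convergence of their potentials to those of \<open>g\<close>; uniqueness of limits then identifies
  \<open>Z'\<close> with the jets of \<open>g\<close>, which closes the equation.\<close>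

lemma fixed_point:
  "\<exists>f. f \<in> dens \<kappa> \<and> (\<forall>y s. 0 < s \<longrightarrow> s < T \<longrightarrow> f (y, s) = F y s (Z f y s))"
proof -
  define \<epsilon> where "\<epsilon> n = inverse (real (Suc n))" for n
  have \<epsilon>_pos: "0 < \<epsilon> n" for n by (simp add: \<epsilon>_def)
  have "\<forall>n. \<exists>f. f \<in> dens \<kappa> \<and> (\<forall>y s. s < T \<longrightarrow> delay (\<epsilon> n) f (y, s) = f (y, s))"
    by (intro allI delay_fixed_point \<epsilon>_pos)
  from choice[OF this] obtain f0 where f0: "\<And>n. f0 n \<in> dens \<kappa>" "\<And>n y s. s < T \<Longrightarrow> delay (\<epsilon> n) (f0 n) (y, s) = f0 n (y, s)"
    by auto
  obtain \<sigma> where \<sigma>: "strict_mono (\<sigma> :: nat \<Rightarrow> nat)"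
    "\<And>bs j x t. bs \<in> indices j \<Longrightarrow> j \<le> m \<Longrightarrow> 0 < t \<Longrightarrow> t < T \<Longrightarrow> convergent (\<lambda>n. U (f0 (\<sigma> n)) bs x t)"
    using convergent_subsequence_U[where f=f0, OF f0(1)] by blast
  define f where "f n = f0 (\<sigma> n)" for n
  define e where "e n = \<epsilon> (\<sigma> n)" for n
  have f: "f n \<in> dens \<kappa>" for n using f0 by (simp add: f_def)
  have fd: "f n (y, s) = (if e n < s then F y s (Z (f n) y (s - e n / 2)) else 0)" if "s < T" for n y s
    unfolding f_def e_def by (subst f0(2)[OF that, symmetric]) (simp add: delay_def that)
  have "\<epsilon> \<longlonglongrightarrow> 0" unfolding \<epsilon>_def by (rule LIMSEQ_inverse_real_of_nat)
  from LIMSEQ_subseq_LIMSEQ[OF this \<sigma>(1)] have e: "e \<longlonglongrightarrow> 0" by (simp add: e_def[abs_def] o_def)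
  have e_pos: "0 < e n" for n by (simp add: e_def \<epsilon>_pos)
  define Z' where "Z' x t bs = (if bs \<in> (\<Union>j\<le>m. indices j) then lim (\<lambda>n. U (f n) bs x t) else 0)" for x :: 'a and t bs
  have Z': "Z' x t \<in> jets m" for x t unfolding Z'_def jets_def by simp
  have Ulim: "(\<lambda>n. U (f n) bs x t) \<longlonglongrightarrow> Z' x t bs" if "bs \<in> indices j" "j \<le> m" "0 < t" "t < T" for bs j x t
    using \<sigma>(2)[OF that, of x] that by (auto simp: Z'_def f_def convergent_LIMSEQ_iff)
  define g where "g = (\<lambda>(y, s). if 0 < s \<and> s < T then F y s (Z' y s) else 0)"
  have flim: "(\<lambda>n. f n (y, s)) \<longlonglongrightarrow> g (y, s)" if s: "0 < s" "s < T" for y s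
  proof -
    have Zlim: "(\<lambda>n. Z (f n) y (s - e n / 2)) \<longlonglongrightarrow> Z' y s"
    proof (rule tendsto_fun_coordinatewise)
      fix bs :: "'a list"
      show "(\<lambda>n. Z (f n) y (s - e n / 2) bs) \<longlonglongrightarrow> Z' y s bs"
      proof (cases "bs \<in> (\<Union>j\<le>m. indices j)")
        case False
        then show ?thesis unfolding Z_def Z'_def by simp
      next
        case True
        then obtain j where bs: "bs \<in> indices j" "j \<le> m" by auto
        \<comment> \<open>The function and the time change together, so continuity of each single
          function would not suffice; the common radius of \<open>U_equicontinuous\<close> removes
          the delay.\<close>
        have "(\<lambda>n. U (f n) bs y (s - e n / 2) - U (f n) bs y s) \<longlonglongrightarrow> 0"
        proof (rule LIMSEQ_I)
          fix \<eta> :: real assume "0 < \<eta>"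
          then obtain r where r: "0 < r" "\<And>f x t. f \<in> dens \<kappa> \<Longrightarrow> 0 < t \<Longrightarrow> t < T \<Longrightarrow> dist (x, t) (y, s) < r \<Longrightarrow> \<bar>U f bs x t - U f bs y s\<bar> < \<eta>"
            using U_equicontinuous[OF bs s, of \<eta> y] by blast
          have "\<forall>\<^sub>F n in sequentially. e n < min r s"
            using e r s by (intro order_tendstoD) auto
          then obtain N where N: "\<And>n. n \<ge> N \<Longrightarrow> e n < min r s" by (auto simp: eventually_sequentially)
          have "norm (U (f n) bs y (s - e n / 2) - U (f n) bs y s - 0) < \<eta>" if "n \<ge> N" for n
            using N[OF that] e_pos[of n] s r(2)[OF f, of "s - e n / 2" y n] by (simp add: dist_Pair_Pair dist_real_def)
          then show "\<exists>N. \<forall>n\<ge>N. norm (U (f n) bs y (s - e n / 2) - U (f n) bs y s - 0) < \<eta>" by blast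
        qed
        from tendsto_add[OF this Ulim[OF bs s, of y]] show ?thesis
          using True by (simp add: Z_def)
      qed
    qed
    have "(\<lambda>n. case (y, s, Z (f n) y (s - e n / 2)) of (x, t, z) \<Rightarrow> F x t z) \<longlonglongrightarrow> (case (y, s, Z' y s) of (x, t, z) \<Rightarrow> F x t z)"
      by (rule continuous_on_tendsto_compose[OF F_cont])
         (use s Z' in \<open>auto intro!: tendsto_intros Zlim simp: Z_in_jets\<close>)
    then have "(\<lambda>n. F y s (Z (f n) y (s - e n / 2))) \<longlonglongrightarrow> g (y, s)"
      using s by (simp add: g_def)
    moreover have "\<forall>\<^sub>F n in sequentially. e n < s"
      using e s by (intro order_tendstoD) auto
    then have "\<forall>\<^sub>F n in sequentially. F y s (Z (f n) y (s - e n / 2)) = f n (y, s)"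
      by eventually_elim (simp add: fd s)
    ultimately show ?thesis by (rule Lim_transform_eventually)
  qed
  have g: "g \<in> dens \<kappa>"
    unfolding dens_iff
  proof (safe)
    have [measurable]: "(\<lambda>\<omega>. snd \<omega> :: real) \<in> borel_measurable (borel :: ('a \<times> real) measure)"
      by (intro borel_measurable_continuous_onI continuous_intros)
    show "g \<in> borel_measurable borel"
    proof (rule borel_measurable_LIMSEQ_real)
      \<comment> \<open>Convergence of \<open>f n\<close> is known only at times in
        \<open>{0<..<T}\<close>; elsewhere the indicator matches the value 0 of
        \<open>g\<close>.\<close>
      show "(\<lambda>n. indicator {0<..<T} (snd \<omega>) * f n \<omega>) \<longlonglongrightarrow> g \<omega>" for \<omega>
      proof (cases \<omega>)
        case (Pair y s)
        then show ?thesis using flim[of s y] by (cases "0 < s \<and> s < T") (auto simp: g_def)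
      qed
      show "(\<lambda>\<omega>. indicator {0<..<T} (snd \<omega>) * f n \<omega>) \<in> borel_measurable borel" for n
        using dens_measurable[OF f[of n]] by measurable
    qed
    show "\<bar>g (y, s)\<bar> \<le> \<kappa> * (s powr (\<delta> - 1) * Wr y s)" if "0 < s" "s < T" for y s
      using f that by (intro LIMSEQ_le_const2[OF tendsto_rabs[OF flim[OF that]]]) (auto simp: dens_iff)
  qed
  have "Z' y s = Z g y s" if s: "0 < s" "s < T" for y s
  proof (rule ext)
    fix bs :: "'a list"
    show "Z' y s bs = Z g y s bs"
    proof (cases "bs \<in> (\<Union>j\<le>m. indices j)")
      case False
      then show ?thesis unfolding Z_def Z'_def by simp
    next
      case True
      then obtain j where bs: "bs \<in> indices j" "j \<le> m" by auto
      have "(\<lambda>n. U (f n) bs y s) \<longlonglongrightarrow> U g bs y s"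
        unfolding U_def by (intro tendsto_intros V_tendsto[OF bs s f g flim])
      then have "Z' y s bs = U g bs y s" using Ulim[OF bs s, of y] LIMSEQ_unique by blast
      then show ?thesis using True by (simp add: Z_def)
    qed
  qed
  then show ?thesis using g by (intro exI[of _ g]) (simp add: g_def)
qed


section \<open>From the fixed point to a solution\<close>

lemma U_deriv:
  assumes "bs \<in> indices j" "j < m" "b \<in> Basis" "0 < t" "t < T" "f \<in> dens \<kappa>"
  shows "((\<lambda>h. U f bs (x + h *\<^sub>R b) t) has_real_derivative U f (b # bs) x t) (at 0)"
  unfolding U_def
  by (intro DERIV_add DERIV_cmult V0_deriv[OF assms(1-5)] V_deriv[OF assms \<kappa>_nonneg])

lemma pderivs_U:
  assumes "f \<in> dens \<kappa>" "0 < t" "t < T"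
  shows "bs \<in> indices j \<Longrightarrow> j \<le> m \<Longrightarrow> pderivs bs (\<lambda>x. U f [] x t) x = U f bs x t"
proof (induction bs arbitrary: j x)
  case (Cons b bs)
  then obtain i where i: "j = Suc i" "b \<in> Basis" "bs \<in> indices i" by (auto simp: Cons_in_indices)
  have "pderivs bs (\<lambda>x. U f [] x t) (x + h *\<^sub>R b) = U f bs (x + h *\<^sub>R b) t" for h
    using Cons.prems i by (intro Cons.IH[of i]) auto
  then have "pderivs (b # bs) (\<lambda>x. U f [] x t) x = deriv (\<lambda>h. U f bs (x + h *\<^sub>R b) t) 0"
    by (simp only: pderivs.simps)
  also have "\<dots> = U f (b # bs) x t"
    using Cons.prems i assms by (intro DERIV_imp_deriv U_deriv) auto
  finally show ?case .
qed simp

lemma jet_U: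
  assumes "f \<in> dens \<kappa>" "0 < t" "t < T"
  shows "jet m (\<lambda>x. U f [] x t) y = Z f y t"
  unfolding jet_def Z_def using pderivs_U[OF assms] by (intro ext) auto

text \<open>Here \<phi> is a Borel version of the actual datum \<open>\<phi>0\<close>; changing it
  on a null set affects none of the integrals. The nonlinear term is obtained by splitting the
  space-time integral \<open>V\<close> with Fubini and passing to the completed measure.\<close>

lemma U_integral_eq:
  assumes f: "f \<in> dens \<kappa>" and fp: "\<And>y s. 0 < s \<Longrightarrow> s < T \<Longrightarrow> f (y, s) = F y s (Z f y s)"
    and \<phi>0: "\<phi>0 \<in> borel_measurable lebesgue" "AE y in lebesgue. \<phi>0 y = \<phi> y"
    and t: "0 < t" "t < T"
  shows "integral_eq_at m a0 (\<Gamma> []) F \<phi>0 (U f []) x t"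
proof -
  have bs: "[] \<in> indices 0" "0 \<le> m" by (auto simp: indices_def)
  note [measurable] = dens_measurable[OF f]
  have G: "integrable lebesgue (\<lambda>y. \<Gamma> [] x y t * \<phi> y)" "(LINT y|lebesgue. \<Gamma> [] x y t * \<phi> y) = V0 [] x t"
  proof -
    note i = integrable_\<Gamma>_\<phi>[OF bs t, of x]
    note meas = borel_measurable_integrable[OF i]
    show "integrable lebesgue (\<lambda>y. \<Gamma> [] x y t * \<phi> y)" using i meas by (simp add: integrable_completion)
    show "(LINT y|lebesgue. \<Gamma> [] x y t * \<phi> y) = V0 [] x t" using meas by (simp add: integral_completion V0_def)
  qed
  have \<Gamma>m: "(\<lambda>y. \<Gamma> [] x y t) \<in> borel_measurable lebesgue"
    by (intro measurable_completion \<Gamma>_measurable'[OF bs t]) auto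
  have eq0: "AE y in lebesgue. \<Gamma> [] x y t * \<phi> y = \<Gamma> [] x y t * \<phi>0 y"
    using \<phi>0(2) by eventually_elim simp
  have m0: "(\<lambda>y. \<Gamma> [] x y t * \<phi>0 y) \<in> borel_measurable lebesgue"
    by (intro borel_measurable_times \<Gamma>m \<phi>0)
  have G0: "integrable lebesgue (\<lambda>y. \<Gamma> [] x y t * \<phi>0 y)" "(LINT y|lebesgue. \<Gamma> [] x y t * \<phi>0 y) = V0 [] x t"
    using integrable_cong_AE_imp[OF G(1) m0 eq0] integral_cong_AE[OF borel_measurable_integrable[OF G(1)] m0 eq0] G(2)
    by simp_all
  define k where "k s y = \<Gamma> [] x y (t - s) * F y s (jet m (\<lambda>x. U f [] x s) y)" for s y
  have k: "k s y = \<Gamma> [] x y (t - s) * f (y, s)" if "0 < s" "s < t" for s y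
    using that t fp by (simp add: k_def jet_U[OF f])
  have kK: "indicator {0<..<t} s *\<^sub>R k s y = K [] x t (y, s) * f (y, s)" for s y
    by (auto simp: K_def k indicator_def)
  \<comment> \<open>Fubini would give integrability in \<open>y\<close> for almost every
    \<open>s\<close> only, whereas \<open>integral_eq_at\<close> demands it for every
    \<open>s\<close>. It follows from the pointwise bound on \<open>f\<close> and
    \<open>W_conv\<close>.\<close>
  have ik: "integrable lborel (k s)" if s: "0 < s" "s < t" for s
  proof (rule integrableI_bounded)
    have ts: "0 < t - s" "t - s < T" using s t by auto
    have [measurable]: "(\<lambda>y. f (y, s)) \<in> borel_measurable borel"
      by (rule measurable_compose[OF _ dens_measurable[OF f]]) (auto intro!: borel_measurable_continuous_onI continuous_intros)
    note [measurable] = \<Gamma>_measurable'[OF bs ts]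
    have keq: "k s = (\<lambda>y. \<Gamma> [] x y (t - s) * f (y, s))" using k[OF s] by auto
    show "k s \<in> borel_measurable lborel" unfolding keq by measurable
    let ?c = "C\<Gamma> * (t - s) powr - (real 0 / d) * (\<kappa> * s powr (\<delta> - 1))"
    have c: "0 \<le> ?c" using C\<Gamma>_pos \<kappa>_nonneg by simp
    have "(\<integral>\<^sup>+y. norm (k s y) \<partial>lborel) \<le> (\<integral>\<^sup>+y. ennreal ?c * (ennreal (pk (t - s) (x - y)) * W y s) \<partial>lborel)"
    proof (intro nn_integral_mono)
      fix y
      have "\<bar>k s y\<bar> \<le> (C\<Gamma> * (t - s) powr - (real 0 / d) * pk (t - s) (x - y)) * (\<kappa> * (s powr (\<delta> - 1) * Wr y s))"
        unfolding k[OF s] abs_mult pk_def using f s t C\<Gamma>_pos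
        by (intro mult_mono \<Gamma>_bound[OF bs ts]) (auto simp: dens_iff)
      also have "\<dots> = ?c * (pk (t - s) (x - y) * Wr y s)" by (simp only: mult_ac)
      finally have "ennreal \<bar>k s y\<bar> \<le> ennreal (?c * (pk (t - s) (x - y) * Wr y s))" by (rule ennreal_leI)
      also have "\<dots> = ennreal ?c * (ennreal (pk (t - s) (x - y)) * W y s)"
        using s t c by (simp only: ennreal_Wr less_imp_le ennreal_mult' pk_nonneg)
      finally show "ennreal (norm (k s y)) \<le> ennreal ?c * (ennreal (pk (t - s) (x - y)) * W y s)" by simp
    qed
    also have "\<dots> = ennreal ?c * (\<integral>\<^sup>+y. ennreal (pk (t - s) (x - y)) * W y s \<partial>lborel)"
      by (rule nn_integral_cmult) measurable
    also have "\<dots> \<le> ennreal ?c * (ennreal (conv_const (real DIM('a)) d L) * W x t)"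
      using s by (intro mult_left_mono W_conv) auto
    also have "\<dots> < \<infinity>" using W_finite[of t x] t by (auto simp: ennreal_mult_less_top)
    finally show "(\<integral>\<^sup>+y. norm (k s y) \<partial>lborel) < \<infinity>" .
  qed
  have ik': "integrable lebesgue (k s)" "(LINT y|lebesgue. k s y) = (LINT y|lborel. k s y)" if "0 < s" "s < t" for s
    using ik[OF that] borel_measurable_integrable[OF ik[OF that]] by (simp_all add: integrable_completion integral_completion)
  have iK: "integrable (lborel \<Otimes>\<^sub>M lborel) (\<lambda>(y, s). K [] x t (y, s) * f (y, s))"
    using integrable_K_dens[OF bs t f \<kappa>_nonneg, of x] by (simp add: lborel_prod case_prod_beta')
  let ?k = "\<lambda>s. LINT y|lborel. K [] x t (y, s) * f (y, s)"
  have isk: "integrable lborel ?k"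
    using lborel_pair.integrable_snd[OF iK] .
  have keq: "indicator {0<..<t} s *\<^sub>R (LINT y|lebesgue. k s y) = ?k s" for s
  proof (cases "0 < s \<and> s < t")
    case True
    then show ?thesis using ik'(2)[of s] by (simp add: kK[symmetric])
  qed (auto simp: K_def indicator_def)
  have "V [] f x t = (LINT s|lborel. ?k s)"
    unfolding V_def using lborel_pair.integral_snd[OF iK] by (simp add: lborel_prod case_prod_beta')
  then have L: "set_integrable lebesgue {0<..<t} (\<lambda>s. LINT y|lebesgue. k s y)"
    "(LINT s:{0<..<t}|lebesgue. (LINT y|lebesgue. k s y)) = V [] f x t"
    unfolding set_integrable_def set_lebesgue_integral_def keq
    using isk borel_measurable_integrable[OF isk] by (simp_all add: integrable_completion integral_completion)
  show ?thesis
    unfolding integral_eq_at_def Let_def k_def[symmetric]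
    using G0 ik'(1) L by (simp add: U_def)
qed

lemma exists_solution:
  assumes \<phi>0: "\<phi>0 \<in> borel_measurable lebesgue" "AE y in lebesgue. \<phi>0 y = \<phi> y"
  shows "\<exists>u. is_solution m a0 (\<Gamma> []) F \<phi>0 T u \<and>
    (\<forall>x. \<forall>t\<in>{0<..<T}. \<forall>j\<le>m. grad_norm j (\<lambda>x. u x t) x
       \<le> 2 * C\<Gamma> * real DIM('a) ^ m * uloc_const (real DIM('a)) L * M * t powr (- (real DIM('a) / d) - real j / d))"
proof -
  obtain f where f: "f \<in> dens \<kappa>" "\<And>y s. 0 < s \<Longrightarrow> s < T \<Longrightarrow> f (y, s) = F y s (Z f y s)"
    using fixed_point by blast
  note pd = pderivs_U[OF f(1)]
  let ?N = "real DIM('a)"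
  let ?B = "2 * C\<Gamma> * ?N ^ m * uloc_const ?N L * M"
  have grad: "grad_norm j (\<lambda>x. U f [] x t) x \<le> ?B * t powr (- (?N / d) - real j / d)"
    if t: "0 < t" "t < T" and j: "j \<le> m" for x t j
  proof -
    have "grad_norm j (\<lambda>x. U f [] x t) x \<le> 2 * C\<Gamma> * ?N ^ m * t powr - (real j / d) * Wr x t"
      unfolding grad_norm_def using pd[OF t] j by (intro L2_set_U_le[OF j t f(1)])
    also have "\<dots> \<le> 2 * C\<Gamma> * ?N ^ m * t powr - (real j / d) * (uloc_const ?N L * M * t powr - (?N / d))"
      using C\<Gamma>_pos t by (intro mult_left_mono Wr_le) auto
    also have "\<dots> = ?B * (t powr - (?N / d) * t powr - (real j / d))" by (simp only: mult_ac)
    also have "t powr - (?N / d) * t powr - (real j / d) = t powr (- (?N / d) - real j / d)"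
      by (simp add: powr_add[symmetric])
    finally show ?thesis .
  qed
  have "is_solution m a0 (\<Gamma> []) F \<phi>0 T (U f [])"
    unfolding is_solution_def
  proof (intro conjI ballI allI impI)
    fix \<tau> assume \<tau>: "\<tau> \<in> {0<..<T}"
    show "pderivs_exist_on m UNIV (\<lambda>x. U f [] x t)" if "t \<in> {\<tau><..<T}" for t
      unfolding pderivs_exist_on_def
    proof (intro allI impI ballI)
      fix j and bs :: "'a list" and b x :: 'a assume j: "j < m" "bs \<in> indices j" "b \<in> Basis"
      have t: "0 < t" "t < T" using that \<tau> by auto
      have "(\<lambda>h. pderivs bs (\<lambda>x. U f [] x t) (x + h *\<^sub>R b)) = (\<lambda>h. U f bs (x + h *\<^sub>R b) t)"
        using pd[OF t j(2)] j by simp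
      then show "(\<lambda>h. pderivs bs (\<lambda>x. U f [] x t) (x + h *\<^sub>R b)) differentiable at 0"
        using U_deriv[OF j(2,1,3) t f(1), of x] by (auto simp: real_differentiable_def)
    qed
    fix j and bs :: "'a list" assume j: "j \<le> m" and bs: "bs \<in> indices j"
    have eq: "pderivs bs (\<lambda>x. U f [] x t) x = U f bs x t" if "t \<in> {\<tau><..<T}" for x t
      using pd[of t bs j] that \<tau> j bs by auto
    show "bounded ((\<lambda>(x, t). pderivs bs (\<lambda>x. U f [] x t) x) ` (UNIV \<times> {\<tau><..<T}))"
      unfolding bounded_iff
    proof (intro exI ballI)
      fix v assume "v \<in> (\<lambda>(x, t). pderivs bs (\<lambda>x. U f [] x t) x) ` (UNIV \<times> {\<tau><..<T})"
      then obtain x t where t: "t \<in> {\<tau><..<T}" and v: "v = U f bs x t" using eq by auto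
      then have t': "0 < t" "t < T" using \<tau> by auto
      have "norm v \<le> 2 * C\<Gamma> * t powr - (real j / d) * Wr x t"
        using U_le[OF bs j t' f(1), of x] by (simp add: v)
      also have "\<dots> \<le> 2 * C\<Gamma> * t powr - (real j / d) * (uloc_const ?N L * M * t powr - (?N / d))"
        using t' C\<Gamma>_pos by (intro mult_left_mono Wr_le) auto
      also have "\<dots> \<le> 2 * C\<Gamma> * \<tau> powr - (real j / d) * (uloc_const ?N L * M * \<tau> powr - (?N / d))"
        using t \<tau> t' C\<Gamma>_pos M_nonneg d_pos uloc_const_pos[OF L_pos, of ?N]
        by (intro mult_mono mult_left_mono powr_mono2') auto
      finally show "norm v \<le> 2 * C\<Gamma> * \<tau> powr - (real j / d) * (uloc_const ?N L * M * \<tau> powr - (?N / d))" .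
    qed
    have "continuous_on (UNIV \<times> {\<tau><..<T}) (\<lambda>(x, t). U f bs x t)"
      using \<tau> by (intro continuous_on_subset[OF U_continuous[OF bs j f(1)]]) auto
    then show "continuous_on (UNIV \<times> {\<tau><..<T}) (\<lambda>(x, t). pderivs bs (\<lambda>x. U f [] x t) x)"
      by (rule continuous_on_eq) (auto simp: eq)
  next
    fix x t assume "t \<in> {0<..<T}"
    then show "integral_eq_at m a0 (\<Gamma> []) F \<phi>0 (U f []) x t"
      by (intro U_integral_eq[OF f \<phi>0]) auto
  qed
  then show ?thesis using grad by (intro exI[of _ "U f []"]) auto
qed

end

section \<open>Admissible kernels and locally integrable data\<close>

lemma embed_in_Basis: "b \<in> Basis \<Longrightarrow> (b, 0, 0) \<in> (Basis :: ('a::euclidean_space \<times> 'a \<times> real) set)"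
  by (auto simp: Basis_prod_def zero_prod_def)

lemma embed_in_indices:
  "bs \<in> indices j \<Longrightarrow> map (\<lambda>b. (b, 0, 0)) bs \<in> (indices j :: ('a::euclidean_space \<times> 'a \<times> real) list set)"
  by (auto simp: indices_def intro: embed_in_Basis)

text \<open>Smoothness of the kernel is formulated on the product space, its decay for derivatives
  in \<open>x\<close> alone. A step in a direction \<open>(b, 0, 0)\<close> moves only
  \<open>x\<close>, so both kinds of iterated derivatives agree.\<close>

lemma pderivs_embed:
  "pderivs (map (\<lambda>b. (b, 0, 0)) bs) (\<lambda>(x, y, t). G x y t) (x, y, t) = pderivs bs (\<lambda>x. G x y t) x"
  for G :: "'a::euclidean_space \<Rightarrow> 'a \<Rightarrow> real \<Rightarrow> real"
proof (induction bs arbitrary: x)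
  case (Cons b bs)
  then have "pderivs (map (\<lambda>b. (b, 0, 0)) bs) (\<lambda>(x, y, t). G x y t) ((x, y, t) + h *\<^sub>R (b, 0, 0))
      = pderivs bs (\<lambda>x. G x y t) (x + h *\<^sub>R b)" for h
    by simp
  then show ?case by (simp only: list.map pderivs.simps)
qed simp

lemma admissible_kernelD:
  fixes G :: "'a::euclidean_space \<Rightarrow> 'a \<Rightarrow> real \<Rightarrow> real"
  assumes adm: "admissible_kernel m d L Tstar G" and T: "ereal T \<le> Tstar" and bs: "bs \<in> indices j" "j \<le> m"
  shows "continuous_on (UNIV \<times> UNIV \<times> {0<..<T}) (\<lambda>(x, y, t). pderivs bs (\<lambda>x. G x y t) x)"
    and "j < m \<Longrightarrow> b \<in> Basis \<Longrightarrow> 0 < t \<Longrightarrow> t < T \<Longrightarrow>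
      ((\<lambda>h. pderivs bs (\<lambda>x. G x y t) (x + h *\<^sub>R b)) has_real_derivative pderivs (b # bs) (\<lambda>x. G x y t) x) (at 0)"
proof -
  let ?S = "{(x, y, t). 0 < t \<and> ereal t < Tstar} :: ('a \<times> 'a \<times> real) set"
  let ?bs = "map (\<lambda>b. (b, 0, 0)) bs :: ('a \<times> 'a \<times> real) list"
  have C: "C_on m ?S (\<lambda>(x, y, t). G x y t)" using adm by (simp add: admissible_kernel_def)
  have lt: "t < T \<Longrightarrow> ereal t < Tstar" for t using T less_le_trans[of "ereal t" "ereal T" Tstar] by simp
  have "continuous_on ?S (pderivs ?bs (\<lambda>(x, y, t). G x y t))"
  proof -
    have "\<forall>j\<le>m. \<forall>bs\<in>indices j. continuous_on ?S (pderivs bs (\<lambda>(x, y, t). G x y t))"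
      using C unfolding C_on_def by (rule conjunct2)
    then show ?thesis using bs embed_in_indices[OF bs(1)] by blast
  qed
  then have "continuous_on (UNIV \<times> UNIV \<times> {0<..<T}) (pderivs ?bs (\<lambda>(x, y, t). G x y t))"
    by (rule continuous_on_subset) (auto simp: lt)
  then show "continuous_on (UNIV \<times> UNIV \<times> {0<..<T}) (\<lambda>(x, y, t). pderivs bs (\<lambda>x. G x y t) x)"
    by (rule continuous_on_eq) (auto simp: pderivs_embed)
  assume *: "j < m" "b \<in> Basis" "0 < t" "t < T"
  have "(b, 0, 0) \<in> (Basis :: ('a \<times> 'a \<times> real) set)" using * by (intro embed_in_Basis)
  moreover have "(x, y, t) \<in> ?S" using * lt by auto
  moreover have "pderivs_exist_on m ?S (\<lambda>(x, y, t). G x y t)"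
    using C unfolding C_on_def by (rule conjunct1)
  ultimately have "(\<lambda>h. pderivs ?bs (\<lambda>(x, y, t). G x y t) ((x, y, t) + h *\<^sub>R (b, 0, 0))) differentiable at 0"
    using *(1) embed_in_indices[OF bs(1)] unfolding pderivs_exist_on_def by blast
  then have "(\<lambda>h. pderivs bs (\<lambda>x. G x y t) (x + h *\<^sub>R b)) differentiable at 0"
    by (simp add: pderivs_embed)
  then show "((\<lambda>h. pderivs bs (\<lambda>x. G x y t) (x + h *\<^sub>R b)) has_real_derivative pderivs (b # bs) (\<lambda>x. G x y t) x) (at 0)"
    by (simp add: DERIV_deriv_iff_real_differentiable)
qed

section \<open>Locally integrable data\<close>

lemma locally_integrable_measurable:
  fixes \<phi> :: "'a::euclidean_space \<Rightarrow> real"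
  assumes "locally_integrable \<phi>"
  shows "\<phi> \<in> borel_measurable lebesgue"
proof (rule borel_measurable_LIMSEQ_real)
  show "(\<lambda>n. indicator (cball 0 (real n)) x *\<^sub>R \<phi> x) \<longlonglongrightarrow> \<phi> x" for x
  proof (rule tendsto_eventually)
    have "\<forall>\<^sub>F n in sequentially. norm x \<le> real n"
      using real_arch_simple[of "norm x"] by (meson eventually_sequentiallyI of_nat_mono order_trans)
    then show "\<forall>\<^sub>F n in sequentially. indicator (cball 0 (real n)) x *\<^sub>R \<phi> x = \<phi> x"
      by eventually_elim simp
  qed
  show "(\<lambda>x. indicator (cball 0 (real n)) x *\<^sub>R \<phi> x) \<in> borel_measurable lebesgue" for n
    using assms unfolding locally_integrable_def set_integrable_def
    by (intro borel_measurable_integrable) auto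
qed

lemma nn_integral_ball_le:
  fixes \<phi> :: "'a::euclidean_space \<Rightarrow> real"
  assumes "locally_integrable \<phi>" "0 < R" and le: "ball_average (\<lambda>y. \<bar>\<phi> y\<bar>) x R \<le> c"
  shows "(\<integral>\<^sup>+y\<in>ball x R. ennreal \<bar>\<phi> y\<bar> \<partial>lborel) \<le> ennreal (c * (unit_ball_vol (real DIM('a)) * R ^ DIM('a)))"
proof -
  have "set_integrable lebesgue (cball x R) \<phi>"
    using assms by (auto simp: locally_integrable_def)
  then have "set_integrable lebesgue (ball x R) \<phi>"
    by (rule set_integrable_subset) auto
  then have "set_integrable lebesgue (ball x R) (\<lambda>y. \<bar>\<phi> y\<bar>)"
    by (rule set_integrable_abs)
  then have i: "integrable lebesgue (\<lambda>y. indicator (ball x R) y *\<^sub>R \<bar>\<phi> y\<bar>)"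
    by (simp add: set_integrable_def)
  have vol: "measure lebesgue (ball x R) = unit_ball_vol (real DIM('a)) * R ^ DIM('a)"
    using content_ball[of R x] assms by (simp add: measure_completion)
  \<comment> \<open>The datum is only Lebesgue measurable; \<open>nn_integral_completion\<close>
    identifies the two integrals without any Borel measurability.\<close>
  have "(\<integral>\<^sup>+y\<in>ball x R. ennreal \<bar>\<phi> y\<bar> \<partial>lborel) = (\<integral>\<^sup>+y. ennreal (indicator (ball x R) y *\<^sub>R \<bar>\<phi> y\<bar>) \<partial>lebesgue)"
    unfolding nn_integral_completion by (intro nn_integral_cong) (auto simp: indicator_def)
  also have "\<dots> = ennreal (LINT y:ball x R|lebesgue. \<bar>\<phi> y\<bar>)"
    unfolding set_lebesgue_integral_def by (rule nn_integral_eq_integral[OF i]) auto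
  also have "\<dots> \<le> ennreal (c * (unit_ball_vol (real DIM('a)) * R ^ DIM('a)))"
    using le assms unfolding ball_average_def vol by (intro ennreal_leI) (simp add: pos_divide_le_eq)
  finally show ?thesis .
qed

theorem theorem1p3:
  fixes G :: "'a::euclidean_space \<Rightarrow> 'a \<Rightarrow> real \<Rightarrow> real"
    and F :: "'a \<Rightarrow> real \<Rightarrow> ('a list \<Rightarrow> real) \<Rightarrow> real"
    and m :: nat and a0 d L A r0 :: real and Tstar :: ereal
    and J :: "nat set" and p :: "nat \<Rightarrow> real"
  assumes "admissible_kernel m d L Tstar G"
    and "structure_condition m d J p A F"
    and r0: "r0 = r_crit DIM('a) d J p A"
    and "r0 < 1"
  shows "\<exists>\<gamma>>0. \<forall>\<phi> :: 'a \<Rightarrow> real. locally_integrable \<phi> \<longrightarrow>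
           (\<exists>C>0. \<forall>T>0. ereal T \<le> Tstar \<longrightarrow>
              (SUP x. ereal (ball_average (\<lambda>y. \<bar>\<phi> y\<bar>) x (T powr (1 / d))))
                \<le> ereal (\<gamma> * T powr (- (real DIM('a) / (d * r0)))) \<longrightarrow>
              (\<exists>u. is_solution m a0 G F \<phi> T u \<and>
                   (\<forall>x. \<forall>t\<in>{0<..<T}. \<forall>j\<le>m.
                      grad_norm j (\<lambda>x. u x t) x
                        \<le> C * t powr (- (real DIM('a) / d) - real j / d))))"
proof -
  let ?N = "real DIM('a)"
  define P where "P = (\<Sum>j\<in>J. p j)"
  define Q where "Q = (\<Sum>j\<in>J. real j * p j)"
  have mL: "real m < d" "0 < L" using assms(1) by (auto simp: admissible_kernel_def)
  then have d: "0 < d" using of_nat_0_le_iff[of m, where 'a=real] by linarith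
  obtain CG where CG: "0 < CG" and Gb: "\<And>x y t j. j \<le> m \<Longrightarrow> 0 < t \<Longrightarrow> ereal t < Tstar \<Longrightarrow>
      grad_norm j (\<lambda>x. G x y t) x \<le> CG * t powr (- ((?N + real j) / d))
        * (1 + t powr (- (1 / d)) * norm (x - y)) powr (- ?N - L - real j)"
    using assms(1) unfolding admissible_kernel_def by blast
  have str: "continuous_on (UNIV \<times> {0..} \<times> jets m) (\<lambda>(x, t, z). F x t z)" "J \<subseteq> {0..m}" "\<forall>j\<in>J. 0 < p j"
    "- 1 < A" "1 < P" "Q < d * (1 + A)"
    and Fb: "\<And>x t z. 0 \<le> t \<Longrightarrow> z \<in> jets m \<Longrightarrow> ereal \<bar>F x t z\<bar> \<le> time_power t A * ereal (\<Prod>j\<in>J. L2_set z (indices j) powr p j)"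
    using assms(2) by (auto simp: structure_condition_def P_def Q_def)
  have N: "1 \<le> ?N" using DIM_positive[where 'a='a] by linarith
  define \<delta> where "\<delta> = 1 + A - Q / d - ?N * (P - 1) / d"
  define \<beta> where "\<beta> = ?N / (d * r0)"
  have r0': "r0 = ?N * (P - 1) / (d * (1 + A) - Q)" by (simp add: r0 r_crit_def P_def Q_def)
  have less: "?N * (P - 1) < d * (1 + A) - Q"
    using \<open>r0 < 1\<close> str(6) by (simp add: r0' divide_less_eq)
  have \<delta>: "0 < \<delta>"
  proof -
    have "\<delta> = (d * (1 + A) - Q - ?N * (P - 1)) / d" using d by (simp add: \<delta>_def field_simps)
    then show ?thesis using less d by simp
  qed
  have \<beta>: "\<beta> = (d * (1 + A) - Q) / (d * (P - 1))"
    using N str(5,6) d by (simp add: \<beta>_def r0')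
  \<comment> \<open>The scaling identity: it cancels \<open>T powr \<delta>\<close> in the smallness
    condition, so that one \<gamma> works for all \<open>T\<close>.\<close>
  have exps: "(?N / d - \<beta>) * (P - 1) = - \<delta>"
    using str(5) d by (simp add: \<beta> \<delta>_def) (simp add: field_simps)
  then have neg: "?N / d - \<beta> < 0"
    using \<delta> str(5) by (metis diff_gt_0_iff_gt mult_less_cancel_right_pos mult_zero_left neg_less_0_iff_less)
  define jc where "jc = jet_const ?N m d L CG"
  define uc where "uc = uloc_const ?N L"
  define pc where "pc = potential_const ?N m d L \<delta>"
  define \<omega> where "\<omega> = unit_ball_vol ?N"
  have \<omega>: "0 < \<omega>" and uc: "0 < uc" using mL by (auto simp: \<omega>_def uc_def uloc_const_pos)
  have "real m / d < 1" using mL d by simp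
  then have pc: "0 \<le> pc"
    unfolding pc_def potential_const_def using \<delta> mL by (intro mult_nonneg_nonneg conv_const_ge_0) auto
  \<comment> \<open>The left side of the smallness condition is
    \<open>X * M powr (P - 1) * T powr \<delta>\<close>.\<close>
  define X where "X = \<bar>a0\<bar> * (jc powr P * uc powr (P - 1)) * pc"
  have X: "0 \<le> X" using pc by (simp add: X_def)
  \<comment> \<open>Chosen such that
    \<open>(\<gamma> * \<omega>) powr (P - 1) = 1 / (X + 1)\<close>, which turns the smallness
    condition into \<open>X / (X + 1) \<le> 1\<close>; the summand 1 allows
    \<open>X = 0\<close>.\<close>
  define \<gamma> where "\<gamma> = (1 / (X + 1)) powr (1 / (P - 1)) / \<omega>"
  have \<gamma>: "0 < \<gamma>" using X \<omega> by (simp add: \<gamma>_def)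
  \<comment> \<open>The hypothesis on averages converted into masses: \<gamma> times the power
    \<open>- \<beta>\<close> of \<open>T\<close>, multiplied by the volume of a ball of radius
    \<open>T powr (1 / d)\<close>.\<close>
  define b where "b T = \<gamma> * \<omega> * T powr (?N / d - \<beta>)" for T
  have b_pos: "0 < b T" if "0 < T" for T using that \<gamma> \<omega> by (simp add: b_def)
  have b_mono: "b T' \<le> b T" if "0 < T" "T \<le> T'" for T T'
    unfolding b_def using that neg \<gamma> \<omega> by (intro mult_left_mono powr_mono2') auto
  have small: "\<bar>a0\<bar> * (jc powr P * (uc * M) powr (P - 1)) * pc * T powr \<delta> \<le> 1"
    if "0 < T" "0 \<le> M" "M \<le> b T" for T M
  proof -
    have "M powr (P - 1) \<le> b T powr (P - 1)" using that str(5) by (intro powr_mono2) auto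
    also have "\<dots> = (\<gamma> * \<omega>) powr (P - 1) * T powr ((?N / d - \<beta>) * (P - 1))"
      using \<gamma> \<omega> by (simp add: b_def powr_mult powr_powr)
    also have "\<gamma> * \<omega> = (1 / (X + 1)) powr (1 / (P - 1))" using \<omega> by (simp add: \<gamma>_def)
    also have "\<dots> powr (P - 1) = 1 / (X + 1)" using X str(5) by (simp add: powr_powr)
    finally have Mle: "M powr (P - 1) \<le> 1 / (X + 1) * T powr - \<delta>" unfolding exps .
    have "\<bar>a0\<bar> * (jc powr P * (uc * M) powr (P - 1)) * pc * T powr \<delta> = X * M powr (P - 1) * T powr \<delta>"
      using uc that by (simp add: X_def powr_mult mult_ac)
    also have "\<dots> \<le> X * (1 / (X + 1) * T powr - \<delta>) * T powr \<delta>"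
      using Mle X by (intro mult_right_mono mult_left_mono) auto
    also have "\<dots> = X / (X + 1)" using that by (simp add: powr_minus)
    also have "\<dots> \<le> 1" using X by simp
    finally show ?thesis .
  qed
  define B where "B = 2 * CG * ?N ^ m * uc"
  have B: "0 < B" using CG uc N by (simp add: B_def)
  have solve: "\<exists>u. is_solution m a0 G F \<phi> T u \<and>
      (\<forall>x. \<forall>t\<in>{0<..<T}. \<forall>j\<le>m. grad_norm j (\<lambda>x. u x t) x \<le> B * M * t powr (- (?N / d) - real j / d))"
    if T: "0 < T" "ereal T \<le> Tstar" and M: "0 \<le> M" "M \<le> b T" and \<phi>: "locally_integrable \<phi>"
      and uloc: "\<And>z. (\<integral>\<^sup>+y\<in>ball z (T powr (1 / d)). ennreal \<bar>\<phi> y\<bar> \<partial>lborel) \<le> ennreal M"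
    for T M and \<phi> :: "'a \<Rightarrow> real"
  proof -
    have lt: "ereal t < Tstar" if "t < T" for t using T that less_le_trans[of "ereal t" "ereal T" Tstar] by simp
    note \<phi>m = locally_integrable_measurable[OF \<phi>]
    \<comment> \<open>The estimates are carried out for a Borel version of the datum;
      \<open>exists_solution\<close> returns to \<phi> itself.\<close>
    obtain \<psi> where \<psi>: "\<psi> \<in> borel_measurable borel" and ae: "AE y in lborel. \<phi> y = \<psi> y"
      using completion_ex_borel_measurable_real[OF \<phi>m] by auto
    have ul: "(\<integral>\<^sup>+y\<in>ball z (T powr (1 / d)). ennreal \<bar>\<psi> y\<bar> \<partial>lborel) \<le> ennreal M" for z
    proof -
      have "(\<integral>\<^sup>+y\<in>ball z (T powr (1 / d)). ennreal \<bar>\<psi> y\<bar> \<partial>lborel) = (\<integral>\<^sup>+y\<in>ball z (T powr (1 / d)). ennreal \<bar>\<phi> y\<bar> \<partial>lborel)"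
        using ae by (intro nn_integral_cong_AE) (auto elim: eventually_mono)
      then show ?thesis using uloc by simp
    qed
    let ?\<Gamma> = "\<lambda>bs x y t. pderivs bs (\<lambda>x. G x y t) x"
    let ?\<kappa> = "jc powr P * (uc * M) powr (P - 1)"
    interpret nonlinear_problem ?\<Gamma> m d L CG T \<delta> M \<psi> a0 A ?\<kappa> F J p
    proof unfold_locales
      fix bs :: "'a list" and j and x y :: 'a and t :: real
      assume bs: "bs \<in> indices j" "j \<le> m" and t: "0 < t" "t < T"
      let ?\<tau> = "t powr (1 / d)"
      have "\<bar>?\<Gamma> bs x y t\<bar> \<le> grad_norm j (\<lambda>x. G x y t) x"
        unfolding grad_norm_def
        using member_le_L2_set[of "indices j" bs "\<lambda>bs. \<bar>?\<Gamma> bs x y t\<bar>"] bs by (simp add: finite_indices L2_set_def)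
      also have "\<dots> \<le> CG * t powr (- ((?N + real j) / d)) * (1 + t powr (- (1 / d)) * norm (x - y)) powr (- ?N - L - real j)"
        using t bs lt by (intro Gb) auto
      \<comment> \<open>The additional decay of order \<open>j\<close> is given up; this only
        enlarges the bound because the base is at least 1.\<close>
      also have "\<dots> \<le> CG * t powr (- ((?N + real j) / d)) * (1 + t powr (- (1 / d)) * norm (x - y)) powr (- (?N + L))"
        using CG by (intro mult_left_mono powr_mono) auto
      \<comment> \<open>Taking the length scale out of the bracket produces
        \<open>t powr ((N + L) / d)\<close>, which together with the prefactor leaves
        \<open>t powr - (j / d)\<close> and the factor \<open>?\<tau> powr L\<close> of
        \<open>pker\<close>.\<close>
      also have "1 + t powr (- (1 / d)) * norm (x - y) = (?\<tau> + norm (x - y)) * t powr (- (1 / d))"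
        using t by (simp add: distrib_right powr_minus field_simps)
      also have "\<dots> powr (- (?N + L)) = (?\<tau> + norm (x - y)) powr (- (?N + L)) * t powr ((?N + L) / d)"
        by (simp add: powr_mult powr_powr) (simp add: minus_divide_left add.commute)
      also have "CG * t powr (- ((?N + real j) / d)) * ((?\<tau> + norm (x - y)) powr (- (?N + L)) * t powr ((?N + L) / d))
         = CG * (t powr (- ((?N + real j) / d)) * t powr ((?N + L) / d)) * (?\<tau> + norm (x - y)) powr (- (?N + L))"
        by (simp only: mult_ac)
      also have "t powr (- ((?N + real j) / d)) * t powr ((?N + L) / d) = t powr - (real j / d) * ?\<tau> powr L"
        by (simp add: powr_add[symmetric] powr_powr add_divide_distrib)
      finally show "\<bar>?\<Gamma> bs x y t\<bar> \<le> CG * t powr - (real j / d) * pker L ?\<tau> (x - y)"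
        by (simp add: pker_def mult_ac)
    next
      fix x :: 'a and t :: real and z :: "'a list \<Rightarrow> real" assume t: "0 < t" and z: "z \<in> jets m"
      have "ereal \<bar>F x t z\<bar> \<le> ereal (t powr A * (\<Prod>j\<in>J. L2_set z (indices j) powr p j))"
        using Fb[of t z x] t z by (simp add: time_power_def)
      then show "\<bar>F x t z\<bar> \<le> t powr A * (\<Prod>j\<in>J. L2_set z (indices j) powr p j)" by simp
    next
      show "\<bar>a0\<bar> * ?\<kappa> * potential_const ?N m d L \<delta> * T powr \<delta> \<le> 1"
        using small[OF T(1) M] by (simp add: pc_def)
    qed (use mL CG T \<delta> M \<psi> ul str admissible_kernelD[OF assms(1) T(2)] in
          \<open>auto simp: P_def Q_def \<delta>_def jc_def uc_def\<close>)
    have "AE y in lebesgue. \<phi> y = \<psi> y" using ae by (rule AE_completion)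
    from exists_solution[OF \<phi>m this] show ?thesis by (simp add: B_def uc_def)
  qed
  show ?thesis
  proof (rule exI[of _ \<gamma>], intro conjI \<gamma> allI impI)
    fix \<phi> :: "'a \<Rightarrow> real" assume \<phi>: "locally_integrable \<phi>"
    define adm where "adm T \<longleftrightarrow> 0 < T \<and> ereal T \<le> Tstar \<and>
        (SUP x. ereal (ball_average (\<lambda>y. \<bar>\<phi> y\<bar>) x (T powr (1 / d)))) \<le> ereal (\<gamma> * T powr (- \<beta>))" for T
    have uloc: "(\<integral>\<^sup>+y\<in>ball z (T powr (1 / d)). ennreal \<bar>\<phi> y\<bar> \<partial>lborel) \<le> ennreal (b T)" if "adm T" for T z
    proof -
      have T: "0 < T" using that by (simp add: adm_def)
      have "ereal (ball_average (\<lambda>y. \<bar>\<phi> y\<bar>) z (T powr (1 / d))) \<le> (SUP x. ereal (ball_average (\<lambda>y. \<bar>\<phi> y\<bar>) x (T powr (1 / d))))"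
        by (rule SUP_upper) simp
      also have "\<dots> \<le> ereal (\<gamma> * T powr (- \<beta>))" using that by (simp add: adm_def)
      finally have "ball_average (\<lambda>y. \<bar>\<phi> y\<bar>) z (T powr (1 / d)) \<le> \<gamma> * T powr (- \<beta>)" by simp
      from nn_integral_ball_le[OF \<phi> _ this]
      have "(\<integral>\<^sup>+y\<in>ball z (T powr (1 / d)). ennreal \<bar>\<phi> y\<bar> \<partial>lborel)
         \<le> ennreal (\<gamma> * T powr (- \<beta>) * (\<omega> * (T powr (1 / d)) ^ DIM('a)))"
        using T by (simp add: \<omega>_def)
      also have "(T powr (1 / d)) ^ DIM('a) = T powr (?N / d)"
        using T by (simp add: powr_realpow[symmetric] powr_powr)
      also have "\<gamma> * T powr (- \<beta>) * (\<omega> * T powr (?N / d)) = b T"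
        by (simp add: b_def diff_conv_add_uminus powr_add del: add_uminus_conv_diff)
      finally show ?thesis .
    qed
    show "\<exists>C>0. \<forall>T>0. ereal T \<le> Tstar \<longrightarrow>
        (SUP x. ereal (ball_average (\<lambda>y. \<bar>\<phi> y\<bar>) x (T powr (1 / d)))) \<le> ereal (\<gamma> * T powr (- (?N / (d * r0)))) \<longrightarrow>
        (\<exists>u. is_solution m a0 G F \<phi> T u \<and>
             (\<forall>x. \<forall>t\<in>{0<..<T}. \<forall>j\<le>m. grad_norm j (\<lambda>x. u x t) x \<le> C * t powr (- (?N / d) - real j / d)))"
    proof (cases "\<exists>T. adm T")
      case False
      \<comment> \<open>With no admissible \<open>T\<close> the claim is vacuous, and any positive
        constant serves.\<close>
      then show ?thesis unfolding adm_def \<beta>_def by (intro exI[of _ 1]) auto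
    next
      case True
      then obtain T0 where T0: "adm T0" by blast
      then have T0_pos: "0 < T0" by (simp add: adm_def)
      text \<open>The mass in balls of radius \<open>T powr (1 / d)\<close> increases with \<open>T\<close> and its admissible bound \<open>b T\<close>
        decreases, so any one admissible \<open>T0\<close> yields a bound that is valid for all admissible \<open>T\<close>.\<close>
      have main: "\<exists>u. is_solution m a0 G F \<phi> T u \<and>
             (\<forall>x. \<forall>t\<in>{0<..<T}. \<forall>j\<le>m. grad_norm j (\<lambda>x. u x t) x \<le> (B * b T0) * t powr (- (?N / d) - real j / d))"
        if T: "adm T" for T
      proof -
        have T_pos: "0 < T" "ereal T \<le> Tstar" using T by (auto simp: adm_def)
        \<comment> \<open>The entry \<open>b T\<close> provides the smallness condition at
          \<open>T\<close>; the entry \<open>b T0\<close> provides the constant, which must not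
          depend on \<open>T\<close>.\<close>
        define M where "M = min (b T) (b T0)"
        have M: "0 \<le> M" "M \<le> b T" "M \<le> b T0"
          using b_pos[OF T_pos(1)] b_pos[OF T0_pos] by (auto simp: M_def)
        have ul: "(\<integral>\<^sup>+y\<in>ball z (T powr (1 / d)). ennreal \<bar>\<phi> y\<bar> \<partial>lborel) \<le> ennreal M" for z
        proof (cases "T0 \<le> T")
          case True
          then show ?thesis using uloc[OF T] b_mono[OF T0_pos True] by (simp add: M_def min_def)
        next
          case False
          then have "T powr (1 / d) \<le> T0 powr (1 / d)" using T_pos d by (intro powr_mono2) auto
          then have "(\<integral>\<^sup>+y\<in>ball z (T powr (1 / d)). ennreal \<bar>\<phi> y\<bar> \<partial>lborel) \<le> (\<integral>\<^sup>+y\<in>ball z (T0 powr (1 / d)). ennreal \<bar>\<phi> y\<bar> \<partial>lborel)"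
            by (intro nn_integral_mono mult_left_mono) (auto simp: indicator_def)
          also have "\<dots> \<le> ennreal (b T0)" by (rule uloc[OF T0])
          finally show ?thesis using b_mono[OF T_pos(1), of T0] False by (simp add: M_def min_def)
        qed
        obtain u where u: "is_solution m a0 G F \<phi> T u"
          "\<And>x t j. t \<in> {0<..<T} \<Longrightarrow> j \<le> m \<Longrightarrow> grad_norm j (\<lambda>x. u x t) x \<le> B * M * t powr (- (?N / d) - real j / d)"
          using solve[OF T_pos M(1,2) \<phi> ul] by blast
        moreover have "B * M * t powr e \<le> B * b T0 * t powr e" for t e :: real
          using M B by (intro mult_right_mono mult_left_mono) auto
        ultimately show ?thesis by (meson order_trans)
      qed
      have "0 < B * b T0" using B b_pos[OF T0_pos] by simp
      then show ?thesis using main unfolding adm_def \<beta>_def by (intro exI[of _ "B * b T0"]) auto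
    qed
  qed
qed

end
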